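(* Let $(G,G')$ be one of the three dual pairs described in the context (in the stable range). Let $\mathbb{O}'\subset\mathfrak{s}'$ be a nilpotent $K'_{\mathbb{C}}$-orbit, with closure $\overline{\mathbb{O}'}$. Then the scheme-theoretic fiber $\psi^{-1}(\overline{\mathbb{O}'})=W\times_{\mathfrak{s}'}\overline{\mathbb{O}'}$ (fiber product of $\psi:W\to\mathfrak{s}'$ with the inclusion of the reduced closed subvariety $\overline{\mathbb{O}'}\subset\mathfrak{s}'$) is a reduced, closed, irreducible affine subvariety of $W$. Moreover, it is the closure of a single $K_{\mathbb{C}}\times K'_{\mathbb{C}}$-orbit in $W$.
   Context: Everything is over $\mathbb{C}$. $M_{a,b}$ is the space of complex $a\times b$ matrices, $\mathrm{Sym}_n$, $\mathrm{Alt}_n$ the symmetric and alternating $n\times n$ matrices, ${}^tA$ the transpose, ${}^tg^{-1}=({}^tg)^{-1}$. All parameters $p,q,m,n$ are positive integers. $(G,G')$ is one of the following pairs; $K_{\mathbb{C}}$, $K'_{\mathbb{C}}$ are complexified maximal compact subgroups of $G,G'$; $W=W^+\oplus W^-$, $\mathfrak{s}$ and $\mathfrak{s}'=\mathfrak{s}'_+\oplus\mathfrak{s}'_-$ are the vector spaces below; $\varphi:W\to\mathfrak{s}$ and $\psi:W\to\mathfrak{s}'$ are the moment maps. Case 1: $G=O(p,q)$, $G'=Sp(2n,\mathbb{R})$, $2n<\min(p,q)$. $K_{\mathbb{C}}=O(p,\mathbb{C})\times O(q,\mathbb{C})$, $K'_{\mathbb{C}}=GL_n(\mathbb{C})$;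 $W^+=M_{p,n}\ni A$, $W^-=M_{q,n}\ni B$; $\mathfrak{s}=M_{p,q}$, $\mathfrak{s}'_\pm=\mathrm{Sym}_n$. Actions: $(k_1,k_2,g)\cdot(A,B)=(k_1A\,{}^tg,\;k_2Bg^{-1})$; $(k_1,k_2)\cdot Z=k_1Zk_2^{-1}$ on $\mathfrak{s}$; $g\cdot(X,Y)=(gX\,{}^tg,\;{}^tg^{-1}Yg^{-1})$ on $\mathfrak{s}'$. $\varphi(A,B)=A\,{}^tB$, $\psi(A,B)=({}^tAA,\,{}^tBB)$. Case 2: $G=U(p,q)$, $G'=U(m,n)$, $m+n\le\min(p,q)$. $K_{\mathbb{C}}=GL_p(\mathbb{C})\times GL_q(\mathbb{C})$, $K'_{\mathbb{C}}=GL_m(\mathbb{C})\times GL_n(\mathbb{C})$; $W^+=M_{p,m}\oplus M_{p,n}\ni(A,B)$, $W^-=M_{q,m}\oplus M_{q,n}\ni(C,D)$; $\mathfrak{s}=M_{p,q}\oplus M_{q,p}$, $\mathfrak{s}'_+=M_{m,n}$, $\mathfrak{s}'_-=M_{n,m}$. Actions: $((g_1,g_2),(h_1,h_2))\cdot(A,B,C,D)=(g_1A\,{}^th_1,\;{}^tg_1^{-1}Bh_2^{-1},\;{}^tg_2^{-1}Ch_1^{-1},\;g_2D\,{}^th_2)$; $(g_1,g_2)\cdot(Z_1,Z_2)=(g_1Z_1g_2^{-1},g_2Z_2g_1^{-1})$; $(h_1,h_2)\cdot(X,Y)=(h_1Xh_2^{-1},h_2Yh_1^{-1})$. $\varphi(A,B,C,D)=(A\,{}^tC,\,D\,{}^tB)$,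 $\psi(A,B,C,D)=({}^tAB,\,{}^tDC)$. Case 3: $G=Sp(p,q)$, $G'=O^*(2n)$, $n\le\min(p,q)$. With $J_p=\begin{pmatrix}0&1_p\\ -1_p&0\end{pmatrix}$: $K_{\mathbb{C}}=Sp(2p,\mathbb{C})\times Sp(2q,\mathbb{C})$, $K'_{\mathbb{C}}=GL_n(\mathbb{C})$; $W^+=M_{2p,n}\ni A$, $W^-=M_{2q,n}\ni B$; $\mathfrak{s}=M_{2p,2q}$, $\mathfrak{s}'_\pm=\mathrm{Alt}_n$. Actions: $(k_1,k_2,g)\cdot(A,B)=(k_1A\,{}^tg,\;{}^tk_2^{-1}Bg^{-1})$; $(k_1,k_2)\cdot Z=k_1Zk_2^{-1}$; $g\cdot(X,Y)=(gX\,{}^tg,\;{}^tg^{-1}Yg^{-1})$. $\varphi(A,B)=A\,{}^tB$, $\psi(A,B)=({}^tAJ_pA,\,{}^tBJ_qB)$. In all cases an element $(X,Y)\in\mathfrak{s}'=\mathfrak{s}'_+\oplus\mathfrak{s}'_-$ is nilpotent iff the block matrix $\begin{pmatrix}0&X\\ Y&0\end{pmatrix}$ is nilpotent; a nilpotent $K'_{\mathbb{C}}$-orbit in $\mathfrak{s}'$ is an orbit consisting of nilpotent elements. *)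

theory Defs
  imports
    "HOL-Analysis.Abstract_Topology"
    "HOL-Algebra.QuotRing"
    "HOL-Algebra.Group_Action"
    "Jordan_Normal_Form.Matrix"
begin

section \<open>Affine varieties, closed subschemes and fibers\<close>

text \<open>
  An embedded complex affine variety is a set of points together with the coordinate functions of
  an ambient affine space. Its regular functions are the restrictions to the set of points of the
  polynomials in the coordinate functions; they are represented extensionally, so that two regular
  functions are equal iff they agree on all points. For a vector space (with linear coordinates)
  this is the polynomial ring, because the complex numbers are infinite.
\<close>

record 'a variety =
  points :: "'a set"
  coords :: "('a \<Rightarrow> complex) set"

inductive_set polynomial_funs :: "('a \<Rightarrow> complex) set \<Rightarrow> ('a \<Rightarrow> complex) set"
  for X :: "('a \<Rightarrow> complex) set"
where
  const: "(\<lambda>_. c) \<in> polynomial_funs X"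
| coord: "f \<in> X \<Longrightarrow> f \<in> polynomial_funs X"
| add: "f \<in> polynomial_funs X \<Longrightarrow> g \<in> polynomial_funs X \<Longrightarrow> (\<lambda>x. f x + g x) \<in> polynomial_funs X"
| mult: "f \<in> polynomial_funs X \<Longrightarrow> g \<in> polynomial_funs X \<Longrightarrow> (\<lambda>x. f x * g x) \<in> polynomial_funs X"

definition coordinate_ring :: "'a variety \<Rightarrow> ('a \<Rightarrow> complex) ring" where
  "coordinate_ring V = \<lparr>
     carrier = (\<lambda>f. restrict f (points V)) ` polynomial_funs (coords V),
     monoid.mult = (\<lambda>f g. \<lambda>x\<in>points V. f x * g x),
     one = (\<lambda>x\<in>points V. 1),
     zero = (\<lambda>x\<in>points V. 0),
     add = (\<lambda>f g. \<lambda>x\<in>points V. f x + g x)\<rparr>"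

definition zero_locus :: "'a variety \<Rightarrow> ('a \<Rightarrow> complex) set \<Rightarrow> 'a set" where
  "zero_locus V F = {x \<in> points V. \<forall>f\<in>F. f x = 0}"

definition zariski :: "'a variety \<Rightarrow> 'a topology" where
  "zariski V = topology (\<lambda>U. \<exists>F \<subseteq> carrier (coordinate_ring V). U = points V - zero_locus V F)"

definition vanishing_ideal :: "'a variety \<Rightarrow> 'a set \<Rightarrow> ('a \<Rightarrow> complex) set" where
  "vanishing_ideal V Z = {f \<in> carrier (coordinate_ring V). \<forall>x\<in>Z. f x = 0}"

definition pullback :: "'a variety \<Rightarrow> ('a \<Rightarrow> 'b) \<Rightarrow> ('b \<Rightarrow> complex) \<Rightarrow> ('a \<Rightarrow> complex)" where
  "pullback V \<psi> f = (\<lambda>x\<in>points V. f (\<psi> x))"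

text \<open>
  A closed subscheme of an affine variety \<open>V\<close> is given by an ideal \<open>I\<close> of its coordinate ring \<open>R\<close>: it
  is the spectrum of \<open>R Quot I\<close>. The fiber product of \<open>\<psi> : V \<rightarrow> S\<close> with the inclusion of the reduced
  closed subvariety \<open>Z \<subseteq> S\<close> is the closed subscheme of \<open>V\<close> given by the following ideal, which
  need not be a radical ideal. The lemma \<open>fiber_universal\<close> below is its universal property.
\<close>

definition fiber_ideal ::
  "'a variety \<Rightarrow> ('a \<Rightarrow> 'b) \<Rightarrow> 'b variety \<Rightarrow> 'b set \<Rightarrow> ('a \<Rightarrow> complex) set" where
  "fiber_ideal V \<psi> S Z = genideal (coordinate_ring V) (pullback V \<psi> ` vanishing_ideal S Z)"

definition spectrum :: "('a, 'm) ring_scheme \<Rightarrow> 'a set topology" where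
  "spectrum R = topology (\<lambda>U. \<exists>S \<subseteq> carrier R. U = {P. primeideal P R \<and> \<not> S \<subseteq> P})"

definition reduced_ring :: "('a, 'm) ring_scheme \<Rightarrow> bool" where
  "reduced_ring R \<longleftrightarrow>
     (\<forall>a \<in> carrier R. \<forall>k::nat. a [^]\<^bsub>R\<^esub> k = \<zero>\<^bsub>R\<^esub> \<longrightarrow> a = \<zero>\<^bsub>R\<^esub>)"

definition irreducible_space :: "'a topology \<Rightarrow> bool" where
  "irreducible_space X \<longleftrightarrow> topspace X \<noteq> {} \<and>
     (\<forall>A B. closedin X A \<longrightarrow> closedin X B \<longrightarrow> A \<union> B = topspace X \<longrightarrow>
        A = topspace X \<or> B = topspace X)"

text \<open>
  Irreducibility is required both of the scheme and of its set of closed points; for ideals of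
  polynomial rings the two are equivalent by the Nullstellensatz.
\<close>

definition reduced_irreducible_closed_subvariety ::
  "'a variety \<Rightarrow> ('a \<Rightarrow> complex) set \<Rightarrow> bool" where
  "reduced_irreducible_closed_subvariety V I \<longleftrightarrow>
     ideal I (coordinate_ring V) \<and>
     reduced_ring (coordinate_ring V Quot I) \<and>
     irreducible_space (spectrum (coordinate_ring V Quot I)) \<and>
     closedin (zariski V) (zero_locus V I) \<and>
     irreducible_space (subtopology (zariski V) (zero_locus V I))"

subsection \<open>Well-definedness\<close>

lemma cring_coordinate_ring: "cring (coordinate_ring V)"
proof (rule cringI)
  let ?R = "coordinate_ring V"
  have mem: "restrict f (points V) \<in> carrier ?R" if "f \<in> polynomial_funs (coords V)" for f
    using that by (simp add: coordinate_ring_def)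
  have obt: "\<exists>g\<in>polynomial_funs (coords V). f = restrict g (points V)" if "f \<in> carrier ?R" for f
    using that by (auto simp: coordinate_ring_def)
  have addc: "f \<oplus>\<^bsub>?R\<^esub> g \<in> carrier ?R" if fg: "f \<in> carrier ?R" "g \<in> carrier ?R" for f g
  proof -
    from obt fg obtain f' g' where *: "f' \<in> polynomial_funs (coords V)" "f = restrict f' (points V)"
      "g' \<in> polynomial_funs (coords V)" "g = restrict g' (points V)" by metis
    have "f \<oplus>\<^bsub>?R\<^esub> g = restrict (\<lambda>x. f' x + g' x) (points V)"
      by (auto simp: coordinate_ring_def * restrict_def)
    then show ?thesis using mem polynomial_funs.add * by metis
  qed
  have multc: "f \<otimes>\<^bsub>?R\<^esub> g \<in> carrier ?R" if fg: "f \<in> carrier ?R" "g \<in> carrier ?R" for f g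
  proof -
    from obt fg obtain f' g' where *: "f' \<in> polynomial_funs (coords V)" "f = restrict f' (points V)"
      "g' \<in> polynomial_funs (coords V)" "g = restrict g' (points V)" by metis
    have "f \<otimes>\<^bsub>?R\<^esub> g = restrict (\<lambda>x. f' x * g' x) (points V)"
      by (auto simp: coordinate_ring_def * restrict_def)
    then show ?thesis using mem polynomial_funs.mult * by metis
  qed
  have zeroc: "\<zero>\<^bsub>?R\<^esub> \<in> carrier ?R" and onec: "\<one>\<^bsub>?R\<^esub> \<in> carrier ?R"
    using mem[OF polynomial_funs.const[of 0]] mem[OF polynomial_funs.const[of 1]]
    by (auto simp: coordinate_ring_def)
  show "abelian_group ?R"
  proof (rule abelian_groupI)
    fix f assume f: "f \<in> carrier ?R"
    from obt[OF f] obtain f' where *: "f' \<in> polynomial_funs (coords V)" "f = restrict f' (points V)"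
      by blast
    have "restrict (\<lambda>x. - 1 * f' x) (points V) \<in> carrier ?R"
      by (intro mem polynomial_funs.mult polynomial_funs.const *)
    moreover have "restrict (\<lambda>x. - 1 * f' x) (points V) \<oplus>\<^bsub>?R\<^esub> f = \<zero>\<^bsub>?R\<^esub>"
      by (auto simp: coordinate_ring_def * restrict_def)
    ultimately show "\<exists>g\<in>carrier ?R. g \<oplus>\<^bsub>?R\<^esub> f = \<zero>\<^bsub>?R\<^esub>" by blast
    show "\<zero>\<^bsub>?R\<^esub> \<oplus>\<^bsub>?R\<^esub> f = f" by (auto simp: coordinate_ring_def * restrict_def)
  qed (use addc zeroc in \<open>auto simp: coordinate_ring_def restrict_def ac_simps\<close>)
  show "comm_monoid ?R"
  proof (rule comm_monoidI)
    fix f assume "f \<in> carrier ?R"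
    then show "\<one>\<^bsub>?R\<^esub> \<otimes>\<^bsub>?R\<^esub> f = f" by (auto simp: coordinate_ring_def restrict_def)
  qed (use multc onec in \<open>auto simp: coordinate_ring_def restrict_def ac_simps\<close>)
qed (auto simp: coordinate_ring_def restrict_def algebra_simps)

lemma openin_zariski:
  "openin (zariski V) U \<longleftrightarrow> (\<exists>F \<subseteq> carrier (coordinate_ring V). U = points V - zero_locus V F)"
proof -
  interpret cring "coordinate_ring V" by (rule cring_coordinate_ring)
  let ?L = "\<lambda>U. \<exists>F \<subseteq> carrier (coordinate_ring V). U = points V - zero_locus V F"
  have "istopology ?L"
    unfolding istopology_def
  proof (intro conjI allI impI)
    fix A B assume "?L A" "?L B"
    then obtain F G where *: "F \<subseteq> carrier (coordinate_ring V)" "A = points V - zero_locus V F"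
      "G \<subseteq> carrier (coordinate_ring V)" "B = points V - zero_locus V G" by metis
    define H where "H = {f \<otimes>\<^bsub>coordinate_ring V\<^esub> g | f g. f \<in> F \<and> g \<in> G}"
    have "H \<subseteq> carrier (coordinate_ring V)" unfolding H_def using * by blast
    moreover have "A \<inter> B = points V - zero_locus V H"
    proof -
      have "(\<forall>h\<in>H. h x = 0) \<longleftrightarrow> (\<forall>f\<in>F. f x = 0) \<or> (\<forall>g\<in>G. g x = 0)" if "x \<in> points V" for x
      proof
        assume H0: "\<forall>h\<in>H. h x = 0"
        show "(\<forall>f\<in>F. f x = 0) \<or> (\<forall>g\<in>G. g x = 0)"
        proof (rule ccontr)
          assume "\<not> ?thesis"
          then obtain f g where fg: "f \<in> F" "g \<in> G" "f x \<noteq> 0" "g x \<noteq> 0" by blast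
          then have "(f \<otimes>\<^bsub>coordinate_ring V\<^esub> g) x = 0" using H0 unfolding H_def by blast
          then show False using fg that by (simp add: coordinate_ring_def)
        qed
      next
        assume "(\<forall>f\<in>F. f x = 0) \<or> (\<forall>g\<in>G. g x = 0)"
        then show "\<forall>h\<in>H. h x = 0" using that unfolding H_def coordinate_ring_def by auto
      qed
      then show ?thesis unfolding *(2,4) zero_locus_def by fast
    qed
    ultimately show "?L (A \<inter> B)" by blast
  next
    fix K assume "\<forall>A\<in>K. ?L A"
    then obtain F where F: "\<And>A. A \<in> K \<Longrightarrow> F A \<subseteq> carrier (coordinate_ring V) \<and>
      A = points V - zero_locus V (F A)" by metis
    have "\<Union>K = points V - zero_locus V (\<Union>A\<in>K. F A)"
    proof (intro equalityI subsetI)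
      fix x assume "x \<in> \<Union>K"
      then obtain A where "A \<in> K" "x \<in> A" by blast
      then have "x \<in> points V - zero_locus V (F A)" using F by blast
      then show "x \<in> points V - zero_locus V (\<Union>A\<in>K. F A)"
        using \<open>A \<in> K\<close> by (auto simp: zero_locus_def)
    next
      fix x assume "x \<in> points V - zero_locus V (\<Union>A\<in>K. F A)"
      then obtain A where "A \<in> K" "x \<in> points V - zero_locus V (F A)"
        by (auto simp: zero_locus_def)
      then show "x \<in> \<Union>K" using F by blast
    qed
    then show "?L (\<Union>K)" using F by (intro exI[of _ "\<Union>A\<in>K. F A"]) blast
  qed
  then show ?thesis by (simp add: zariski_def)
qed

lemma topspace_zariski: "topspace (zariski V) = points V"
proof -
  have "(\<lambda>x\<in>points V. 1) \<in> carrier (coordinate_ring V)"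
    using polynomial_funs.const[of 1] by (auto simp: coordinate_ring_def)
  then have "openin (zariski V) (points V)"
    unfolding openin_zariski
    by (intro exI[of _ "{\<lambda>x\<in>points V. 1}"]) (auto simp: zero_locus_def)
  then show ?thesis
    by (metis Diff_subset openin_subset openin_topspace openin_zariski subset_antisym)
qed

lemma openin_spectrum:
  "openin (spectrum R) U \<longleftrightarrow> (\<exists>S \<subseteq> carrier R. U = {P. primeideal P R \<and> \<not> S \<subseteq> P})"
proof -
  let ?L = "\<lambda>U. \<exists>S \<subseteq> carrier R. U = {P. primeideal P R \<and> \<not> S \<subseteq> P}"
  have "istopology ?L"
    unfolding istopology_def
  proof (intro conjI allI impI)
    fix A B assume "?L A" "?L B"
    then obtain S T where *: "S \<subseteq> carrier R" "A = {P. primeideal P R \<and> \<not> S \<subseteq> P}"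
      "T \<subseteq> carrier R" "B = {P. primeideal P R \<and> \<not> T \<subseteq> P}"
      by (elim exE conjE) (rule that)
    define H where "H = {s \<otimes>\<^bsub>R\<^esub> t | s t. s \<in> S \<and> t \<in> T} \<inter> carrier R"
    have "(H \<subseteq> P) \<longleftrightarrow> S \<subseteq> P \<or> T \<subseteq> P" if P: "primeideal P R" for P
    proof -
      interpret primeideal P R by (rule P)
      show ?thesis
      proof
        assume H: "H \<subseteq> P"
        show "S \<subseteq> P \<or> T \<subseteq> P"
        proof (rule ccontr)
          assume "\<not> (S \<subseteq> P \<or> T \<subseteq> P)"
          then obtain s t where st: "s \<in> S" "s \<notin> P" "t \<in> T" "t \<notin> P" by blast
          then have c: "s \<in> carrier R" "t \<in> carrier R" using *(1,3) by auto
          then have "s \<otimes>\<^bsub>R\<^esub> t \<in> H" using st unfolding H_def by auto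
          then have "s \<otimes>\<^bsub>R\<^esub> t \<in> P" using H by (rule rev_subsetD)
          then show False using st c I_prime[of s t] by simp
        qed
      next
        assume "S \<subseteq> P \<or> T \<subseteq> P"
        then show "H \<subseteq> P"
        proof
          assume "S \<subseteq> P"
          then show ?thesis using *(3) I_r_closed unfolding H_def by auto
        next
          assume "T \<subseteq> P"
          then show ?thesis using *(1) I_l_closed unfolding H_def by auto
        qed
      qed
    qed
    then have "A \<inter> B = {P. primeideal P R \<and> \<not> H \<subseteq> P}" unfolding *(2,4) by auto
    then show "?L (A \<inter> B)" by (intro exI[of _ H] conjI) (auto simp: H_def)
  next
    fix K assume "\<forall>A\<in>K. ?L A"
    then obtain F where F: "\<And>A. A \<in> K \<Longrightarrow> F A \<subseteq> carrier R \<and>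
      A = {P. primeideal P R \<and> \<not> F A \<subseteq> P}" by metis
    have "\<Union>K = {P. primeideal P R \<and> \<not> (\<Union>A\<in>K. F A) \<subseteq> P}"
    proof (intro equalityI subsetI)
      fix P assume "P \<in> \<Union>K"
      then obtain A where "A \<in> K" "P \<in> A" by blast
      then have "P \<in> {P. primeideal P R \<and> \<not> F A \<subseteq> P}" using F by blast
      then show "P \<in> {P. primeideal P R \<and> \<not> (\<Union>A\<in>K. F A) \<subseteq> P}" using \<open>A \<in> K\<close> by blast
    next
      fix P assume "P \<in> {P. primeideal P R \<and> \<not> (\<Union>A\<in>K. F A) \<subseteq> P}"
      then obtain A where "A \<in> K" "P \<in> {P. primeideal P R \<and> \<not> F A \<subseteq> P}" by blast
      then show "P \<in> \<Union>K" using F by blast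
    qed
    then show "?L (\<Union>K)" using F by (intro exI[of _ "\<Union>A\<in>K. F A"]) blast
  qed
  then show ?thesis by (simp add: spectrum_def)
qed

lemma topspace_spectrum: "topspace (spectrum R) = {P. primeideal P R}"
proof -
  have "\<not> carrier R \<subseteq> P" if "primeideal P R" for P
  proof -
    interpret primeideal P R by (rule that)
    show ?thesis using I_notcarr a_subset by blast
  qed
  then have "{P. primeideal P R} = {P. primeideal P R \<and> \<not> carrier R \<subseteq> P}" by blast
  then have "openin (spectrum R) {P. primeideal P R}"
    unfolding openin_spectrum by blast
  moreover have "U \<subseteq> {P. primeideal P R}" if "openin (spectrum R) U" for U
    using that unfolding openin_spectrum by blast
  ultimately show ?thesis by (metis openin_subset openin_topspace subset_antisym)
qed


lemma zero_locus_genideal: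
  assumes "F \<subseteq> carrier (coordinate_ring V)"
  shows "zero_locus V (genideal (coordinate_ring V) F) = zero_locus V F"
proof -
  interpret cring "coordinate_ring V" by (rule cring_coordinate_ring)
  have "f x = 0" if x: "x \<in> points V" "\<forall>g\<in>F. g x = 0" and f: "f \<in> genideal (coordinate_ring V) F"
    for f x
  proof -
    let ?M = "{f \<in> carrier (coordinate_ring V). f x = 0}"
    have "ideal ?M (coordinate_ring V)"
    proof (rule idealI)
      show "subgroup ?M (add_monoid (coordinate_ring V))"
      proof (rule add.subgroupI)
        have "\<zero>\<^bsub>coordinate_ring V\<^esub> \<in> ?M"
          using zero_closed x(1) by (simp add: coordinate_ring_def)
        then show "?M \<noteq> {}" by blast
        fix f assume f: "f \<in> ?M"
        then have "(\<ominus>\<^bsub>coordinate_ring V\<^esub> f) \<oplus>\<^bsub>coordinate_ring V\<^esub> f = \<zero>\<^bsub>coordinate_ring V\<^esub>"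
          by (simp add: l_neg)
        then have "(\<ominus>\<^bsub>coordinate_ring V\<^esub> f) x + f x = 0"
          using x by (auto simp: coordinate_ring_def dest!: fun_cong[where x = x])
        then show "\<ominus>\<^bsub>coordinate_ring V\<^esub> f \<in> ?M" using f by simp
        fix g assume "g \<in> ?M"
        then show "f \<oplus>\<^bsub>coordinate_ring V\<^esub> g \<in> ?M"
          using f x a_closed[of f g] by (simp add: coordinate_ring_def)
      qed auto
      fix f g assume fg: "f \<in> ?M" "g \<in> carrier (coordinate_ring V)"
      show "g \<otimes>\<^bsub>coordinate_ring V\<^esub> f \<in> ?M" "f \<otimes>\<^bsub>coordinate_ring V\<^esub> g \<in> ?M"
        using fg x m_closed[of f g] m_closed[of g f] by (simp_all add: coordinate_ring_def)
    qed (rule ring_axioms)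
    moreover have "F \<subseteq> ?M" using assms x by auto
    ultimately show ?thesis using genideal_minimal[of ?M F] f by blast
  qed
  then show ?thesis using genideal_self[OF assms] by (auto simp: zero_locus_def)
qed

lemma mem_closedin_zariski_iff:
  assumes "closedin (zariski S) Z" "y \<in> points S"
  shows "y \<in> Z \<longleftrightarrow> (\<forall>f\<in>vanishing_ideal S Z. f y = 0)"
proof -
  obtain F where F: "F \<subseteq> carrier (coordinate_ring S)" "points S - Z = points S - zero_locus S F"
    and "Z \<subseteq> points S"
    using assms(1) by (auto simp: closedin_def openin_zariski topspace_zariski)
  then have "Z = zero_locus S F" by (auto simp: zero_locus_def)
  then show ?thesis using F(1) assms(2) by (auto simp: zero_locus_def vanishing_ideal_def)
qed

lemma zero_locus_fiber_ideal:
  assumes "\<psi> \<in> points V \<rightarrow> points S" "closedin (zariski S) Z"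
    and "\<And>f. f \<in> carrier (coordinate_ring S) \<Longrightarrow> pullback V \<psi> f \<in> carrier (coordinate_ring V)"
  shows "zero_locus V (fiber_ideal V \<psi> S Z) = {x \<in> points V. \<psi> x \<in> Z}"
proof -
  have "pullback V \<psi> ` vanishing_ideal S Z \<subseteq> carrier (coordinate_ring V)"
    using assms(3) by (auto simp: vanishing_ideal_def)
  then have "zero_locus V (fiber_ideal V \<psi> S Z) = zero_locus V (pullback V \<psi> ` vanishing_ideal S Z)"
    unfolding fiber_ideal_def by (rule zero_locus_genideal)
  also have "\<dots> = {x \<in> points V. \<forall>f\<in>vanishing_ideal S Z. f (\<psi> x) = 0}"
    by (auto simp: zero_locus_def pullback_def)
  also have "\<dots> = {x \<in> points V. \<psi> x \<in> Z}"
    using mem_closedin_zariski_iff[OF assms(2)] assms(1) by blast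
  finally show ?thesis .
qed

text \<open>
  The quotient by the fiber ideal is the pushout (in commutative rings) of the coordinate rings of
  \<open>V\<close> and of \<open>Z\<close> over that of \<open>S\<close>.
\<close>

lemma fiber_cocone:
  assumes \<psi>: "\<And>f. f \<in> carrier (coordinate_ring S) \<Longrightarrow> pullback V \<psi> f \<in> carrier (coordinate_ring V)"
    and fg: "f \<in> carrier (coordinate_ring S)" "g \<in> carrier (coordinate_ring S)"
    and eq: "restrict f Z = restrict g Z" and Z: "Z \<subseteq> points S" "\<psi> \<in> points V \<rightarrow> points S"
  shows "fiber_ideal V \<psi> S Z +>\<^bsub>coordinate_ring V\<^esub> pullback V \<psi> f =
    fiber_ideal V \<psi> S Z +>\<^bsub>coordinate_ring V\<^esub> pullback V \<psi> g"
proof -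
  interpret V: cring "coordinate_ring V" by (rule cring_coordinate_ring)
  interpret S: cring "coordinate_ring S" by (rule cring_coordinate_ring)
  let ?I = "fiber_ideal V \<psi> S Z" and ?d = "f \<ominus>\<^bsub>coordinate_ring S\<^esub> g"
  have sub: "pullback V \<psi> ` vanishing_ideal S Z \<subseteq> carrier (coordinate_ring V)"
    using \<psi> by (auto simp: vanishing_ideal_def)
  interpret I: ideal ?I "coordinate_ring V"
    unfolding fiber_ideal_def by (rule V.genideal_ideal[OF sub])
  have d: "?d \<in> carrier (coordinate_ring S)" using fg by simp
  have fd: "f = ?d \<oplus>\<^bsub>coordinate_ring S\<^esub> g" using fg by (simp add: S.minus_eq S.a_assoc S.l_neg)
  have fx: "f x = ?d x + g x" if "x \<in> points S" for x
    using that fun_cong[OF fd, of x] by (simp add: coordinate_ring_def)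
  have "?d \<in> vanishing_ideal S Z"
    unfolding vanishing_ideal_def
  proof (intro CollectI conjI ballI d)
    fix x assume x: "x \<in> Z"
    then have "f x = g x" using fun_cong[OF eq, of x] by simp
    then show "?d x = 0" using fx[of x] x Z(1) by auto
  qed
  then have dI: "pullback V \<psi> ?d \<in> ?I" using V.genideal_self[OF sub] by (auto simp: fiber_ideal_def)
  have "pullback V \<psi> f = pullback V \<psi> ?d \<oplus>\<^bsub>coordinate_ring V\<^esub> pullback V \<psi> g"
    using fx Z by (auto simp: pullback_def coordinate_ring_def restrict_def fun_eq_iff Pi_iff)
  then have "pullback V \<psi> f \<in> ?I +>\<^bsub>coordinate_ring V\<^esub> pullback V \<psi> g"
    using dI by (auto simp: a_r_coset_def')
  then show ?thesis by (rule I.a_repr_independence'[OF _ \<psi>[OF fg(2)], symmetric])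
qed

lemma fiber_universal:
  assumes T: "cring T"
    and \<psi>: "\<And>f. f \<in> carrier (coordinate_ring S) \<Longrightarrow> pullback V \<psi> f \<in> carrier (coordinate_ring V)"
    and Z: "Z \<subseteq> points S"
    and \<alpha>: "\<alpha> \<in> Ring.ring_hom (coordinate_ring V) T"
    and \<beta>: "\<beta> \<in> Ring.ring_hom (coordinate_ring (S\<lparr>points := Z\<rparr>)) T"
    and compat: "\<And>f. f \<in> carrier (coordinate_ring S) \<Longrightarrow> \<alpha> (pullback V \<psi> f) = \<beta> (restrict f Z)"
  defines "R \<equiv> coordinate_ring V" and "I \<equiv> fiber_ideal V \<psi> S Z"
  shows "\<exists>!h. h \<in> Ring.ring_hom (R Quot I) T \<and> h \<in> extensional (carrier (R Quot I)) \<and>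
    (\<forall>f \<in> carrier R. h (I +>\<^bsub>R\<^esub> f) = \<alpha> f) \<and>
    (\<forall>f \<in> carrier (coordinate_ring S). h (I +>\<^bsub>R\<^esub> pullback V \<psi> f) = \<beta> (restrict f Z))"
proof -
  interpret R: cring R unfolding R_def by (rule cring_coordinate_ring)
  interpret T: cring T by (rule T)
  interpret Z: cring "coordinate_ring (S\<lparr>points := Z\<rparr>)" by (rule cring_coordinate_ring)
  interpret \<alpha>: ring_hom_ring R T \<alpha>
    by (rule ring_hom_ringI2[OF R.ring_axioms T.ring_axioms \<alpha>[folded R_def]])
  interpret \<beta>: ring_hom_ring "coordinate_ring (S\<lparr>points := Z\<rparr>)" T \<beta>
    by (rule ring_hom_ringI2[OF Z.ring_axioms T.ring_axioms \<beta>])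
  have sub: "pullback V \<psi> ` vanishing_ideal S Z \<subseteq> carrier R"
    using \<psi> by (auto simp: vanishing_ideal_def R_def)
  have I_gen: "I = genideal R (pullback V \<psi> ` vanishing_ideal S Z)"
    by (simp add: I_def R_def fiber_ideal_def)
  interpret I: ideal I R unfolding I_gen by (rule R.genideal_ideal[OF sub])
  have "\<alpha> (pullback V \<psi> f) = \<zero>\<^bsub>T\<^esub>" if f: "f \<in> vanishing_ideal S Z" for f
  proof -
    have "restrict f Z = \<zero>\<^bsub>coordinate_ring (S\<lparr>points := Z\<rparr>)\<^esub>"
      using f by (auto simp: vanishing_ideal_def coordinate_ring_def restrict_def)
    then show ?thesis using compat[of f] f \<beta>.hom_zero by (simp add: vanishing_ideal_def)
  qed
  then have "pullback V \<psi> ` vanishing_ideal S Z \<subseteq> a_kernel R T \<alpha>"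
    unfolding a_kernel_def' using sub by blast
  then have ker: "I \<subseteq> a_kernel R T \<alpha>"
    unfolding I_gen by (rule R.genideal_minimal[OF \<alpha>.kernel_is_ideal])
  have const: "\<alpha> x = \<alpha> f" if f: "f \<in> carrier R" and x: "x \<in> I +>\<^bsub>R\<^esub> f" for f x
  proof -
    obtain i where i: "i \<in> I" "x = i \<oplus>\<^bsub>R\<^esub> f" using x by (auto simp: a_r_coset_def')
    have "i \<in> a_kernel R T \<alpha>" using ker i(1) by (rule subsetD)
    then have "i \<in> carrier R" "\<alpha> i = \<zero>\<^bsub>T\<^esub>" unfolding a_kernel_def' by blast+
    then show ?thesis using i f by simp
  qed
  have carr: "carrier (R Quot I) = {I +>\<^bsub>R\<^esub> f | f. f \<in> carrier R}"
    by (auto simp: FactRing_def A_RCOSETS_def')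
  define h where "h = (\<lambda>C\<in>carrier (R Quot I). \<alpha> (SOME x. x \<in> C))"
  have h: "h (I +>\<^bsub>R\<^esub> f) = \<alpha> f" if f: "f \<in> carrier R" for f
  proof -
    have "(SOME x. x \<in> I +>\<^bsub>R\<^esub> f) \<in> I +>\<^bsub>R\<^esub> f"
      using I.a_rcos_self[OF f] by (rule someI[where P = "\<lambda>x. x \<in> I +>\<^bsub>R\<^esub> f"])
    then show ?thesis using const[OF f] f carr by (auto simp: h_def)
  qed
  have "h \<in> Ring.ring_hom (R Quot I) T"
  proof (rule ring_hom_memI)
    fix C assume "C \<in> carrier (R Quot I)"
    then obtain f where f: "f \<in> carrier R" "C = I +>\<^bsub>R\<^esub> f" unfolding carr by blast
    then show "h C \<in> carrier T" using h by simp
    fix D assume "D \<in> carrier (R Quot I)"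
    then obtain g where g: "g \<in> carrier R" "D = I +>\<^bsub>R\<^esub> g" unfolding carr by blast
    show "h (C \<otimes>\<^bsub>R Quot I\<^esub> D) = h C \<otimes>\<^bsub>T\<^esub> h D"
      using f g h by (simp add: FactRing_def I.rcoset_mult_add)
    show "h (C \<oplus>\<^bsub>R Quot I\<^esub> D) = h C \<oplus>\<^bsub>T\<^esub> h D"
      using f g h by (simp add: FactRing_def I.a_rcos_sum)
  next
    show "h \<one>\<^bsub>R Quot I\<^esub> = \<one>\<^bsub>T\<^esub>" using h[OF R.one_closed] by (simp add: FactRing_def)
  qed
  moreover have "h (I +>\<^bsub>R\<^esub> pullback V \<psi> f) = \<beta> (restrict f Z)" if "f \<in> carrier (coordinate_ring S)" for f
    using h[of "pullback V \<psi> f"] \<psi>[OF that] compat[OF that] by (simp add: R_def)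
  moreover have "h \<in> extensional (carrier (R Quot I))" by (simp add: h_def)
  moreover have "k = h" if "k \<in> extensional (carrier (R Quot I))"
      "\<forall>f \<in> carrier R. k (I +>\<^bsub>R\<^esub> f) = \<alpha> f" for k
    using that h carr \<open>h \<in> extensional _\<close> by (intro extensionalityI[of k _ h]) auto
  ultimately show ?thesis using h by blast
qed

section \<open>The three families of dual pairs\<close>

definition GL :: "nat \<Rightarrow> complex mat monoid" where
  "GL n = units_of (ring_mat TYPE(complex) n ())"

definition O_group :: "nat \<Rightarrow> complex mat monoid" where
  "O_group n = GL n\<lparr>carrier := {k \<in> carrier (GL n). k\<^sup>T * k = 1\<^sub>m n}\<rparr>"

definition J_mat :: "nat \<Rightarrow> complex mat" where
  "J_mat p = four_block_mat (0\<^sub>m p p) (1\<^sub>m p) (- 1\<^sub>m p) (0\<^sub>m p p)"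

definition Sp_group :: "nat \<Rightarrow> complex mat monoid" where
  "Sp_group p = GL (2 * p)\<lparr>carrier := {k \<in> carrier (GL (2 * p)). k\<^sup>T * J_mat p * k = J_mat p}\<rparr>"

definition gl_inv :: "complex mat \<Rightarrow> complex mat" where
  "gl_inv g = inv\<^bsub>GL (dim_row g)\<^esub> g"

definition mat_coords :: "nat \<Rightarrow> nat \<Rightarrow> (complex mat \<Rightarrow> complex) set" where
  "mat_coords a b = {\<lambda>A. A $$ (i, j) | i j. i < a \<and> j < b}"

definition mat_space :: "nat \<Rightarrow> nat \<Rightarrow> complex mat variety" where
  "mat_space a b = \<lparr>points = carrier_mat a b, coords = mat_coords a b\<rparr>"

definition sym_space :: "nat \<Rightarrow> complex mat variety" where
  "sym_space n = \<lparr>points = {A \<in> carrier_mat n n. A\<^sup>T = A}, coords = mat_coords n n\<rparr>"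

definition alt_space :: "nat \<Rightarrow> complex mat variety" where
  "alt_space n = \<lparr>points = {A \<in> carrier_mat n n. A\<^sup>T = - A}, coords = mat_coords n n\<rparr>"

definition prod_variety :: "'a variety \<Rightarrow> 'b variety \<Rightarrow> ('a \<times> 'b) variety" (infixr \<open>\<times>\<^sub>V\<close> 80) where
  "V \<times>\<^sub>V V' = \<lparr>points = points V \<times> points V',
     coords = {f \<circ> fst | f. f \<in> coords V} \<union> {g \<circ> snd | g. g \<in> coords V'}\<rparr>"

text \<open>
  The record below collects, for a dual pair \<open>(G, G')\<close>, the complexified maximal compact subgroups
  \<open>K\<close> and \<open>K'\<close>, the spaces \<open>W\<close> and \<open>\<ss>'\<close>, the actions of \<open>K \<times> K'\<close> on \<open>W\<close> and of \<open>K'\<close> on \<open>\<ss>'\<close>, and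
  the moment map \<open>\<psi> : W \<rightarrow> \<ss>'\<close>.
\<close>

record ('k, 'l, 'w) dual_pair =
  grp_K :: "'k monoid"
  grp_K' :: "'l monoid"
  space_W :: "'w variety"
  space_s' :: "(complex mat \<times> complex mat) variety"
  act_W :: "'k \<times> 'l \<Rightarrow> 'w \<Rightarrow> 'w"
  act_s' :: "'l \<Rightarrow> complex mat \<times> complex mat \<Rightarrow> complex mat \<times> complex mat"
  psi :: "'w \<Rightarrow> complex mat \<times> complex mat"

text \<open>\<open>(O(p,q), Sp(2n,\<real>))\<close>\<close>

definition pair_O_Sp ::
  "nat \<Rightarrow> nat \<Rightarrow> nat \<Rightarrow> (complex mat \<times> complex mat, complex mat, complex mat \<times> complex mat) dual_pair"
where
  "pair_O_Sp p q n = \<lparr>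
     grp_K = O_group p \<times>\<times> O_group q,
     grp_K' = GL n,
     space_W = mat_space p n \<times>\<^sub>V mat_space q n,
     space_s' = sym_space n \<times>\<^sub>V sym_space n,
     act_W = (\<lambda>((k1, k2), g) (A, B). (k1 * A * g\<^sup>T, k2 * B * gl_inv g)),
     act_s' = (\<lambda>g (X, Y). (g * X * g\<^sup>T, (gl_inv g)\<^sup>T * Y * gl_inv g)),
     psi = (\<lambda>(A, B). (A\<^sup>T * A, B\<^sup>T * B))\<rparr>"

text \<open>\<open>(U(p,q), U(m,n))\<close>\<close>

definition pair_U_U ::
  "nat \<Rightarrow> nat \<Rightarrow> nat \<Rightarrow> nat \<Rightarrow>
    (complex mat \<times> complex mat, complex mat \<times> complex mat,
     (complex mat \<times> complex mat) \<times> (complex mat \<times> complex mat)) dual_pair"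
where
  "pair_U_U p q m n = \<lparr>
     grp_K = GL p \<times>\<times> GL q,
     grp_K' = GL m \<times>\<times> GL n,
     space_W = (mat_space p m \<times>\<^sub>V mat_space p n) \<times>\<^sub>V (mat_space q m \<times>\<^sub>V mat_space q n),
     space_s' = mat_space m n \<times>\<^sub>V mat_space n m,
     act_W = (\<lambda>((g1, g2), (h1, h2)) ((A, B), (C, D)).
       ((g1 * A * h1\<^sup>T, (gl_inv g1)\<^sup>T * B * gl_inv h2),
        ((gl_inv g2)\<^sup>T * C * gl_inv h1, g2 * D * h2\<^sup>T))),
     act_s' = (\<lambda>(h1, h2) (X, Y). (h1 * X * gl_inv h2, h2 * Y * gl_inv h1)),
     psi = (\<lambda>((A, B), (C, D)). (A\<^sup>T * B, D\<^sup>T * C))\<rparr>"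

text \<open>\<open>(Sp(p,q), O\<^sup>*(2n))\<close>\<close>

definition pair_Sp_O ::
  "nat \<Rightarrow> nat \<Rightarrow> nat \<Rightarrow> (complex mat \<times> complex mat, complex mat, complex mat \<times> complex mat) dual_pair"
where
  "pair_Sp_O p q n = \<lparr>
     grp_K = Sp_group p \<times>\<times> Sp_group q,
     grp_K' = GL n,
     space_W = mat_space (2 * p) n \<times>\<^sub>V mat_space (2 * q) n,
     space_s' = alt_space n \<times>\<^sub>V alt_space n,
     act_W = (\<lambda>((k1, k2), g) (A, B). (k1 * A * g\<^sup>T, (gl_inv k2)\<^sup>T * B * gl_inv g)),
     act_s' = (\<lambda>g (X, Y). (g * X * g\<^sup>T, (gl_inv g)\<^sup>T * Y * gl_inv g)),
     psi = (\<lambda>(A, B). (A\<^sup>T * J_mat p * A, B\<^sup>T * J_mat q * B))\<rparr>"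

definition nilpotent_pair :: "complex mat \<times> complex mat \<Rightarrow> bool" where
  "nilpotent_pair = (\<lambda>(X, Y).
     let N = four_block_mat (0\<^sub>m (dim_row X) (dim_col Y)) X Y (0\<^sub>m (dim_row Y) (dim_col X))
     in \<exists>k. N ^\<^sub>m k = 0\<^sub>m (dim_row N) (dim_col N))"

definition nilpotent_orbits ::
  "('k, 'l, 'w) dual_pair \<Rightarrow> (complex mat \<times> complex mat) set set" where
  "nilpotent_orbits D =
     {Orb \<in> orbits (grp_K' D) (points (space_s' D)) (act_s' D). \<forall>z\<in>Orb. nilpotent_pair z}"

definition closure_fiber_ideal ::
  "('k, 'l, 'w) dual_pair \<Rightarrow> (complex mat \<times> complex mat) set \<Rightarrow> ('w \<Rightarrow> complex) set" where
  "closure_fiber_ideal D Orb =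
     fiber_ideal (space_W D) (psi D) (space_s' D) (zariski (space_s' D) closure_of Orb)"

end

theory Submission
  imports Defs "HOL-Library.Function_Algebras" "Jordan_Normal_Form.Determinant"
begin

text \<open>
  The matrix entries of \<open>\<psi>\<close> have leading monomials, for a
  suitable weight, which are pairwise coprime squarefree products. Hence the products of the entries of \<open>\<psi>\<close>
  with the monomials divisible by no leading monomial form a basis of the functions on \<open>W\<close>, and a
  function on \<open>W\<close> is a unique combination of the latter with coefficients in the functions on the target of \<open>\<psi>\<close>.
  A minor \<open>\<Delta>\<close> whose leading monomial is coprime to those of \<open>\<psi>\<close> is a nonzerodivisor modulo the fiber ideal. On
  the chart \<open>\<Delta> \<noteq> 0\<close> a point over \<open>z\<close> can be moved rationally to a point over any other \<open>z'\<close>, so that a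
  function vanishing on the part of the fiber over an orbit in the chart has coefficients vanishing on that
  orbit. Thus the fiber ideal is the vanishing ideal of the chart part of \<open>\<psi>\<^sup>-\<^sup>1(\<O>')\<close>, and this part
  lies in a single orbit: in the chart, points with the same image are conjugate under \<open>K\<close>, by
  generalized reflections for the bilinear forms and by Gauss elimination for the pairings. The orbit is
  irreducible because any two of its points lie on a rational curve.
\<close>

section \<open>Algebras of complex functions\<close>

text \<open>Reducedness is what the geometry of the chart alone cannot give: a function vanishing on
  the fiber has to be shown to lie in the ideal itself, not only in its radical. This works because
  the leading terms of the equations \<open>g p - z p\<close> do not depend on \<open>z\<close>. The
  basis for \<open>z = 0\<close> expands a function once and for all; the basis for a general
  \<open>z\<close> then shows that the same monomials remain independent on the fiber over
  \<open>z\<close>, so the coefficients vanish there one by one. This is flatness of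
  \<open>\<psi>\<close> made explicit. The minor counts as one more generator, so that
  multiplication by it merely shifts the basis and the denominators of the chart can be cancelled.
  Irreducibility cannot be inherited from the group that acts, because orthogonal groups are
  disconnected. Instead a curve is drawn in the orbit of \<open>K'\<close>, which is a product of
  general linear groups, and is lifted by correcting the segment between two points of the chart.
  The correction is the same map that clears the equations on the chart, which is why it is required
  both to be rational and to lie in the ideal of the fiber.\<close>

locale function_algebra =
  fixes P :: "'b set" and F :: "('b \<Rightarrow> complex) set"
  assumes const: "(\<lambda>_. c) \<in> F"
    and add: "f \<in> F \<Longrightarrow> g \<in> F \<Longrightarrow> (\<lambda>x. f x + g x) \<in> F"
    and mult: "f \<in> F \<Longrightarrow> g \<in> F \<Longrightarrow> (\<lambda>x. f x * g x) \<in> F"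
    and cong: "f \<in> F \<Longrightarrow> (\<And>x. x \<in> P \<Longrightarrow> f x = g x) \<Longrightarrow> g \<in> F"
begin

lemma uminus: "f \<in> F \<Longrightarrow> (\<lambda>x. - f x) \<in> F"
  using mult[OF const[of "-1"], of f] by simp

lemma diff: "f \<in> F \<Longrightarrow> g \<in> F \<Longrightarrow> (\<lambda>x. f x - g x) \<in> F"
  using add[OF _ uminus, of f g] by simp

lemma sum: "(\<And>i. i \<in> A \<Longrightarrow> f i \<in> F) \<Longrightarrow> (\<lambda>x. \<Sum>i\<in>A. f i x) \<in> F"
  by (induction A rule: infinite_finite_induct) (auto intro: const add)

lemma prod: "(\<And>i. i \<in> A \<Longrightarrow> f i \<in> F) \<Longrightarrow> (\<lambda>x. \<Prod>i\<in>A. f i x) \<in> F"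
  by (induction A rule: infinite_finite_induct) (auto intro: const mult)

lemma prod_mset: "(\<And>i. i \<in># A \<Longrightarrow> f i \<in> F) \<Longrightarrow> (\<lambda>x. \<Prod>i\<in>#A. f i x) \<in> F"
  by (induction A) (auto intro: const mult)

lemma power: "f \<in> F \<Longrightarrow> (\<lambda>x. f x ^ k) \<in> F"
  by (induction k) (auto intro: const mult)

lemma comp_polynomial_funs:
  assumes "f \<in> polynomial_funs X" "\<And>c. c \<in> X \<Longrightarrow> (\<lambda>x. c (\<phi> x)) \<in> F"
  shows "(\<lambda>x. f (\<phi> x)) \<in> F"
  using assms(1) by induction (auto intro: const add mult assms(2))

section \<open>Matrices of functions, their determinants and adjugates\<close>

definition mat_funs :: "nat \<Rightarrow> nat \<Rightarrow> ('b \<Rightarrow> complex mat) set" where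
  "mat_funs a b = {M. (\<forall>x\<in>P. M x \<in> carrier_mat a b) \<and> (\<forall>i<a. \<forall>j<b. (\<lambda>x. M x $$ (i, j)) \<in> F)}"

lemma mat_funsI:
  assumes "\<And>x. x \<in> P \<Longrightarrow> M x \<in> carrier_mat a b" "\<And>i j. i < a \<Longrightarrow> j < b \<Longrightarrow> (\<lambda>x. M x $$ (i, j)) \<in> F"
  shows "M \<in> mat_funs a b"
  using assms by (auto simp: mat_funs_def)

lemma mat_funs_carrier: "M \<in> mat_funs a b \<Longrightarrow> x \<in> P \<Longrightarrow> M x \<in> carrier_mat a b"
  by (auto simp: mat_funs_def)

lemma mat_funs_entry: "M \<in> mat_funs a b \<Longrightarrow> i < a \<Longrightarrow> j < b \<Longrightarrow> (\<lambda>x. M x $$ (i, j)) \<in> F"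
  by (auto simp: mat_funs_def)

lemma mat_funs_const: "A \<in> carrier_mat a b \<Longrightarrow> (\<lambda>_. A) \<in> mat_funs a b"
  by (intro mat_funsI const)

lemma mat_funs_mat:
  assumes "\<And>i j. i < a \<Longrightarrow> j < b \<Longrightarrow> (\<lambda>x. f x i j) \<in> F"
  shows "(\<lambda>x. mat a b (\<lambda>(i, j). f x i j)) \<in> mat_funs a b"
  by (intro mat_funsI) (use assms in auto)

lemma mat_funs_transpose: "M \<in> mat_funs a b \<Longrightarrow> (\<lambda>x. (M x)\<^sup>T) \<in> mat_funs b a"
proof (intro mat_funsI)
  fix i j assume *: "M \<in> mat_funs a b" "i < b" "j < a"
  show "(\<lambda>x. (M x)\<^sup>T $$ (i, j)) \<in> F"
    by (rule cong[OF mat_funs_entry[OF *(1,3,2)]]) (use * in \<open>auto dest!: mat_funs_carrier\<close>)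
qed (auto simp: mat_funs_def)

lemma mat_funs_mult:
  assumes "M \<in> mat_funs a b" "N \<in> mat_funs b c"
  shows "(\<lambda>x. M x * N x) \<in> mat_funs a c"
proof (intro mat_funsI)
  fix i j assume ij: "i < a" "j < c"
  have "(\<lambda>x. \<Sum>k\<in>{0..<b}. M x $$ (i, k) * N x $$ (k, j)) \<in> F"
    using assms ij by (auto intro!: sum mult mat_funs_entry)
  then show "(\<lambda>x. (M x * N x) $$ (i, j)) \<in> F"
  proof (rule cong)
    fix x assume "x \<in> P"
    with assms have "M x \<in> carrier_mat a b" "N x \<in> carrier_mat b c" by (auto dest: mat_funs_carrier)
    then show "(\<Sum>k\<in>{0..<b}. M x $$ (i, k) * N x $$ (k, j)) = (M x * N x) $$ (i, j)"
      using ij by (simp add: scalar_prod_def)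
  qed
qed (use assms in \<open>blast intro: mult_carrier_mat mat_funs_carrier\<close>)

lemma mat_funs_add:
  assumes "M \<in> mat_funs a b" "N \<in> mat_funs a b"
  shows "(\<lambda>x. M x + N x) \<in> mat_funs a b"
proof (intro mat_funsI)
  fix i j assume ij: "i < a" "j < b"
  show "(\<lambda>x. (M x + N x) $$ (i, j)) \<in> F"
    by (rule cong[OF add[OF mat_funs_entry[OF assms(1) ij] mat_funs_entry[OF assms(2) ij]]])
      (use assms ij in \<open>auto dest!: mat_funs_carrier\<close>)
qed (use mat_funs_carrier[OF assms(1)] mat_funs_carrier[OF assms(2)] in auto)

lemma mat_funs_smult:
  assumes "M \<in> mat_funs a b" "f \<in> F"
  shows "(\<lambda>x. f x \<cdot>\<^sub>m M x) \<in> mat_funs a b"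
proof (intro mat_funsI)
  fix i j assume ij: "i < a" "j < b"
  show "(\<lambda>x. (f x \<cdot>\<^sub>m M x) $$ (i, j)) \<in> F"
    by (rule cong[OF mult[OF assms(2) mat_funs_entry[OF assms(1) ij]]])
      (use assms ij in \<open>auto dest!: mat_funs_carrier\<close>)
qed (use mat_funs_carrier[OF assms(1)] in auto)

lemma det_mat_funs:
  assumes "M \<in> mat_funs n n"
  shows "(\<lambda>x. det (M x)) \<in> F"
proof -
  have "(\<lambda>x. \<Sum>\<pi>\<in>{\<pi>. \<pi> permutes {0..<n}}. signof \<pi> * (\<Prod>i\<in>{0..<n}. M x $$ (i, \<pi> i))) \<in> F"
    by (intro sum mult const prod mat_funs_entry[OF assms]) (auto simp: permutes_in_image)
  then show ?thesis
    by (rule cong) (simp add: det_def'[OF mat_funs_carrier[OF assms]])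
qed

lemma adj_mat_funs:
  assumes "M \<in> mat_funs n n"
  shows "(\<lambda>x. adj_mat (M x)) \<in> mat_funs n n"
proof (intro mat_funsI)
  fix i j assume ij: "i < n" "j < n"
  have "(\<lambda>x. mat_delete (M x) j i) \<in> mat_funs (n - 1) (n - 1)"
  proof (intro mat_funsI)
    fix i' j' assume *: "i' < n - 1" "j' < n - 1"
    have "(\<lambda>x. M x $$ (if i' < j then i' else Suc i', if j' < i then j' else Suc j')) \<in> F"
      by (rule mat_funs_entry[OF assms]) (use * in auto)
    then show "(\<lambda>x. mat_delete (M x) j i $$ (i', j')) \<in> F"
    proof (rule cong)
      fix x assume "x \<in> P"
      from mat_funs_carrier[OF assms this] have "dim_row (M x) = n" "dim_col (M x) = n" by auto
      then show "M x $$ (if i' < j then i' else Suc i', if j' < i then j' else Suc j') =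
        mat_delete (M x) j i $$ (i', j')"
        using * by (simp add: mat_delete_def)
    qed
  qed (use mat_funs_carrier[OF assms] in \<open>blast intro: mat_delete_carrier\<close>)
  then have "(\<lambda>x. (-1) ^ (j + i) * det (mat_delete (M x) j i)) \<in> F"
    by (intro mult const det_mat_funs)
  then show "(\<lambda>x. adj_mat (M x) $$ (i, j)) \<in> F"
  proof (rule cong)
    fix x assume "x \<in> P"
    from mat_funs_carrier[OF assms this] have "dim_row (M x) = n" "dim_col (M x) = n" by auto
    then show "(-1) ^ (j + i) * det (mat_delete (M x) j i) = adj_mat (M x) $$ (i, j)"
      using ij by (simp add: adj_mat_def cofactor_def)
  qed
qed (use mat_funs_carrier[OF assms] adj_mat(1) in auto)

end

text \<open>The first of three instances; regular functions on a variety and rational functions of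
  one variable follow. The facts about determinants and adjugates thus become available for all
  three at once.\<close>

lemma function_algebra_polynomial_funs: "function_algebra UNIV (polynomial_funs X)"
proof
  fix f g assume "f \<in> polynomial_funs X" "\<And>x. x \<in> UNIV \<Longrightarrow> f x = g x"
  then show "g \<in> polynomial_funs X" by (metis UNIV_I ext)
qed (auto intro: polynomial_funs.intros)

text \<open>The same functions as in \<open>coordinate_ring V\<close>, but with arbitrary values off
  \<open>points V\<close>, which avoids a \<open>restrict\<close> at each algebraic
  operation.\<close>

definition regular_funs :: "'a variety \<Rightarrow> ('a \<Rightarrow> complex) set" where
  "regular_funs V = {f. \<exists>g\<in>polynomial_funs (coords V). \<forall>x\<in>points V. f x = g x}"

lemma polynomial_funs_regular: "f \<in> polynomial_funs (coords V) \<Longrightarrow> f \<in> regular_funs V"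
  by (auto simp: regular_funs_def)

lemma function_algebra_regular_funs: "function_algebra (points V) (regular_funs V)"
proof
  fix f g assume "f \<in> regular_funs V" "g \<in> regular_funs V"
  then obtain f' g' where "f' \<in> polynomial_funs (coords V)" "\<forall>x\<in>points V. f x = f' x"
    "g' \<in> polynomial_funs (coords V)" "\<forall>x\<in>points V. g x = g' x"
    by (auto simp: regular_funs_def)
  then show "(\<lambda>x. f x + g x) \<in> regular_funs V" "(\<lambda>x. f x * g x) \<in> regular_funs V"
    unfolding regular_funs_def mem_Collect_eq
    by (intro bexI[OF _ polynomial_funs.add[of f' _ g']] bexI[OF _ polynomial_funs.mult[of f' _ g']];
        simp)+
next
  fix f g assume "f \<in> regular_funs V" "\<And>x. x \<in> points V \<Longrightarrow> f x = g x"
  then show "g \<in> regular_funs V" by (auto simp: regular_funs_def)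
qed (auto intro: polynomial_funs.intros polynomial_funs_regular)

lemma restrict_regular: "f \<in> regular_funs V \<Longrightarrow> restrict f (points V) \<in> carrier (coordinate_ring V)"
  unfolding regular_funs_def coordinate_ring_def
  by (auto intro!: ext simp: image_iff restrict_def elim!: bexI[rotated])

lemma carrier_coordinate_ringE:
  assumes "f \<in> carrier (coordinate_ring V)"
  obtains g where "g \<in> polynomial_funs (coords V)" "f = restrict g (points V)"
  using assms by (auto simp: coordinate_ring_def)

text \<open>Rational functions of one variable without poles in \<open>Z\<close>; their values at other poles are arbitrary.\<close>

definition rational_funs :: "complex set \<Rightarrow> (complex \<Rightarrow> complex) set" where
  "rational_funs Z = {\<phi>. \<exists>p q. (\<forall>z\<in>Z. poly q z \<noteq> 0) \<and> (\<forall>t. poly q t \<noteq> 0 \<longrightarrow> \<phi> t * poly q t = poly p t)}"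

lemma rational_funsE:
  assumes "\<phi> \<in> rational_funs Z"
  obtains p q where "\<And>z. z \<in> Z \<Longrightarrow> poly q z \<noteq> 0" "\<And>t. poly q t \<noteq> 0 \<Longrightarrow> \<phi> t * poly q t = poly p t"
  using assms by (auto simp: rational_funs_def)

lemma rational_funsI:
  assumes "\<And>z. z \<in> Z \<Longrightarrow> poly q z \<noteq> 0" "\<And>t. poly q t \<noteq> 0 \<Longrightarrow> \<phi> t * poly q t = poly p t"
  shows "\<phi> \<in> rational_funs Z"
  using assms by (auto simp: rational_funs_def)

lemma function_algebra_rational_funs: "function_algebra UNIV (rational_funs Z)"
proof
  fix c show "(\<lambda>_. c) \<in> rational_funs Z"
    by (rule rational_funsI[of Z 1 _ "[:c:]"]) auto
next
  fix f g assume "f \<in> rational_funs Z" "g \<in> rational_funs Z"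
  then obtain p q p' q' where *: "\<And>z. z \<in> Z \<Longrightarrow> poly q z \<noteq> 0" "\<And>t. poly q t \<noteq> 0 \<Longrightarrow> f t * poly q t = poly p t"
    "\<And>z. z \<in> Z \<Longrightarrow> poly q' z \<noteq> 0" "\<And>t. poly q' t \<noteq> 0 \<Longrightarrow> g t * poly q' t = poly p' t"
    by (metis rational_funsE)
  show "(\<lambda>x. f x + g x) \<in> rational_funs Z"
  proof (rule rational_funsI[of Z "q * q'" _ "p * q' + p' * q"])
    fix t assume "poly (q * q') t \<noteq> 0"
    then show "(f t + g t) * poly (q * q') t = poly (p * q' + p' * q) t"
      using *(2)[of t] *(4)[of t] by (simp add: algebra_simps flip: *(2,4))
  qed (use * in auto)
  show "(\<lambda>x. f x * g x) \<in> rational_funs Z"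
  proof (rule rational_funsI[of Z "q * q'" _ "p * p'"])
    fix t assume "poly (q * q') t \<noteq> 0"
    then show "(f t * g t) * poly (q * q') t = poly (p * p') t"
      using *(2)[of t] *(4)[of t] by (simp add: algebra_simps flip: *(2,4))
  qed (use * in auto)
next
  fix f g assume "f \<in> rational_funs Z" "\<And>x. x \<in> UNIV \<Longrightarrow> f x = g x"
  then show "g \<in> rational_funs Z" by (metis UNIV_I ext)
qed

lemma rational_funs_ident: "(\<lambda>t. t) \<in> rational_funs Z"
  by (rule rational_funsI[of Z 1 _ "[:0, 1:]"]) auto

text \<open>Along a path of matrices \<open>gl_inv\<close> agrees with the adjugate formula only
  where the determinant \<open>D\<close> is nonzero. Multiplying the denominator by the numerator of
  \<open>D\<close> makes the defining condition silent at the other parameters.\<close>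

lemma rational_funs_cong_nonzero:
  assumes "\<phi> \<in> rational_funs Z" "D \<in> rational_funs Z" "\<And>z. z \<in> Z \<Longrightarrow> D z \<noteq> 0"
    and "\<And>t. D t \<noteq> 0 \<Longrightarrow> \<psi> t = \<phi> t"
  shows "\<psi> \<in> rational_funs Z"
proof -
  obtain p q p' q' where *: "\<And>z. z \<in> Z \<Longrightarrow> poly q z \<noteq> 0" "\<And>t. poly q t \<noteq> 0 \<Longrightarrow> \<phi> t * poly q t = poly p t"
    "\<And>z. z \<in> Z \<Longrightarrow> poly q' z \<noteq> 0" "\<And>t. poly q' t \<noteq> 0 \<Longrightarrow> D t * poly q' t = poly p' t"
    using assms(1,2) by (metis rational_funsE)
  show ?thesis
  proof (rule rational_funsI[of Z "q * q' * p'" _ "p * q' * p'"])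
    fix z assume z: "z \<in> Z"
    then show "poly (q * q' * p') z \<noteq> 0"
      using * assms(3)[OF z] by (metis mult_eq_0_iff poly_mult)
  next
    fix t assume t: "poly (q * q' * p') t \<noteq> 0"
    then have "D t \<noteq> 0" using *(4)[of t] by auto
    then show "\<psi> t * poly (q * q' * p') t = poly (p * q' * p') t"
      using assms(4)[of t] *(2)[of t] t by (auto simp flip: *(2))
  qed
qed

lemma rational_funs_inverse:
  assumes "D \<in> rational_funs Z" "\<And>z. z \<in> Z \<Longrightarrow> D z \<noteq> 0"
  shows "(\<lambda>t. 1 / D t) \<in> rational_funs Z"
proof -
  obtain p q where *: "\<And>z. z \<in> Z \<Longrightarrow> poly q z \<noteq> 0" "\<And>t. poly q t \<noteq> 0 \<Longrightarrow> D t * poly q t = poly p t"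
    using assms(1) by (metis rational_funsE)
  show ?thesis
  proof (rule rational_funsI[of Z "q * p" _ "q * q"])
    fix z assume z: "z \<in> Z"
    then show "poly (q * p) z \<noteq> 0"
      using * assms(2)[OF z] by (metis mult_eq_0_iff poly_mult)
  next
    fix t assume t: "poly (q * p) t \<noteq> 0"
    then show "1 / D t * poly (q * p) t = poly (q * q) t"
      using *(2)[of t] by (auto simp flip: *(2))
  qed
qed

text \<open>Irreducibility of the line, in the form needed later: the two factors are evaluated at
  different points. All numerators and denominators, including those of \<open>D\<close>, multiply
  to the zero polynomial, so \<open>p\<close> or \<open>p'\<close> is zero, and a function with zero
  numerator vanishes wherever it is known to have no pole.\<close>

lemma rational_funs_mult_eq_0:
  assumes "\<phi> \<in> rational_funs Z" "\<psi> \<in> rational_funs Z" "D \<in> rational_funs Z" "z \<in> Z" "z' \<in> Z"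
    and "\<And>z. z \<in> Z \<Longrightarrow> D z \<noteq> 0" and "\<And>t. D t \<noteq> 0 \<Longrightarrow> \<phi> t * \<psi> t = 0"
  shows "\<phi> z = 0 \<or> \<psi> z' = 0"
proof -
  obtain p q where 1: "\<And>z. z \<in> Z \<Longrightarrow> poly q z \<noteq> 0" "\<And>t. poly q t \<noteq> 0 \<Longrightarrow> \<phi> t * poly q t = poly p t"
    using assms(1) by (rule rational_funsE) blast
  obtain p' q' where 2: "\<And>z. z \<in> Z \<Longrightarrow> poly q' z \<noteq> 0" "\<And>t. poly q' t \<noteq> 0 \<Longrightarrow> \<psi> t * poly q' t = poly p' t"
    using assms(2) by (rule rational_funsE) blast
  obtain p'' q'' where 3: "\<And>z. z \<in> Z \<Longrightarrow> poly q'' z \<noteq> 0" "\<And>t. poly q'' t \<noteq> 0 \<Longrightarrow> D t * poly q'' t = poly p'' t"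
    using assms(3) by (rule rational_funsE) blast
  note * = 1 2 3
  have "poly (q * q' * q'' * p'' * p * p') t = 0" for t
  proof (cases "poly (q * q' * q'' * p'') t = 0")
    case False
    then have "D t \<noteq> 0" using *(6)[of t] by auto
    then show ?thesis using assms(7)[of t] False *(2)[of t] *(4)[of t] by auto
  qed auto
  then have "q * q' * q'' * p'' * p * p' = 0" using poly_all_0_iff_0 by blast
  moreover have "q \<noteq> 0" "q' \<noteq> 0" "q'' \<noteq> 0"
    using *(1,3,5)[OF assms(4)] by auto
  moreover have "p'' \<noteq> 0"
    using *(6)[OF *(5)[OF assms(4)]] *(5)[OF assms(4)] assms(6)[OF assms(4)] by auto
  ultimately have "p = 0 \<or> p' = 0" by auto
  then show ?thesis
    using *(1)[OF assms(4)] *(2)[OF *(1)[OF assms(4)]] *(3)[OF assms(5)] *(4)[OF *(3)[OF assms(5)]]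
    by auto
qed

section \<open>Vanishing ideals of irreducible sets\<close>

lemma zero_locus_closed:
  "F \<subseteq> carrier (coordinate_ring V) \<Longrightarrow> closedin (zariski V) (zero_locus V F)"
  unfolding closedin_def topspace_zariski openin_zariski
  by (auto simp: zero_locus_def)

lemma vanishing_ideal_closure:
  assumes "A \<subseteq> points V"
  shows "vanishing_ideal V (zariski V closure_of A) = vanishing_ideal V A"
proof
  show "vanishing_ideal V (zariski V closure_of A) \<subseteq> vanishing_ideal V A"
    using closure_of_subset[of A "zariski V"] assms
    by (auto simp: vanishing_ideal_def topspace_zariski)
  show "vanishing_ideal V A \<subseteq> vanishing_ideal V (zariski V closure_of A)"
  proof
    fix f assume f: "f \<in> vanishing_ideal V A"
    then have 1: "closedin (zariski V) (zero_locus V {f})"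
      by (intro zero_locus_closed) (simp add: vanishing_ideal_def)
    have 2: "A \<subseteq> zero_locus V {f}"
      using f assms by (auto simp: vanishing_ideal_def zero_locus_def)
    have "zariski V closure_of A \<subseteq> zero_locus V {f}"
      by (rule Abstract_Topology.closure_of_minimal[OF 2 1])
    then show "f \<in> vanishing_ideal V (zariski V closure_of A)"
      using f by (auto simp: vanishing_ideal_def zero_locus_def)
  qed
qed

lemma zero_locus_vanishing_ideal:
  assumes "A \<subseteq> points V"
  shows "zero_locus V (vanishing_ideal V A) = zariski V closure_of A"
proof -
  have "zariski V closure_of A \<subseteq> points V"
    using closure_of_subset_topspace[of "zariski V" A] by (simp add: topspace_zariski)
  then show ?thesis
    using mem_closedin_zariski_iff[OF closedin_closure_of, of _ V A]
    by (auto simp: vanishing_ideal_closure[OF assms] zero_locus_def)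
qed

lemma vanishing_ideal_ideal:
  assumes "A \<subseteq> points V"
  shows "ideal (vanishing_ideal V A) (coordinate_ring V)"
proof -
  let ?R = "coordinate_ring V"
  interpret cring ?R by (rule cring_coordinate_ring)
  have ev: "(f \<oplus>\<^bsub>?R\<^esub> g) x = f x + g x" "(f \<otimes>\<^bsub>?R\<^esub> g) x = f x * g x" "\<zero>\<^bsub>?R\<^esub> x = 0" if "x \<in> A" for f g x
    using that assms by (auto simp: coordinate_ring_def)
  show ?thesis
  proof (rule idealI)
    show "subgroup (vanishing_ideal V A) (add_monoid ?R)"
    proof (rule add.subgroupI)
      have "\<zero>\<^bsub>?R\<^esub> \<in> vanishing_ideal V A"
        by (auto simp: vanishing_ideal_def ev)
      then show "vanishing_ideal V A \<noteq> {}" by blast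
    next
      fix f assume f: "f \<in> vanishing_ideal V A"
      have "(\<ominus>\<^bsub>?R\<^esub> f) x = 0" if "x \<in> A" for x
      proof -
        have "((\<ominus>\<^bsub>?R\<^esub> f) \<oplus>\<^bsub>?R\<^esub> f) x = 0"
          using f that by (simp add: vanishing_ideal_def l_neg ev)
        then show ?thesis using f that by (simp add: vanishing_ideal_def ev)
      qed
      then show "\<ominus>\<^bsub>?R\<^esub> f \<in> vanishing_ideal V A" using f by (auto simp: vanishing_ideal_def)
    qed (auto simp: vanishing_ideal_def ev)
  qed (auto simp: vanishing_ideal_def ev intro: ring_axioms)
qed

lemma (in domain) reduced_ring_domain: "reduced_ring R"
  unfolding reduced_ring_def
proof (intro ballI allI impI)
  fix a and k :: nat assume a: "a \<in> carrier R" "a [^] k = \<zero>"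
  show "a = \<zero>"
    using a(2) by (induction k) (use a(1) integral[of "a [^] _" a] in auto)
qed

text \<open>The zero ideal is the generic point: a closed set containing it is the whole spectrum,
  and of two closed sets covering the spectrum one must contain it.\<close>

lemma (in domain) irreducible_spectrum_domain: "irreducible_space (spectrum R)"
proof -
  have zero: "primeideal {\<zero>} R" by (rule zeroprimeideal)
  have full: "A = topspace (spectrum R)" if A: "closedin (spectrum R) A" "{\<zero>} \<in> A" for A
  proof -
    obtain S where S: "S \<subseteq> carrier R" "topspace (spectrum R) - A = {P. primeideal P R \<and> \<not> S \<subseteq> P}"
      using A(1) unfolding closedin_def openin_spectrum by (elim conjE exE) (rule that)
    have sub: "A \<subseteq> topspace (spectrum R)" using A(1) by (rule closedin_subset)
    have "S \<subseteq> {\<zero>}" using S(2) A(2) zero by blast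
    then have "S \<subseteq> P" if "primeideal P R" for P
    proof -
      interpret P: primeideal P R by (rule that)
      show ?thesis using \<open>S \<subseteq> {\<zero>}\<close> P.zero_closed by blast
    qed
    then show ?thesis using S(2) sub by blast
  qed
  then show ?thesis
    using zero unfolding irreducible_space_def topspace_spectrum by blast
qed

text \<open>The assumption \<open>prime\<close> makes the vanishing ideal prime, so the quotient is
  a domain, which settles reducedness and the spectrum at once. For the closed points, a proper
  closed subset of the closure of \<open>A\<close> misses a point of \<open>A\<close> and is killed
  by a function nonzero at that point; two such subsets covering the closure would give a product
  that vanishes on \<open>A\<close> although neither factor does.\<close>

lemma vanishing_ideal_irreducible:
  assumes A: "A \<subseteq> points V" "A \<noteq> {}"
    and prime: "\<And>f g. f \<in> polynomial_funs (coords V) \<Longrightarrow> g \<in> polynomial_funs (coords V) \<Longrightarrow>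
      (\<forall>x\<in>A. f x * g x = 0) \<Longrightarrow> (\<forall>x\<in>A. f x = 0) \<or> (\<forall>x\<in>A. g x = 0)"
  shows "reduced_irreducible_closed_subvariety V (vanishing_ideal V A)"
proof -
  let ?R = "coordinate_ring V" and ?I = "vanishing_ideal V A"
  interpret cring ?R by (rule cring_coordinate_ring)
  have prime': "(\<forall>x\<in>A. f x = 0) \<or> (\<forall>x\<in>A. g x = 0)"
    if fg: "f \<in> carrier ?R" "g \<in> carrier ?R" and z: "\<forall>x\<in>A. f x * g x = 0" for f g
  proof -
    obtain f' g' where *: "f' \<in> polynomial_funs (coords V)" "f = restrict f' (points V)"
      "g' \<in> polynomial_funs (coords V)" "g = restrict g' (points V)"
      using fg by (metis carrier_coordinate_ringE)
    then have eq: "f x = f' x" "g x = g' x" if "x \<in> A" for x using A(1) that by auto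
    show ?thesis using prime[OF *(1,3)] z by (simp add: eq)
  qed
  interpret I: primeideal ?I ?R
  proof (rule primeidealI)
    show "ideal ?I ?R" by (rule vanishing_ideal_ideal[OF A(1)])
    show "carrier ?R \<noteq> ?I"
    proof
      assume "carrier ?R = ?I"
      then have "\<one>\<^bsub>?R\<^esub> \<in> ?I" using one_closed by blast
      then have "\<forall>x\<in>A. \<one>\<^bsub>?R\<^esub> x = 0" by (simp add: vanishing_ideal_def)
      moreover have "\<forall>x\<in>A. \<one>\<^bsub>?R\<^esub> x = 1" using A(1) by (simp add: coordinate_ring_def subset_iff)
      ultimately show False using A(2) by auto
    qed
    fix f g assume fg: "f \<in> carrier ?R" "g \<in> carrier ?R" "f \<otimes>\<^bsub>?R\<^esub> g \<in> ?I"
    then have "\<forall>x\<in>A. (f \<otimes>\<^bsub>?R\<^esub> g) x = 0" by (simp add: vanishing_ideal_def)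
    moreover have "\<forall>x\<in>A. (f \<otimes>\<^bsub>?R\<^esub> g) x = f x * g x"
      using A(1) by (simp add: coordinate_ring_def subset_iff)
    ultimately have "\<forall>x\<in>A. f x * g x = 0" by simp
    then show "f \<in> ?I \<or> g \<in> ?I" using prime'[OF fg(1,2)] fg by (auto simp: vanishing_ideal_def)
  qed (rule is_cring)
  interpret Q: domain "?R Quot ?I" by (rule I.quotient_is_domain)
  have zl: "zero_locus V ?I = zariski V closure_of A" by (rule zero_locus_vanishing_ideal[OF A(1)])
  have Acl: "A \<subseteq> zariski V closure_of A"
    using A(1) by (intro closure_of_subset) (simp add: topspace_zariski)
  have "irreducible_space (subtopology (zariski V) (zariski V closure_of A))"
    unfolding irreducible_space_def
  proof (intro conjI allI impI)
    have top: "topspace (subtopology (zariski V) (zariski V closure_of A)) = zariski V closure_of A"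
      using closure_of_subset_topspace[of "zariski V" A] by auto
    show "topspace (subtopology (zariski V) (zariski V closure_of A)) \<noteq> {}"
      using A(2) Acl top by blast
    fix B C
    assume BC: "closedin (subtopology (zariski V) (zariski V closure_of A)) B"
      "closedin (subtopology (zariski V) (zariski V closure_of A)) C"
      "B \<union> C = topspace (subtopology (zariski V) (zariski V closure_of A))"
    have cl: "closedin (zariski V) B" "closedin (zariski V) C"
      using BC closedin_closed_subtopology[OF closedin_closure_of] by blast+
    have sub: "B \<subseteq> zariski V closure_of A" "C \<subseteq> zariski V closure_of A" using BC(3) top by auto
    have key: "D = zariski V closure_of A \<or> (\<exists>f\<in>vanishing_ideal V D. \<exists>x\<in>A. f x \<noteq> 0)"
      if D: "closedin (zariski V) D" "D \<subseteq> zariski V closure_of A" for D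
    proof (cases "A \<subseteq> D")
      case True
      then show ?thesis using Abstract_Topology.closure_of_minimal[OF True D(1)] D(2) by blast
    next
      case False
      then show ?thesis using mem_closedin_zariski_iff[OF D(1)] A(1) by blast
    qed
    show "B = topspace (subtopology (zariski V) (zariski V closure_of A)) \<or>
      C = topspace (subtopology (zariski V) (zariski V closure_of A))"
    proof (rule ccontr)
      assume "\<not> ?thesis"
      then have "B \<noteq> zariski V closure_of A" "C \<noteq> zariski V closure_of A" using top by metis+
      then obtain f x g y where *: "f \<in> vanishing_ideal V B" "x \<in> A" "f x \<noteq> 0"
        "g \<in> vanishing_ideal V C" "y \<in> A" "g y \<noteq> 0"
        using key[OF cl(1) sub(1)] key[OF cl(2) sub(2)] by (elim disjE bexE) (rule that, auto)
      have "A \<subseteq> B \<union> C" using BC(3) Acl unfolding top by blast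
      moreover have "f \<in> carrier ?R" "g \<in> carrier ?R" "\<forall>x\<in>B. f x = 0" "\<forall>x\<in>C. g x = 0"
        using *(1,4) unfolding vanishing_ideal_def by simp_all
      ultimately have "(\<forall>x\<in>A. f x = 0) \<or> (\<forall>x\<in>A. g x = 0)"
        by (intro prime') auto
      then show False
      proof
        assume "\<forall>x\<in>A. f x = 0"
        from bspec[OF this *(2)] *(3) show False by contradiction
      next
        assume "\<forall>x\<in>A. g x = 0"
        from bspec[OF this *(5)] *(6) show False by contradiction
      qed
    qed
  qed
  then show ?thesis
    unfolding reduced_irreducible_closed_subvariety_def zl
    using I.ideal_axioms Q.reduced_ring_domain Q.irreducible_spectrum_domain by simp
qed

section \<open>Monomials and leading monomials\<close>

interpretation cfun: vector_space "\<lambda>(c :: complex) (f :: 'b \<Rightarrow> complex) x. c * f x"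
  by standard (auto simp: fun_eq_iff algebra_simps)

lemma cfun_add: "f \<in> cfun.span S \<Longrightarrow> g \<in> cfun.span S \<Longrightarrow> (\<lambda>x. f x + g x) \<in> cfun.span S"
  using cfun.span_add[of f S g] by (simp add: plus_fun_def)

lemma cfun_scale: "f \<in> cfun.span S \<Longrightarrow> (\<lambda>x. c * f x) \<in> cfun.span S"
  by (rule cfun.span_scale)

lemma cfun_diff: "f \<in> cfun.span S \<Longrightarrow> g \<in> cfun.span S \<Longrightarrow> (\<lambda>x. f x - g x) \<in> cfun.span S"
  using cfun_add[OF _ cfun_scale[of g S "-1"], of f] by simp

lemma cfun_zero: "(\<lambda>x. 0) \<in> cfun.span S"
  using cfun.span_zero[of S] by (simp add: zero_fun_def)

lemma cfun_sum: "(\<And>i. i \<in> A \<Longrightarrow> f i \<in> cfun.span S) \<Longrightarrow> (\<lambda>x. \<Sum>i\<in>A. f i x) \<in> cfun.span S"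
  by (induction A rule: infinite_finite_induct) (auto intro: cfun_zero cfun_add)

lemma cfun_span_induct [consumes 1, case_names zero add base]:
  assumes "f \<in> cfun.span S" "Q (\<lambda>_. 0)"
    and "\<And>c g h. g \<in> S \<Longrightarrow> Q h \<Longrightarrow> Q (\<lambda>x. c * g x + h x)"
  shows "Q f"
  using assms(1)
  by (induction rule: cfun.span_induct_alt)
    (use assms(2,3) in \<open>auto simp: zero_fun_def plus_fun_def\<close>)

lemma cfun_span_mult:
  assumes "f \<in> cfun.span S" "g \<in> cfun.span T"
    and "\<And>s t. s \<in> S \<Longrightarrow> t \<in> T \<Longrightarrow> (\<lambda>x. s x * t x) \<in> cfun.span U"
  shows "(\<lambda>x. f x * g x) \<in> cfun.span U"
proof -
  have 1: "(\<lambda>x. s x * g x) \<in> cfun.span U" if "s \<in> S" for s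
    using assms(2)
  proof (induction rule: cfun_span_induct)
    case (add c t h)
    then show ?case using cfun_add[OF cfun_scale[OF assms(3)[OF that add(1)], of c] add(2)]
      by (simp add: algebra_simps)
  qed (simp add: cfun_zero)
  show ?thesis
    using assms(1)
  proof (induction rule: cfun_span_induct)
    case (add c s h)
    then show ?case using cfun_add[OF cfun_scale[OF 1[OF add(1)], of c] add(2)]
      by (simp add: algebra_simps)
  qed (simp add: cfun_zero)
qed

section \<open>Polynomials as functions of an assignment\<close>

abbreviation assignment_polys :: "(('v \<Rightarrow> complex) \<Rightarrow> complex) set" where
  "assignment_polys \<equiv> polynomial_funs (range (\<lambda>x a. a x))"

definition monf :: "'v multiset \<Rightarrow> ('v \<Rightarrow> complex) \<Rightarrow> complex" where
  "monf M a = (\<Prod>x\<in>#M. a x)"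

lemma monf_add: "monf (M + N) a = monf M a * monf N a"
  by (simp add: monf_def)

lemma monf_empty [simp]: "monf {#} a = 1"
  by (simp add: monf_def)

lemma monf_add_mset [simp]: "monf (add_mset x M) a = a x * monf M a"
  by (simp add: monf_def)

lemma monf_single [simp]: "monf {#x#} = (\<lambda>a. a x)"
  by (simp add: fun_eq_iff)

lemma monf_polynomial: "monf M \<in> assignment_polys"
proof -
  have "(\<lambda>a. \<Prod>x\<in>#M. a x) \<in> assignment_polys"
    by (rule function_algebra.prod_mset[OF function_algebra_polynomial_funs])
      (auto intro: polynomial_funs.coord)
  then show ?thesis by (simp add: monf_def [abs_def])
qed

lemma polynomial_funs_span: "f \<in> assignment_polys \<Longrightarrow> f \<in> cfun.span (range monf)"
proof (induction rule: polynomial_funs.induct)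
  case (const c)
  show ?case using cfun_scale[OF cfun.span_base[of "monf {#}" "range monf"], of c] by simp
next
  case (coord f)
  then obtain x where x: "f = monf {#x#}" unfolding monf_single by auto
  show ?case unfolding x by (rule cfun.span_base) (rule rangeI)
next
  case (mult f g)
  show ?case
    by (rule cfun_span_mult[OF mult(3,4)]) (auto simp: monf_add[symmetric, abs_def] intro!: cfun.span_base)
qed (auto intro: cfun_add)

lemma span_monf_polynomial: "f \<in> cfun.span (range monf) \<Longrightarrow> f \<in> assignment_polys"
proof (induction rule: cfun_span_induct)
  case (add c g h)
  then show ?case
    by (intro polynomial_funs.add polynomial_funs.mult polynomial_funs.const) (auto intro: monf_polynomial)
qed (rule polynomial_funs.const)

lemma monf_fun_upd: "monf M (a(y := t)) = t ^ count M y * monf (filter_mset (\<lambda>x. x \<noteq> y) M) a"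
  by (induction M) auto

text \<open>Induction on the set of variables. Varying only \<open>y\<close> gives a polynomial in
  one variable that vanishes everywhere, so its coefficient at the exponent of \<open>y\<close> in
  \<open>M\<close> is zero; this coefficient is a relation among monomials without
  \<open>y\<close>.\<close>

lemma monf_sum_eq_0:
  assumes "finite Y" "finite B" "\<And>M. M \<in> B \<Longrightarrow> set_mset M \<subseteq> Y"
    and "\<And>a. (\<Sum>M\<in>B. c M * monf M a) = 0" and "M \<in> B"
  shows "c M = 0"
  using assms
proof (induction Y arbitrary: B c M rule: finite_induct)
  case empty
  then have "B = {{#}}" "M = {#}" by auto
  then show ?case using empty(3) by simp
next
  case (insert y Y)
  define r where "r = filter_mset (\<lambda>x. x \<noteq> y)"
  define k where "k = count M y"
  define Bk where "Bk = {N \<in> B. count N y = k}"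
  have r_eq: "N = r N + replicate_mset k y" if "N \<in> Bk" for N
    using that by (intro multiset_eqI) (auto simp: r_def Bk_def)
  have inj: "inj_on r Bk" using r_eq by (metis inj_onI)
  have z: "(\<Sum>N\<in>Bk. c N * monf (r N) a) = 0" for a
  proof -
    define p where "p = (\<Sum>N\<in>B. monom (c N * monf (r N) a) (count N y))"
    have "poly p t = 0" for t
    proof -
      have "poly p t = (\<Sum>N\<in>B. c N * monf N (a(y := t)))"
        by (simp add: p_def poly_sum poly_monom monf_fun_upd r_def algebra_simps)
      then show ?thesis using insert.prems(3) by simp
    qed
    then have "coeff p k = 0" using poly_all_0_iff_0 by (metis coeff_0)
    also have "coeff p k = (\<Sum>N\<in>B. if count N y = k then c N * monf (r N) a else 0)"
      by (simp add: p_def coeff_sum)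
    also have "\<dots> = (\<Sum>N\<in>Bk. c N * monf (r N) a)"
      unfolding Bk_def by (rule sum.inter_filter[symmetric]) (rule insert.prems(1))
    finally show ?thesis by simp
  qed
  have "c (r M + replicate_mset k y) = 0"
  proof (rule insert.IH[of "r ` Bk" "\<lambda>N. c (N + replicate_mset k y)"])
    show "finite (r ` Bk)" using insert.prems(1) by (simp add: Bk_def)
    show "set_mset N \<subseteq> Y" if "N \<in> r ` Bk" for N
      using that insert.prems(2) by (fastforce simp: r_def Bk_def)
    show "(\<Sum>N\<in>r ` Bk. c (N + replicate_mset k y) * monf N a) = 0" for a
      using z[of a] by (simp add: sum.reindex[OF inj] flip: r_eq)
    show "r M \<in> r ` Bk" using insert.prems(4) by (auto simp: Bk_def k_def)
  qed
  then show ?case using r_eq[of M] insert.prems(4) by (simp add: Bk_def k_def)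
qed

lemma inj_monf: "inj (monf :: 'v multiset \<Rightarrow> _)"
proof (rule injI, rule ccontr)
  fix M N :: "'v multiset" assume *: "monf M = monf N" "M \<noteq> N"
  have "(if M = M then 1 else - 1 :: complex) = 0"
    by (rule monf_sum_eq_0[of "set_mset M \<union> set_mset N" "{M, N}" "\<lambda>K. if K = M then 1 else - 1"])
      (use * in auto)
  then show False by simp
qed

text \<open>Polynomials are treated as functions throughout; over an infinite field nothing is lost,
  and this independence is what allows one to speak of the monomials occurring in a
  function.\<close>

lemma independent_monf: "cfun.independent (range (monf :: 'v multiset \<Rightarrow> _))"
proof -
  have "u v = 0" if t: "finite t" "t \<subseteq> range monf" "(\<Sum>v\<in>t. (\<lambda>x. u v * v x)) = 0" "v \<in> t"
    for t u and v :: "('v \<Rightarrow> complex) \<Rightarrow> complex"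
  proof -
  from t(2) obtain B where B: "t = monf ` B" by (meson subset_image_iff)
  have inj: "inj_on monf B" using inj_monf by (rule inj_on_subset) simp
  have fin: "finite B" using t(1) B finite_imageD inj by blast
  obtain M where M: "M \<in> B" "v = monf M" using t(4) B by blast
  have "u (monf M) = 0"
  proof (rule monf_sum_eq_0[of "\<Union>(set_mset ` B)" B "\<lambda>M. u (monf M)"])
    fix a
    have "(\<Sum>v\<in>t. (\<lambda>x. u v * v x)) a = (\<Sum>v\<in>t. u v * v a)"
      by (induction t rule: infinite_finite_induct) auto
    then show "(\<Sum>M\<in>B. u (monf M) * monf M a) = 0"
      using t(3) by (simp add: B sum.reindex[OF inj])
  qed (use fin M in auto)
  then show "u v = 0" using M by simp
  qed
  then show ?thesis unfolding cfun.independent_explicit_module by blast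
qed

lemma monf_notin_span:
  fixes M :: "'v multiset"
  shows "monf M \<notin> cfun.span (monf ` (- {M}))"
proof -
  have "monf ` (- {M}) = range monf - {monf M}"
    unfolding Compl_eq_Diff_UNIV image_set_diff[OF inj_monf] by simp
  moreover have "monf M \<notin> cfun.span (range monf - {monf M})"
  proof
    assume a: "monf M \<in> cfun.span (range monf - {monf M})"
    have "cfun.dependent (range (monf :: 'v multiset \<Rightarrow> _))"
      unfolding cfun.dependent_def by (intro bexI[of _ "monf M"]) (rule a, rule rangeI)
    then show False using independent_monf by contradiction
  qed
  ultimately show ?thesis by (rule ssubst)
qed

section \<open>Weights and leading monomials\<close>

definition wt :: "('v \<Rightarrow> nat) \<Rightarrow> 'v multiset \<Rightarrow> nat" where
  "wt w M = (\<Sum>x\<in>#M. w x)"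

lemma wt_add: "wt w (M + N) = wt w M + wt w N"
  by (simp add: wt_def)

lemma wt_empty [simp]: "wt w {#} = 0"
  by (simp add: wt_def)

lemma wt_add_mset [simp]: "wt w (add_mset x M) = w x + wt w M"
  by (simp add: wt_def)

definition low :: "('v \<Rightarrow> nat) \<Rightarrow> nat \<Rightarrow> (('v \<Rightarrow> complex) \<Rightarrow> complex) set" where
  "low w d = cfun.span (monf ` {M. wt w M < d})"

lemma low_monf: "wt w M < d \<Longrightarrow> monf M \<in> low w d"
  unfolding low_def by (auto intro: cfun.span_base)

lemma low_add: "f \<in> low w d \<Longrightarrow> g \<in> low w d \<Longrightarrow> (\<lambda>x. f x + g x) \<in> low w d"
  unfolding low_def by (rule cfun_add)

lemma low_scale: "f \<in> low w d \<Longrightarrow> (\<lambda>x. c * f x) \<in> low w d"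
  unfolding low_def by (rule cfun_scale)

lemma low_sum: "(\<And>i. i \<in> A \<Longrightarrow> f i \<in> low w d) \<Longrightarrow> (\<lambda>x. \<Sum>i\<in>A. f i x) \<in> low w d"
  unfolding low_def by (rule cfun_sum)

lemma low_mult:
  assumes "f \<in> low w d" "g \<in> low w e"
  shows "(\<lambda>x. f x * g x) \<in> low w (d + e)"
  unfolding low_def
  by (rule cfun_span_mult[OF assms[unfolded low_def]])
    (auto simp: monf_add[symmetric, abs_def] wt_add intro!: cfun.span_base)

lemma low_mult_monf:
  assumes "f \<in> low w d"
  shows "(\<lambda>x. monf M x * f x) \<in> low w (wt w M + d)"
  unfolding low_def
  by (rule cfun_span_mult[of _ "{monf M}", OF cfun.span_base assms[unfolded low_def]])
    (auto simp: monf_add[symmetric, abs_def] wt_add intro!: cfun.span_base)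

text \<open>A weight does not order all monomials, so a polynomial need not have a leading monomial
  in this sense: \<open>M\<close> has to be its only monomial of maximal weight.\<close>

definition lead :: "('v \<Rightarrow> nat) \<Rightarrow> 'v multiset \<Rightarrow> (('v \<Rightarrow> complex) \<Rightarrow> complex) \<Rightarrow> bool" where
  "lead w M g \<longleftrightarrow> (\<exists>c l. c \<noteq> 0 \<and> l \<in> low w (wt w M) \<and> g = (\<lambda>a. c * monf M a + l a))"

lemma leadI:
  "c \<noteq> 0 \<Longrightarrow> l \<in> low w (wt w M) \<Longrightarrow> (\<And>a. g a = c * monf M a + l a) \<Longrightarrow> lead w M g"
  unfolding lead_def by (intro exI[of _ c] exI[of _ l]) (simp add: fun_eq_iff)

lemma leadE:
  assumes "lead w M g"
  obtains c l where "c \<noteq> 0" "l \<in> low w (wt w M)" "g = (\<lambda>a. c * monf M a + l a)"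
  using assms by (auto simp: lead_def)

lemma lead_monf: "lead w M (monf M)"
  unfolding lead_def
  by (intro exI[of _ 1] exI[of _ "\<lambda>_. 0"]) (simp add: low_def cfun_zero)

lemma lead_add_low:
  assumes "lead w M g" "l \<in> low w (wt w M)"
  shows "lead w M (\<lambda>a. g a + l a)"
  using assms(1) by (rule leadE) (rule leadI[OF _ low_add[OF _ assms(2)]], auto simp: add.assoc)

lemma lead_mult:
  assumes "lead w M g" "lead w N h"
  shows "lead w (M + N) (\<lambda>a. g a * h a)"
proof -
  obtain c l where 1: "c \<noteq> 0" "l \<in> low w (wt w M)" "g = (\<lambda>a. c * monf M a + l a)"
    using assms(1) by (rule leadE)
  obtain d k where 2: "d \<noteq> 0" "k \<in> low w (wt w N)" "h = (\<lambda>a. d * monf N a + k a)"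
    using assms(2) by (rule leadE)
  have "(\<lambda>a. c * (monf M a * k a) + (d * (monf N a * l a) + l a * k a)) \<in> low w (wt w (M + N))"
    using low_mult_monf[OF 1(2), of N] low_mult_monf[OF 2(2), of M] low_mult[OF 1(2) 2(2)]
    by (intro low_add low_scale) (simp_all add: wt_add add.commute)
  then show ?thesis
    by (rule leadI[of "c * d", rotated]) (use 1(1) 2(1) in \<open>auto simp: 1(3) 2(3) monf_add algebra_simps\<close>)
qed

lemma lead_prod_mset:
  "(\<And>q. q \<in># A \<Longrightarrow> lead w (\<mu> q) (\<gamma> q)) \<Longrightarrow> lead w (\<Sum>q\<in>#A. \<mu> q) (\<lambda>a. \<Prod>q\<in>#A. \<gamma> q a)"
proof (induction A)
  case empty
  show ?case using lead_monf[of w "{#}"] by (simp add: monf_def [abs_def])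
next
  case (add q A)
  then show ?case using lead_mult[of w "\<mu> q" "\<gamma> q"] by simp
qed

text \<open>The reason why all fibers can be treated with the same leading monomials: passing from
  \<open>g p\<close> to \<open>g p - z p\<close> changes only a term of weight zero.\<close>

lemma lead_diff_const:
  assumes "lead w M g" "0 < wt w M"
  shows "lead w M (\<lambda>a. g a - c)"
  using lead_add_low[OF assms(1) low_scale[OF low_monf[of w "{#}"], of "wt w M" "- c"]] assms(2) by simp

lemma lead_scale:
  assumes "lead w M g" "c \<noteq> 0"
  shows "lead w M (\<lambda>a. c * g a)"
proof -
  obtain d l where d: "d \<noteq> 0" "l \<in> low w (wt w M)" "g = (\<lambda>a. d * monf M a + l a)"
    using assms(1) by (rule leadE)
  show ?thesis
    by (rule leadI[of "c * d" "\<lambda>a. c * l a"]) (use assms(2) d in \<open>auto intro: low_scale simp: algebra_simps\<close>)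
qed

lemma lead_sum:
  assumes "finite K" "k0 \<in> K" "c k0 \<noteq> 0"
    and "\<And>k. k \<in> K \<Longrightarrow> k \<noteq> k0 \<Longrightarrow> c k = 0 \<or> wt w (M k) < wt w (M k0)"
  shows "lead w (M k0) (\<lambda>a. \<Sum>k\<in>K. c k * monf (M k) a)"
proof -
  have "(\<lambda>a. \<Sum>k\<in>K - {k0}. c k * monf (M k) a) \<in> low w (wt w (M k0))"
  proof (rule low_sum)
    fix k assume "k \<in> K - {k0}"
    then show "(\<lambda>a. c k * monf (M k) a) \<in> low w (wt w (M k0))"
      using assms(4)[of k] low_scale[OF low_monf[of w "M k"]] by (auto simp: low_def cfun_zero)
  qed
  from lead_add_low[OF lead_scale[OF lead_monf assms(3)] this] show ?thesis
    using assms(1,2) by (simp add: sum.remove)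
qed

section \<open>Bases adapted to a system with coprime leading monomials\<close>

lemma span_image_sumE:
  assumes "f \<in> cfun.span (b ` S)"
  obtains T c where "finite T" "T \<subseteq> S" "f = (\<lambda>a. \<Sum>i\<in>T. c i * b i a)"
proof -
  have "\<exists>T c. finite T \<and> T \<subseteq> S \<and> f = (\<lambda>a. \<Sum>i\<in>T. c i * b i a)"
    using assms
  proof (induction rule: cfun_span_induct)
    case zero
    show ?case by (intro exI[of _ "{}"]) simp
  next
    case (add k g h)
    obtain s where s: "s \<in> S" "g = b s" using add(1) by blast
    obtain T c where T: "finite T" "T \<subseteq> S" "h = (\<lambda>a. \<Sum>i\<in>T. c i * b i a)" using add(2) by blast
    define c' where "c' i = (if i = s then k else 0) + (if i \<in> T then c i else 0)" for i
    have "(\<Sum>i\<in>insert s T. c' i * b i a) = k * g a + h a" for a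
    proof -
      have "(\<Sum>i\<in>insert s T. c' i * b i a) =
          (\<Sum>i\<in>insert s T. if s = i then k * b s a else 0) + (\<Sum>i\<in>insert s T. if i \<in> T then c i * b i a else 0)"
        unfolding sum.distrib[symmetric] by (rule sum.cong) (auto simp: c'_def algebra_simps)
      also have "(\<Sum>i\<in>insert s T. if i \<in> T then c i * b i a else 0) = (\<Sum>i\<in>T. c i * b i a)"
        using T(1) by (intro sum.mono_neutral_cong_right) auto
      finally show ?thesis using T(1,3) s(2) by simp
    qed
    then show ?case using T s by (intro exI[of _ "insert s T"] exI[of _ c']) auto
  qed
  then show ?thesis using that by blast
qed

text \<open>Coprime leading monomials are the easy case of Buchberger's criterion. The conclusion
  drawn here is stronger than a Groebner basis: monomials divisible by no leading monomial, times
  arbitrary products of generators, form a linear basis, so the polynomials are free over the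
  algebra of the generators.\<close>

locale lead_system =
  fixes w :: "'v \<Rightarrow> nat" and Q :: "'q set" and \<mu> :: "'q \<Rightarrow> 'v multiset"
    and \<gamma> :: "'q \<Rightarrow> ('v \<Rightarrow> complex) \<Rightarrow> complex"
  assumes lead_gen: "q \<in> Q \<Longrightarrow> lead w (\<mu> q) (\<gamma> q)"
    and wt_pos: "q \<in> Q \<Longrightarrow> 0 < wt w (\<mu> q)"
    and disjoint: "q \<in> Q \<Longrightarrow> q' \<in> Q \<Longrightarrow> q \<noteq> q' \<Longrightarrow> set_mset (\<mu> q) \<inter> set_mset (\<mu> q') = {}"
begin

definition idx :: "('v multiset \<times> 'q multiset) set" where
  "idx = {(M, A). (\<forall>q\<in>Q. \<not> \<mu> q \<subseteq># M) \<and> set_mset A \<subseteq> Q}"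

definition bas :: "'v multiset \<times> 'q multiset \<Rightarrow> ('v \<Rightarrow> complex) \<Rightarrow> complex" where
  "bas = (\<lambda>(M, A) a. monf M a * (\<Prod>q\<in>#A. \<gamma> q a))"

definition ld :: "'v multiset \<times> 'q multiset \<Rightarrow> 'v multiset" where
  "ld = (\<lambda>(M, A). M + (\<Sum>q\<in>#A. \<mu> q))"

lemma lead_bas: "i \<in> idx \<Longrightarrow> lead w (ld i) (bas i)"
  by (auto simp: idx_def bas_def ld_def intro!: lead_mult lead_monf lead_prod_mset lead_gen)

text \<open>Leading monomials are divided off as long as possible. By \<open>wt_pos\<close> none of
  them is empty, so the size drops.\<close>

lemma ex_ld: "\<exists>i\<in>idx. ld i = N"
proof (induction "size N" arbitrary: N rule: less_induct)
  case less
  show ?case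
  proof (cases "\<exists>q\<in>Q. \<mu> q \<subseteq># N")
    case False
    then show ?thesis by (intro bexI[of _ "(N, {#})"]) (auto simp: idx_def ld_def)
  next
    case True
    then obtain q where q: "q \<in> Q" "\<mu> q \<subseteq># N" by blast
    have "\<mu> q \<noteq> {#}" using wt_pos[OF q(1)] by auto
    then have "size (N - \<mu> q) < size N"
      using size_Diff_submset[OF q(2)] size_mset_mono[OF q(2)] by (simp add: nonempty_has_size)
    then obtain M A where MA: "(M, A) \<in> idx" "ld (M, A) = N - \<mu> q" using less by (metis surj_pair)
    have "(M, add_mset q A) \<in> idx" using MA(1) q(1) by (simp add: idx_def)
    moreover have "ld (M, add_mset q A) = ld (M, A) + \<mu> q" by (simp add: ld_def ac_simps)
    then have "ld (M, add_mset q A) = N"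
      unfolding MA(2) by (simp only: subset_mset.diff_add[OF q(2)])
    ultimately show ?thesis by blast
  qed
qed

lemma count_sum_gen:
  assumes "set_mset A \<subseteq> Q" "q \<in> Q" "x \<in># \<mu> q"
  shows "count (\<Sum>q\<in>#A. \<mu> q) x = count A q * count (\<mu> q) x"
  using assms(1)
proof (induction A)
  case (add r A)
  have "count (\<mu> r) x = 0" if "r \<noteq> q"
    using disjoint[of r q] that assms(2,3) add.prems by (auto simp: count_eq_zero_iff)
  then show ?case using add by (auto simp: algebra_simps)
qed auto

text \<open>Suppose \<open>q\<close> occurs more often in \<open>A'\<close>. As
  \<open>\<mu> q\<close> does not divide \<open>M\<close>, some variable \<open>x\<close> has a
  larger exponent in \<open>\<mu> q\<close> than in \<open>M\<close>. By coprimality no other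
  generator contributes to the exponent of \<open>x\<close>, so the right-hand side has more of
  \<open>x\<close> than the left-hand side.\<close>

lemma ld_count_le:
  assumes "(M, A) \<in> idx" "(M', A') \<in> idx" "ld (M, A) = ld (M', A')"
  shows "count A' q \<le> count A q"
proof (rule ccontr)
  assume "\<not> ?thesis"
  then have less: "count A q < count A' q" by simp
  then have "q \<in># A'" by (metis count_inI not_less0)
  then have q: "q \<in> Q" using assms(2) by (auto simp: idx_def)
  then obtain x where x: "count M x < count (\<mu> q) x"
    using assms(1) by (auto simp: idx_def subseteq_mset_def not_le)
  then have mem: "x \<in># \<mu> q" by (metis count_inI not_less0)
  have "count M x + count A q * count (\<mu> q) x = count M' x + count A' q * count (\<mu> q) x"
    using arg_cong[OF assms(3), of "\<lambda>N. count N x"] assms(1,2) count_sum_gen[OF _ q mem]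
    by (auto simp: ld_def idx_def)
  moreover have "Suc (count A q) * count (\<mu> q) x \<le> count A' q * count (\<mu> q) x"
    using less by (intro mult_le_mono1) simp
  ultimately show False using x by simp
qed

lemma inj_on_ld: "inj_on ld idx"
proof (rule inj_onI)
  fix i j assume ij: "i \<in> idx" "j \<in> idx" "ld i = ld j"
  obtain M A N B where i: "i = (M, A)" and j: "j = (N, B)" by (metis surj_pair)
  have "count A q = count B q" for q
    using ld_count_le[of M A N B q] ld_count_le[of N B M A q] ij unfolding i j by simp
  then have "A = B" by (rule multiset_eqI)
  then show "i = j" using ij(3) by (simp add: i j ld_def)
qed

text \<open>Triangularity: the element of \<open>bas\<close> with leading monomial \<open>N\<close>
  is a multiple of \<open>N\<close> up to monomials of smaller weight, and these are covered by
  induction on the weight.\<close>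

lemma monf_in_span: "monf N \<in> cfun.span (bas ` idx)"
proof (induction "wt w N" arbitrary: N rule: less_induct)
  case less
  obtain i where i: "i \<in> idx" "ld i = N" using ex_ld by blast
  obtain c l where c: "c \<noteq> 0" "l \<in> low w (wt w N)" "bas i = (\<lambda>a. c * monf N a + l a)"
    using lead_bas[OF i(1)] unfolding i(2) by (rule leadE)
  have l: "l \<in> cfun.span (bas ` idx)"
    using c(2) unfolding low_def
    by (rule subsetD[OF cfun.span_minimal, rotated 2]) (use less in auto)
  have "(\<lambda>a. (1 / c) * (bas i a - l a)) \<in> cfun.span (bas ` idx)"
    using i(1) by (intro cfun_scale cfun_diff[OF cfun.span_base l]) auto
  also have "(\<lambda>a. (1 / c) * (bas i a - l a)) = monf N" using c(1,3) by auto
  finally show ?case .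
qed

lemma polynomial_in_span: "f \<in> assignment_polys \<Longrightarrow> f \<in> cfun.span (bas ` idx)"
  by (rule subsetD[OF cfun.span_minimal, OF _ _ polynomial_funs_span]) (use monf_in_span in auto)

text \<open>In a linear relation, consider a term \<open>k\<close> whose leading monomial has
  maximal weight. Since \<open>ld\<close> is injective, no other term contains the monomial
  \<open>ld k\<close>, so it cannot cancel.\<close>

lemma bas_notin_span:
  assumes "i \<in> idx"
  shows "bas i \<notin> cfun.span (bas ` (idx - {i}))"
proof
  assume "bas i \<in> cfun.span (bas ` (idx - {i}))"
  then obtain T c where T: "finite T" "T \<subseteq> idx - {i}" "bas i = (\<lambda>a. \<Sum>j\<in>T. c j * bas j a)"
    by (rule span_image_sumE)
  \<comment> \<open>The coefficient -1 at \<open>i\<close> turns the representation into a relation.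
    Terms with coefficient zero are dropped so that the maximum below is taken over terms that
    really occur.\<close>
  define d where "d = c(i := -1)"
  define T' where "T' = {j \<in> insert i T. d j \<noteq> 0}"
  have fin: "finite T'" and ne: "i \<in> T'" and sub: "T' \<subseteq> idx"
    using T(1,2) assms by (auto simp: T'_def d_def)
  have zero: "(\<Sum>j\<in>T'. d j * bas j a) = 0" for a
  proof -
    have "(\<Sum>j\<in>T'. d j * bas j a) = (\<Sum>j\<in>insert i T. d j * bas j a)"
      unfolding T'_def using T(1) by (intro sum.mono_neutral_left) auto
    also have "\<dots> = - bas i a + (\<Sum>j\<in>T. d j * bas j a)"
      using T(1,2) by (subst sum.insert) (auto simp: d_def)
    also have "(\<Sum>j\<in>T. d j * bas j a) = (\<Sum>j\<in>T. c j * bas j a)"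
      using T(2) by (intro sum.cong) (auto simp: d_def)
    finally show ?thesis by (simp add: T(3))
  qed
  obtain k where k: "k \<in> T'" "\<And>j. j \<in> T' \<Longrightarrow> wt w (ld j) \<le> wt w (ld k)"
  proof -
    have "Max ((\<lambda>j. wt w (ld j)) ` T') \<in> (\<lambda>j. wt w (ld j)) ` T'"
      using fin ne by (intro Max_in) auto
    then obtain k where "k \<in> T'" "Max ((\<lambda>j. wt w (ld j)) ` T') = wt w (ld k)" by blast
    then show ?thesis using that[of k] fin by (metis Max_ge finite_imageI imageI)
  qed
  let ?S = "cfun.span (monf ` (- {ld k}))"
  have low: "l \<in> ?S" if "l \<in> low w (wt w (ld j))" "j \<in> T'" for l j
    using that(1) unfolding low_def
    by (rule subsetD[OF cfun.span_mono, rotated]) (use k(2)[OF that(2)] in auto)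
  have others: "bas j \<in> ?S" if j: "j \<in> T' - {k}" for j
  proof -
    obtain c l where c: "l \<in> low w (wt w (ld j))" "bas j = (\<lambda>a. c * monf (ld j) a + l a)"
      using lead_bas[of j] j sub by (meson DiffD1 leadE subsetD)
    have "ld j \<noteq> ld k" using j k(1) sub inj_on_ld by (auto dest: inj_onD)
    then have "monf (ld j) \<in> ?S" by (intro cfun.span_base) auto
    then show ?thesis using low[OF c(1)] j unfolding c(2)
      by (intro cfun_add cfun_scale) auto
  qed
  obtain e l where e: "e \<noteq> 0" "l \<in> low w (wt w (ld k))" "bas k = (\<lambda>a. e * monf (ld k) a + l a)"
    using lead_bas[of k] k(1) sub by (meson leadE subsetD)
  have dk: "d k \<noteq> 0" using k(1) by (simp add: T'_def)
  have "(\<lambda>a. (- 1 / (d k * e)) * ((\<Sum>j\<in>T' - {k}. d j * bas j a) + d k * l a)) \<in> ?S"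
    using others low[OF e(2) k(1)] by (intro cfun_scale cfun_add cfun_sum) auto
  also have "(\<lambda>a. (- 1 / (d k * e)) * ((\<Sum>j\<in>T' - {k}. d j * bas j a) + d k * l a)) = monf (ld k)"
  proof
    fix a
    have "(\<Sum>j\<in>T' - {k}. d j * bas j a) = - (d k * (e * monf (ld k) a + l a))"
      using zero[of a] k(1) fin e(3) by (simp add: sum.remove add_eq_0_iff)
    then show "(- 1 / (d k * e)) * ((\<Sum>j\<in>T' - {k}. d j * bas j a) + d k * l a) = monf (ld k) a"
      using dk e(1) by (simp add: field_simps)
  qed
  finally show False using monf_notin_span by blast
qed

end

section \<open>Families with a rational correction map\<close>

lemma lead_polynomial: "lead w M g \<Longrightarrow> g \<in> assignment_polys"
proof (erule leadE)
  fix c l assume *: "l \<in> low w (wt w M)" "g = (\<lambda>a. c * monf M a + l a)"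
  have "l \<in> cfun.span (range monf)"
    using *(1) unfolding low_def by (rule subsetD[OF cfun.span_mono, rotated]) auto
  then show "g \<in> assignment_polys"
    unfolding *(2)
    by (intro polynomial_funs.add polynomial_funs.mult polynomial_funs.const monf_polynomial span_monf_polynomial)
qed

locale coprime_family =
  fixes w :: "'v \<Rightarrow> nat" and P :: "'p set" and \<mu> :: "'p \<Rightarrow> 'v multiset" and \<nu> :: "'v multiset"
    and g :: "'p \<Rightarrow> ('v \<Rightarrow> complex) \<Rightarrow> complex" and \<delta> :: "('v \<Rightarrow> complex) \<Rightarrow> complex"
  assumes finite_P: "finite P"
    and lead_g: "p \<in> P \<Longrightarrow> lead w (\<mu> p) (g p)"
    and lead_\<delta>: "lead w \<nu> \<delta>"
    and wt_\<mu>: "p \<in> P \<Longrightarrow> 0 < wt w (\<mu> p)"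
    and wt_\<nu>: "0 < wt w \<nu>"
    and disjoint_\<mu>: "p \<in> P \<Longrightarrow> p' \<in> P \<Longrightarrow> p \<noteq> p' \<Longrightarrow> set_mset (\<mu> p) \<inter> set_mset (\<mu> p') = {}"
    and disjoint_\<nu>: "p \<in> P \<Longrightarrow> set_mset (\<mu> p) \<inter> set_mset \<nu> = {}"
begin

text \<open>The ideal generated by the \<open>g p - z p\<close>, written out as explicit
  combinations so that no quotient ring is needed.\<close>

definition fiber_polys :: "('p \<Rightarrow> complex) \<Rightarrow> (('v \<Rightarrow> complex) \<Rightarrow> complex) set" where
  "fiber_polys z = {f. \<exists>h. (\<forall>p\<in>P. h p \<in> assignment_polys) \<and> f = (\<lambda>a. \<Sum>p\<in>P. (g p a - z p) * h p a)}"

lemma fiber_polys_zero: "(\<lambda>_. 0) \<in> fiber_polys z"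
  unfolding fiber_polys_def by (auto intro!: exI[of _ "\<lambda>_ _. 0"] polynomial_funs.const)

lemma fiber_polys_add:
  assumes "f \<in> fiber_polys z" "f' \<in> fiber_polys z"
  shows "(\<lambda>a. f a + f' a) \<in> fiber_polys z"
proof -
  obtain h h' where *: "\<forall>p\<in>P. h p \<in> assignment_polys" "f = (\<lambda>a. \<Sum>p\<in>P. (g p a - z p) * h p a)"
    "\<forall>p\<in>P. h' p \<in> assignment_polys" "f' = (\<lambda>a. \<Sum>p\<in>P. (g p a - z p) * h' p a)"
    using assms unfolding fiber_polys_def by blast
  show ?thesis
    unfolding fiber_polys_def mem_Collect_eq
    by (intro exI[of _ "\<lambda>p a. h p a + h' p a"])
      (use *(1,3) in \<open>auto simp: *(2,4) distrib_left sum.distrib intro!: polynomial_funs.add\<close>)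
qed

lemma fiber_polys_mult:
  assumes "f \<in> fiber_polys z" "f' \<in> assignment_polys"
  shows "(\<lambda>a. f' a * f a) \<in> fiber_polys z"
proof -
  obtain h where *: "\<forall>p\<in>P. h p \<in> assignment_polys" "f = (\<lambda>a. \<Sum>p\<in>P. (g p a - z p) * h p a)"
    using assms unfolding fiber_polys_def by blast
  show ?thesis
    unfolding fiber_polys_def mem_Collect_eq
    by (intro exI[of _ "\<lambda>p a. f' a * h p a"])
      (use * assms(2) in \<open>auto simp: sum_distrib_left algebra_simps intro!: polynomial_funs.mult\<close>)
qed

lemma fiber_polys_gen:
  assumes "p \<in> P"
  shows "(\<lambda>a. g p a - z p) \<in> fiber_polys z"
  unfolding fiber_polys_def mem_Collect_eq
  by (intro exI[of _ "\<lambda>p' a. if p' = p then 1 else 0"])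
    (use assms finite_P in \<open>auto intro!: polynomial_funs.const simp: if_distrib cong: if_cong\<close>)

lemma fiber_polys_sum: "(\<And>i. i \<in> A \<Longrightarrow> f i \<in> fiber_polys z) \<Longrightarrow> (\<lambda>a. \<Sum>i\<in>A. f i a) \<in> fiber_polys z"
  by (induction A rule: infinite_finite_induct) (auto intro: fiber_polys_zero fiber_polys_add)

lemma fiber_polys_eq_0: "f \<in> fiber_polys z \<Longrightarrow> \<forall>p\<in>P. g p a = z p \<Longrightarrow> f a = 0"
  unfolding fiber_polys_def by auto

text \<open>\<open>None\<close> stands for the minor \<open>\<delta>\<close>. With
  \<open>\<delta>\<close> among the generators, multiplying by it only raises a multiplicity in the
  index of a basis element.\<close>

abbreviation (input) "gens \<equiv> insert None (Some ` P)"

abbreviation (input) "gen_fun z \<equiv> (\<lambda>q. case q of None \<Rightarrow> \<delta> | Some p \<Rightarrow> (\<lambda>a. g p a - z p))"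

text \<open>The leading monomials are the same for every \<open>z\<close>, so a single index set
  \<open>sys.idx\<close> serves all fibers simultaneously; only the functions
  \<open>sys.bas z\<close> vary.\<close>

sublocale sys: lead_system w gens "case_option \<nu> \<mu>" "gen_fun z" for z
proof
  show "lead w (case_option \<nu> \<mu> q) (gen_fun z q)" if "q \<in> gens" for q
    using that by (auto intro: lead_\<delta> lead_diff_const[OF lead_g wt_\<mu>])
  show "0 < wt w (case_option \<nu> \<mu> q)" if "q \<in> gens" for q
    using that by (auto intro: wt_\<mu> wt_\<nu>)
  show "set_mset (case_option \<nu> \<mu> q) \<inter> set_mset (case_option \<nu> \<mu> q') = {}"
    if "q \<in> gens" "q' \<in> gens" "q \<noteq> q'" for q q'
    using that
  proof (cases q; cases q')
    fix p p' assume "q = Some p" "q' = Some p'"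
    then show ?thesis using that disjoint_\<mu>[of p p'] by auto
  next
    fix p assume "q = Some p" "q' = None"
    then show ?thesis using that disjoint_\<nu>[of p] by auto
  next
    fix p assume "q = None" "q' = Some p"
    then show ?thesis using that disjoint_\<nu>[of p] by auto
  qed auto
qed

text \<open>A basis element times \<open>g p - z p\<close> is again a basis element, with
  \<open>Some p\<close> added to its index. Basis elements whose index consists of copies of
  \<open>None\<close> are therefore independent modulo the ideal.\<close>

lemma fiber_polys_span:
  assumes "f \<in> fiber_polys z"
  shows "f \<in> cfun.span (sys.bas z ` {(M, A) \<in> sys.idx. \<exists>p. Some p \<in># A})"
proof -
  obtain h where *: "\<forall>p\<in>P. h p \<in> assignment_polys" "f = (\<lambda>a. \<Sum>p\<in>P. (g p a - z p) * h p a)"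
    using assms unfolding fiber_polys_def by blast
  let ?S = "cfun.span (sys.bas z ` {(M, A) \<in> sys.idx. \<exists>p. Some p \<in># A})"
  have "(\<lambda>a. (g p a - z p) * h p a) \<in> ?S" if p: "p \<in> P" for p
  proof (rule cfun_span_mult)
    show "(\<lambda>a. g p a - z p) \<in> cfun.span {\<lambda>a. g p a - z p}" by (intro cfun.span_base) simp
    show "h p \<in> cfun.span (sys.bas z ` sys.idx)" using * p by (intro sys.polynomial_in_span) auto
    fix s t assume "s \<in> {\<lambda>a. g p a - z p}" "t \<in> sys.bas z ` sys.idx"
    then obtain M A where t: "(M, A) \<in> sys.idx" "t = sys.bas z (M, A)" "s = (\<lambda>a. g p a - z p)" by auto
    have "(\<lambda>a. s a * t a) = sys.bas z (M, add_mset (Some p) A)"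
      by (simp add: t sys.bas_def algebra_simps)
    moreover have "(M, add_mset (Some p) A) \<in> {(M, A) \<in> sys.idx. \<exists>p. Some p \<in># A}"
      using t(1) p by (auto simp: sys.idx_def)
    ultimately show "(\<lambda>a. s a * t a) \<in> ?S" by (simp only:) (rule cfun.span_base, rule imageI)
  qed
  then show ?thesis unfolding *(2) by (intro cfun_sum)
qed

end

text \<open>Subtracting \<open>T z x / \<delta>\<close> from each variable \<open>x\<close> moves a
  point of the chart into the fiber over \<open>z\<close> without changing \<open>\<delta>\<close>.
  As \<open>T z x\<close> lies in the ideal of that fiber, points already there stay fixed, and the
  substitution is the identity modulo the ideal once \<open>\<delta>\<close> is inverted.
  \<open>T_rational\<close> makes the correction applicable along curves.\<close>

locale corrected_family = coprime_family w P \<mu> \<nu> g \<delta>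
  for w :: "'v \<Rightarrow> nat" and P :: "'p set" and \<mu> \<nu> g \<delta> +
  fixes T :: "('p \<Rightarrow> complex) \<Rightarrow> 'v \<Rightarrow> ('v \<Rightarrow> complex) \<Rightarrow> complex"
  assumes T_fiber: "T z x \<in> fiber_polys z"
    and T_correct: "\<delta> a \<noteq> 0 \<Longrightarrow> p \<in> P \<Longrightarrow> g p (\<lambda>x. a x - T z x a / \<delta> a) = z p"
    and T_\<delta>: "\<delta> a \<noteq> 0 \<Longrightarrow> \<delta> (\<lambda>x. a x - T z x a / \<delta> a) = \<delta> a"
    and T_rational: "(\<And>y. (\<lambda>t. \<alpha> t y) \<in> rational_funs Z) \<Longrightarrow> (\<And>p. (\<lambda>t. \<zeta> t p) \<in> rational_funs Z) \<Longrightarrow>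
      (\<lambda>t. T (\<zeta> t) x (\<alpha> t)) \<in> rational_funs Z"
begin

text \<open>Being unchanged by the substitution, modulo the ideal and up to powers of
  \<open>\<delta>\<close>, holds for each variable by \<open>T_fiber\<close> and is inherited by
  sums and products.\<close>

lemma clear_denominators:
  assumes "f \<in> assignment_polys"
  shows "\<exists>N. \<exists>S\<in>fiber_polys z. \<forall>a. \<delta> a \<noteq> 0 \<longrightarrow> \<delta> a ^ N * (f a - f (\<lambda>x. a x - T z x a / \<delta> a)) = S a"
  using assms
proof induction
  case (const c)
  show ?case by (intro exI[of _ 0] bexI[OF _ fiber_polys_zero]) simp
next
  case (coord f)
  then obtain x where "f = (\<lambda>a. a x)" by auto
  then show ?case by (intro exI[of _ 1] bexI[OF _ T_fiber[of z x]]) simp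
next
  case (add f f')
  then obtain N N' S S' where *: "S \<in> fiber_polys z" "S' \<in> fiber_polys z"
    "\<And>a. \<delta> a \<noteq> 0 \<Longrightarrow> \<delta> a ^ N * (f a - f (\<lambda>x. a x - T z x a / \<delta> a)) = S a"
    "\<And>a. \<delta> a \<noteq> 0 \<Longrightarrow> \<delta> a ^ N' * (f' a - f' (\<lambda>x. a x - T z x a / \<delta> a)) = S' a" by blast
  have pow: "(\<lambda>a. \<delta> a ^ n) \<in> assignment_polys" for n
    by (rule function_algebra.power[OF function_algebra_polynomial_funs lead_polynomial[OF lead_\<delta>]])
  let ?S = "\<lambda>a. \<delta> a ^ N' * S a + \<delta> a ^ N * S' a"
  have "?S \<in> fiber_polys z" by (intro fiber_polys_add fiber_polys_mult pow *(1,2))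
  moreover have "\<delta> a ^ (N + N') * ((f a + f' a) -
      (f (\<lambda>x. a x - T z x a / \<delta> a) + f' (\<lambda>x. a x - T z x a / \<delta> a))) = ?S a"
    if "\<delta> a \<noteq> 0" for a
    using that by (simp add: power_add algebra_simps flip: *(3,4))
  ultimately show ?case by (intro exI[of _ "N + N'"] bexI[of _ ?S] allI impI)
next
  case (mult f f')
  then obtain N N' S S' where *: "S \<in> fiber_polys z" "S' \<in> fiber_polys z"
    "\<And>a. \<delta> a \<noteq> 0 \<Longrightarrow> \<delta> a ^ N * (f a - f (\<lambda>x. a x - T z x a / \<delta> a)) = S a"
    "\<And>a. \<delta> a \<noteq> 0 \<Longrightarrow> \<delta> a ^ N' * (f' a - f' (\<lambda>x. a x - T z x a / \<delta> a)) = S' a" by blast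
  interpret A: function_algebra UNIV "assignment_polys :: (('v \<Rightarrow> complex) \<Rightarrow> complex) set"
    by (rule function_algebra_polynomial_funs)
  have pow: "(\<lambda>a. \<delta> a ^ n) \<in> assignment_polys" for n by (rule A.power[OF lead_polynomial[OF lead_\<delta>]])
  have S: "S \<in> assignment_polys"
    using *(1) unfolding fiber_polys_def
    by (auto intro!: A.sum A.mult A.diff A.const lead_polynomial[OF lead_g])
  \<comment> \<open>From \<open>f f' - (f - s) (f' - s') = f' s + f s' - s s'\<close> with
    \<open>s = S / \<delta>^N\<close> and \<open>s' = S' / \<delta>^N'\<close>.\<close>
  let ?S = "\<lambda>a. ((\<delta> a ^ N' * f' a) * S a + (\<delta> a ^ N * f a) * S' a) + (- 1 * S a) * S' a"
  have "?S \<in> fiber_polys z"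
    by (intro fiber_polys_add fiber_polys_mult A.mult A.const pow mult S *(1,2))
  moreover have "\<delta> a ^ (N + N') * (f a * f' a - f (\<lambda>x. a x - T z x a / \<delta> a) * f' (\<lambda>x. a x - T z x a / \<delta> a)) = ?S a"
    if "\<delta> a \<noteq> 0" for a
    using that by (simp add: power_add algebra_simps flip: *(3,4))
  ultimately show ?case by (intro exI[of _ "N + N'"] bexI[of _ ?S] allI impI)
qed

text \<open>This replaces the Nullstellensatz. The corrected point lies in the fiber, so
  \<open>f\<close> vanishes at it and only \<open>f\<close> itself remains in
  \<open>clear_denominators\<close>. One further factor \<open>\<delta>\<close> makes the identity
  hold off the chart too.\<close>

lemma vanishing_fiber:
  assumes "f \<in> assignment_polys"
    and "\<And>a. \<delta> a \<noteq> 0 \<Longrightarrow> \<forall>p\<in>P. g p a = z p \<Longrightarrow> f a = 0"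
  shows "\<exists>N. (\<lambda>a. \<delta> a ^ N * f a) \<in> fiber_polys z"
proof -
  obtain N S where *: "S \<in> fiber_polys z"
    "\<And>a. \<delta> a \<noteq> 0 \<Longrightarrow> \<delta> a ^ N * (f a - f (\<lambda>x. a x - T z x a / \<delta> a)) = S a"
    using clear_denominators[OF assms(1)] by blast
  have "(\<lambda>a. \<delta> a * S a) \<in> fiber_polys z"
    by (rule fiber_polys_mult[OF *(1) lead_polynomial[OF lead_\<delta>]])
  moreover have "\<delta> a * S a = \<delta> a ^ Suc N * f a" for a
    using *(2)[of a] assms(2)[of "\<lambda>x. a x - T z x a / \<delta> a"] T_\<delta>[of a z] T_correct[of a _ z]
    by (cases "\<delta> a = 0") auto
  then have "(\<lambda>a. \<delta> a * S a) = (\<lambda>a. \<delta> a ^ Suc N * f a)" by (rule ext)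
  ultimately show ?thesis by (intro exI[of _ "Suc N"]) (simp only:)
qed

lemma prod_mset_gen:
  "(\<Prod>q\<in>#A. gen_fun z q a) =
    \<delta> a ^ count A None * (\<Prod>p\<in>#image_mset the (filter_mset (\<lambda>q. q \<noteq> None) A). g p a - z p)"
  by (induction A) (auto split: option.splits)

text \<open>The expansion in the basis for \<open>z = 0\<close> is grouped by monomial and power of
  \<open>\<delta>\<close>; the products of the \<open>g p\<close> are collected in the coefficients.
  Freezing these at a point \<open>z\<close> of \<open>Orb\<close> gives a combination of basis
  elements without any \<open>Some p\<close> which, after multiplication by a power of
  \<open>\<delta>\<close>, lies in the ideal of the fiber over \<open>z\<close>. By independence
  modulo that ideal each frozen coefficient is zero.\<close>

lemma vanishing_decomposition:
  assumes f: "f \<in> assignment_polys"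
    and van: "\<And>a z. z \<in> Orb \<Longrightarrow> \<delta> a \<noteq> 0 \<Longrightarrow> \<forall>p\<in>P. g p a = z p \<Longrightarrow> f a = 0"
  shows "\<exists>(B :: ('v multiset \<times> nat) set) m c. finite B \<and>
    (\<forall>i\<in>B. m i \<in> assignment_polys \<and> c i \<in> polynomial_funs ((\<lambda>p \<zeta>. \<zeta> p) ` P) \<and> (\<forall>z\<in>Orb. c i z = 0)) \<and>
    f = (\<lambda>a. \<Sum>i\<in>B. m i a * c i (\<lambda>p. g p a))"
proof -
  let ?somes = "\<lambda>A. image_mset the (filter_mset (\<lambda>q. q \<noteq> None) A)"
  obtain I c where I: "finite I" "I \<subseteq> sys.idx" "f = (\<lambda>a. \<Sum>i\<in>I. c i * sys.bas (\<lambda>_. 0) i a)"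
    using sys.polynomial_in_span[OF f] by (rule span_image_sumE)
  \<comment> \<open>\<open>key\<close> forgets which equations occur in an index; what is forgotten
    becomes part of the coefficient \<open>d\<close>.\<close>
  define key :: "'v multiset \<times> 'p option multiset \<Rightarrow> 'v multiset \<times> nat"
    where "key = (\<lambda>(M, A). (M, count A None))"
  define B where "B = key ` I"
  define m where "m = (\<lambda>(M, k) a. monf M a * \<delta> a ^ k)"
  define d where "d \<beta> \<zeta> = (\<Sum>i\<in>{i\<in>I. key i = \<beta>}. c i * (\<Prod>p\<in>#?somes (snd i). \<zeta> p))" for \<beta> and \<zeta> :: "'p \<Rightarrow> complex"
  have some_P: "p \<in> P" if "(M, A) \<in> I" "Some p \<in># A" for M A p
    using that I(2) by (auto simp: sys.idx_def)
  interpret A: function_algebra UNIV "assignment_polys :: (('v \<Rightarrow> complex) \<Rightarrow> complex) set"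
    by (rule function_algebra_polynomial_funs)
  interpret C: function_algebra UNIV "polynomial_funs ((\<lambda>p (\<zeta> :: 'p \<Rightarrow> complex). \<zeta> p) ` P)"
    by (rule function_algebra_polynomial_funs)
  have m_poly: "m \<beta> \<in> assignment_polys" for \<beta>
    by (cases \<beta>) (auto simp: m_def intro!: A.mult A.power monf_polynomial lead_polynomial[OF lead_\<delta>])
  have d_poly: "d \<beta> \<in> polynomial_funs ((\<lambda>p \<zeta>. \<zeta> p) ` P)" for \<beta>
    unfolding d_def by (intro C.sum C.mult C.const C.prod_mset polynomial_funs.coord) (use some_P in auto)
  have d_cong: "d \<beta> \<zeta> = d \<beta> \<zeta>'" if "\<forall>p\<in>P. \<zeta> p = \<zeta>' p" for \<beta> \<zeta> \<zeta>'
    unfolding d_def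
    by (intro sum.cong arg_cong2[of _ _ _ _ "(*)"] arg_cong[of _ _ prod_mset] image_mset_cong)
      (use some_P that in auto)
  have f_eq: "f a = (\<Sum>\<beta>\<in>B. m \<beta> a * d \<beta> (\<lambda>p. g p a))" for a
  proof -
    have "f a = (\<Sum>\<beta>\<in>B. \<Sum>i\<in>{i\<in>I. key i = \<beta>}. c i * sys.bas (\<lambda>_. 0) i a)"
      unfolding I(3) B_def by (rule sum.image_gen[OF I(1)])
    also have "\<dots> = (\<Sum>\<beta>\<in>B. m \<beta> a * d \<beta> (\<lambda>p. g p a))"
    proof (intro sum.cong refl)
      fix \<beta>
      show "(\<Sum>i\<in>{i\<in>I. key i = \<beta>}. c i * sys.bas (\<lambda>_. 0) i a) = m \<beta> a * d \<beta> (\<lambda>p. g p a)"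
        unfolding d_def sum_distrib_left
        by (intro sum.cong refl)
          (auto simp: sys.bas_def prod_mset_gen key_def m_def simp del: image_mset_filter_mset_swap)
    qed
    finally show ?thesis .
  qed
  have "d \<beta>0 z = 0" if z: "z \<in> Orb" and \<beta>0: "\<beta>0 \<in> B" for \<beta>0 z
  proof (rule ccontr)
    assume nz: "d \<beta>0 z \<noteq> 0"
    \<comment> \<open>On the fiber over \<open>z\<close> the coefficients are constants, so
      \<open>f\<close> agrees there with a combination of the \<open>m \<beta>\<close> with constant
      coefficients.\<close>
    have van': "(\<Sum>\<beta>\<in>B. m \<beta> a * d \<beta> z) = 0" if "\<delta> a \<noteq> 0" "\<forall>p\<in>P. g p a = z p" for a
      using van[OF z that] d_cong[OF that(2)] by (simp add: f_eq)
    have "(\<lambda>a. \<Sum>\<beta>\<in>B. m \<beta> a * d \<beta> z) \<in> assignment_polys"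
      by (intro A.sum A.mult m_poly A.const)
    from vanishing_fiber[OF this van'] obtain N
      where N: "(\<lambda>a. \<delta> a ^ N * (\<Sum>\<beta>\<in>B. m \<beta> a * d \<beta> z)) \<in> fiber_polys z" by blast
    \<comment> \<open>Multiplication by \<open>\<delta>^N\<close> turns \<open>m \<beta>\<close>
      into the basis element with \<open>N\<close> more copies of \<open>None\<close>. Such indices
      contain no \<open>Some p\<close>, so they avoid those that span the ideal.\<close>
    define \<tau> where "\<tau> = (\<lambda>(M :: 'v multiset, k). (M, replicate_mset (k + N) (None :: 'p option)))"
    have \<tau>_idx: "\<tau> \<beta> \<in> sys.idx" if "\<beta> \<in> B" for \<beta>
      using that I(2) by (auto simp: B_def \<tau>_def key_def sys.idx_def split: if_splits)
    have \<tau>_bas: "sys.bas z (\<tau> \<beta>) a = \<delta> a ^ N * m \<beta> a" for \<beta> a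
      by (cases \<beta>) (simp add: \<tau>_def sys.bas_def m_def power_add)
    have \<tau>_inj: "\<tau> \<beta> \<noteq> \<tau> \<beta>0" if "\<beta> \<noteq> \<beta>0" for \<beta>
      using that by (cases \<beta>; cases \<beta>0) (auto simp: \<tau>_def dest: arg_cong[of _ _ size])
    let ?S = "cfun.span (sys.bas z ` (sys.idx - {\<tau> \<beta>0}))"
    have "{(M, A) \<in> sys.idx. \<exists>p. Some p \<in># A} \<subseteq> sys.idx - {\<tau> \<beta>0}"
      by (cases \<beta>0) (auto simp: \<tau>_def split: if_splits)
    then have "(\<lambda>a. \<delta> a ^ N * (\<Sum>\<beta>\<in>B. m \<beta> a * d \<beta> z)) \<in> ?S"
      using fiber_polys_span[OF N] cfun.span_mono[OF image_mono] by blast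
    moreover have "(\<lambda>a. \<Sum>\<beta>\<in>B - {\<beta>0}. d \<beta> z * sys.bas z (\<tau> \<beta>) a) \<in> ?S"
      using \<tau>_idx \<tau>_inj by (intro cfun_sum cfun_scale cfun.span_base) auto
    ultimately have "(\<lambda>a. (1 / d \<beta>0 z) * (\<delta> a ^ N * (\<Sum>\<beta>\<in>B. m \<beta> a * d \<beta> z) -
        (\<Sum>\<beta>\<in>B - {\<beta>0}. d \<beta> z * sys.bas z (\<tau> \<beta>) a))) \<in> ?S"
      by (intro cfun_scale cfun_diff)
    moreover have "(1 / d \<beta>0 z) * (\<delta> a ^ N * (\<Sum>\<beta>\<in>B. m \<beta> a * d \<beta> z) -
        (\<Sum>\<beta>\<in>B - {\<beta>0}. d \<beta> z * sys.bas z (\<tau> \<beta>) a)) = sys.bas z (\<tau> \<beta>0) a" for a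
    proof -
      have "finite B" using I(1) by (simp add: B_def)
      then have "\<delta> a ^ N * (\<Sum>\<beta>\<in>B. m \<beta> a * d \<beta> z) =
          d \<beta>0 z * sys.bas z (\<tau> \<beta>0) a + (\<Sum>\<beta>\<in>B - {\<beta>0}. d \<beta> z * sys.bas z (\<tau> \<beta>) a)"
        using \<beta>0 by (simp add: sum.remove \<tau>_bas sum_distrib_left algebra_simps)
      then show ?thesis using nz by simp
    qed
    ultimately show False using sys.bas_notin_span[OF \<tau>_idx[OF \<beta>0], of z] by simp
  qed
  then show ?thesis
    using I(1) m_poly d_poly f_eq by (intro exI[of _ B] exI[of _ m] exI[of _ d]) (auto simp: B_def)
qed

text \<open>The segment from \<open>a\<close> to \<open>b\<close> leaves the part over
  \<open>Orb\<close>. Correcting it with target \<open>\<zeta> t\<close> brings it back wherever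
  \<open>E\<close> and \<open>\<delta>\<close> are nonzero and fixes both ends, which already lie
  over \<open>\<zeta> 0\<close> and \<open>\<zeta> 1\<close>. On the resulting rational curve
  \<open>f f'\<close> vanishes.\<close>

lemma irreducible_family:
  assumes f: "f \<in> assignment_polys" and f': "f' \<in> assignment_polys"
    and van: "\<And>a z. z \<in> Orb \<Longrightarrow> \<delta> a \<noteq> 0 \<Longrightarrow> \<forall>p\<in>P. g p a = z p \<Longrightarrow> f a * f' a = 0"
    and ab: "\<delta> a \<noteq> 0" "\<delta> b \<noteq> 0"
    and \<zeta>: "\<And>p. (\<lambda>t. \<zeta> t p) \<in> rational_funs {0, 1}" "\<forall>p\<in>P. g p a = \<zeta> 0 p" "\<forall>p\<in>P. g p b = \<zeta> 1 p"
    and E: "E \<in> rational_funs {0, 1}" "E 0 \<noteq> 0" "E 1 \<noteq> 0" "\<And>t. E t \<noteq> 0 \<Longrightarrow> \<zeta> t \<in> Orb"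
  shows "f a = 0 \<or> f' b = 0"
proof -
  interpret R: function_algebra UNIV "rational_funs {0, 1}" by (rule function_algebra_rational_funs)
  define \<alpha> where "\<alpha> t x = (1 - t) * a x + t * b x" for t x
  define \<alpha>' where "\<alpha>' t x = \<alpha> t x - T (\<zeta> t) x (\<alpha> t) / \<delta> (\<alpha> t)" for t x
  have \<alpha>: "(\<lambda>t. \<alpha> t x) \<in> rational_funs {0, 1}" for x
    unfolding \<alpha>_def by (intro R.add R.mult R.diff R.const rational_funs_ident)
  have \<alpha>01: "\<alpha> 0 = a" "\<alpha> 1 = b" by (auto simp: \<alpha>_def)
  have \<delta>\<alpha>: "(\<lambda>t. \<delta> (\<alpha> t)) \<in> rational_funs {0, 1}"
    by (rule R.comp_polynomial_funs[OF lead_polynomial[OF lead_\<delta>]]) (auto intro: \<alpha>)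
  have inv: "(\<lambda>t. 1 / \<delta> (\<alpha> t)) \<in> rational_funs {0, 1}"
    by (rule rational_funs_inverse[OF \<delta>\<alpha>]) (use ab \<alpha>01 in auto)
  have "(\<lambda>t. \<alpha> t x - T (\<zeta> t) x (\<alpha> t) * (1 / \<delta> (\<alpha> t))) \<in> rational_funs {0, 1}" for x
    by (intro R.diff R.mult \<alpha> inv T_rational \<zeta>(1))
  then have \<alpha>': "(\<lambda>t. \<alpha>' t x) \<in> rational_funs {0, 1}" for x by (simp add: \<alpha>'_def)
  have f\<alpha>: "(\<lambda>t. f (\<alpha>' t)) \<in> rational_funs {0, 1}" "(\<lambda>t. f' (\<alpha>' t)) \<in> rational_funs {0, 1}"
    by (auto intro!: R.comp_polynomial_funs[OF f] R.comp_polynomial_funs[OF f'] \<alpha>')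
  have "f (\<alpha>' 0) = 0 \<or> f' (\<alpha>' 1) = 0"
  proof (rule rational_funs_mult_eq_0[OF f\<alpha> R.mult[OF E(1) \<delta>\<alpha>]])
    fix t assume "E t * \<delta> (\<alpha> t) \<noteq> 0"
    then have t: "E t \<noteq> 0" "\<delta> (\<alpha> t) \<noteq> 0" by auto
    show "f (\<alpha>' t) * f' (\<alpha>' t) = 0"
      using van[OF E(4)[OF t(1)], of "\<alpha>' t"] T_\<delta>[OF t(2), of "\<zeta> t"] T_correct[OF t(2), of _ "\<zeta> t"] t(2)
      by (simp add: \<alpha>'_def [abs_def])
  qed (use E ab \<alpha>01 in auto)
  moreover have "\<alpha>' 0 = a" "\<alpha>' 1 = b"
    using fiber_polys_eq_0[OF T_fiber] \<zeta>(2,3) by (auto simp: \<alpha>'_def \<alpha>01)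
  ultimately show ?thesis by simp
qed

end

section \<open>The fiber ideal as a vanishing ideal\<close>

lemma vanishing_ideal_restrictD:
  assumes "restrict f (points V) \<in> vanishing_ideal V A" "A \<subseteq> points V" "x \<in> A"
  shows "f x = 0"
proof -
  have "restrict f (points V) x = 0" using assms(1,3) by (simp add: vanishing_ideal_def)
  then show ?thesis using assms(2,3) by (simp add: subsetD)
qed

text \<open>The bridge from families of polynomials to varieties. \<open>pt\<close> is only asked to
  have the right inverse \<open>\<xi>\<close>, because in the models the index type has infinitely
  many variables and only finitely many of them are used. Likewise \<open>\<chi>\<close> lists only
  coordinates sufficient to determine a point of \<open>S\<close>, such as a triangle of a symmetric
  matrix.\<close>

locale fiber_model =
  fixes V :: "'w variety" and S :: "'s variety" and \<psi> :: "'w \<Rightarrow> 's"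
    and pt :: "('v \<Rightarrow> complex) \<Rightarrow> 'w" and \<xi> :: "'w \<Rightarrow> 'v \<Rightarrow> complex"
    and \<chi> :: "'p \<Rightarrow> 's \<Rightarrow> complex" and \<Delta> :: "'w \<Rightarrow> complex"
    and w P \<mu> \<nu> T
  assumes family: "corrected_family w P \<mu> \<nu> (\<lambda>p a. \<chi> p (\<psi> (pt a))) (\<lambda>a. \<Delta> (pt a)) T"
    and pt_points: "pt a \<in> points V"
    and pt_\<xi>: "A \<in> points V \<Longrightarrow> pt (\<xi> A) = A"
    and \<xi>_regular: "(\<lambda>A. \<xi> A x) \<in> regular_funs V"
    and coord_pt: "c \<in> coords V \<Longrightarrow> (\<lambda>a. c (pt a)) \<in> assignment_polys"
    and \<psi>_points: "A \<in> points V \<Longrightarrow> \<psi> A \<in> points S"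
    and \<psi>_regular: "d \<in> coords S \<Longrightarrow> (\<lambda>A. d (\<psi> A)) \<in> regular_funs V"
    and \<chi>_coord: "p \<in> P \<Longrightarrow> \<chi> p \<in> coords S"
    and \<chi>_eq: "z \<in> points S \<Longrightarrow> z' \<in> points S \<Longrightarrow> (\<And>p. p \<in> P \<Longrightarrow> \<chi> p z = \<chi> p z') \<Longrightarrow> z = z'"
begin

sublocale corrected_family w P \<mu> \<nu> "\<lambda>p a. \<chi> p (\<psi> (pt a))" "\<lambda>a. \<Delta> (pt a)" T
  by (rule family)

lemma comp_pt: "f \<in> polynomial_funs (coords V) \<Longrightarrow> (\<lambda>a. f (pt a)) \<in> assignment_polys"
  by (rule function_algebra.comp_polynomial_funs[OF function_algebra_polynomial_funs]) (auto intro: coord_pt)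

lemma pullback_carrier:
  assumes "f \<in> carrier (coordinate_ring S)"
  shows "pullback V \<psi> f \<in> carrier (coordinate_ring V)"
proof -
  obtain f' where f': "f' \<in> polynomial_funs (coords S)" "f = restrict f' (points S)"
    using assms by (rule carrier_coordinate_ringE)
  have "(\<lambda>A. f' (\<psi> A)) \<in> regular_funs V"
    by (rule function_algebra.comp_polynomial_funs[OF function_algebra_regular_funs f'(1)])
      (rule \<psi>_regular)
  then have "restrict (\<lambda>A. f' (\<psi> A)) (points V) \<in> carrier (coordinate_ring V)" by (rule restrict_regular)
  also have "restrict (\<lambda>A. f' (\<psi> A)) (points V) = pullback V \<psi> f"
    using f'(2) by (auto simp: pullback_def restrict_def \<psi>_points)
  finally show ?thesis .
qed

text \<open>Values outside \<open>P\<close> are left free, since the targets \<open>z\<close> of a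
  family are functions on the whole index type.\<close>

definition orbit_values :: "'s set \<Rightarrow> ('p \<Rightarrow> complex) set" where
  "orbit_values Orb = {z. \<exists>y\<in>Orb. \<forall>p\<in>P. z p = \<chi> p y}"

lemma orbit_values_psi:
  assumes "Orb \<subseteq> points S" "z \<in> orbit_values Orb" "\<forall>p\<in>P. \<chi> p (\<psi> (pt a)) = z p"
  shows "\<psi> (pt a) \<in> Orb"
proof -
  obtain y where y: "y \<in> Orb" "\<forall>p\<in>P. z p = \<chi> p y" using assms(2) by (auto simp: orbit_values_def)
  have "\<psi> (pt a) = y"
    by (rule \<chi>_eq) (use y assms \<psi>_points[OF pt_points] in auto)
  then show ?thesis using y by simp
qed

text \<open>The source of reducedness. The coefficients vanish on the orbit, hence on its closure,
  so their pullbacks are among the generators of the fiber ideal, and each summand of the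
  decomposition is a multiple of such a generator.\<close>

lemma vanishing_mem_fiber_ideal:
  assumes Orb: "Orb \<subseteq> points S" and f: "f \<in> polynomial_funs (coords V)"
    and van: "\<And>a. \<psi> (pt a) \<in> Orb \<Longrightarrow> \<Delta> (pt a) \<noteq> 0 \<Longrightarrow> f (pt a) = 0"
  shows "restrict f (points V) \<in> fiber_ideal V \<psi> S (zariski S closure_of Orb)"
proof -
  let ?R = "coordinate_ring V" and ?I = "fiber_ideal V \<psi> S (zariski S closure_of Orb)"
  interpret R: cring ?R by (rule cring_coordinate_ring)
  have gen: "pullback V \<psi> ` vanishing_ideal S (zariski S closure_of Orb) \<subseteq> carrier ?R"
    using pullback_carrier by (auto simp: vanishing_ideal_def)
  interpret I: ideal ?I ?R unfolding fiber_ideal_def by (rule R.genideal_ideal[OF gen])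
  have "\<exists>B m c. finite B \<and>
    (\<forall>i\<in>B. m i \<in> assignment_polys \<and> c i \<in> polynomial_funs ((\<lambda>p \<zeta>. \<zeta> p) ` P) \<and>
      (\<forall>z\<in>orbit_values Orb. c i z = 0)) \<and>
    (\<lambda>a. f (pt a)) = (\<lambda>a. \<Sum>i\<in>(B :: ('v multiset \<times> nat) set). m i a * c i (\<lambda>p. \<chi> p (\<psi> (pt a))))"
    by (rule vanishing_decomposition[OF comp_pt[OF f]]) (auto intro: van orbit_values_psi[OF Orb])
  then obtain m c and B :: "('v multiset \<times> nat) set" where B: "finite B"
    "\<And>i. i \<in> B \<Longrightarrow> m i \<in> assignment_polys" "\<And>i. i \<in> B \<Longrightarrow> c i \<in> polynomial_funs ((\<lambda>p \<zeta>. \<zeta> p) ` P)"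
    "\<And>i z. i \<in> B \<Longrightarrow> z \<in> orbit_values Orb \<Longrightarrow> c i z = 0"
    "(\<lambda>a. f (pt a)) = (\<lambda>a. \<Sum>i\<in>B. m i a * c i (\<lambda>p. \<chi> p (\<psi> (pt a))))"
    by blast
  define h where "h i = (\<lambda>A\<in>points V. m i (\<xi> A) * c i (\<lambda>p. \<chi> p (\<psi> A)))" for i
  have h: "h i \<in> ?I" if i: "i \<in> B" for i
  proof -
    have "(\<lambda>A. m i (\<xi> A)) \<in> regular_funs V"
      by (rule function_algebra.comp_polynomial_funs[OF function_algebra_regular_funs B(2)[OF i]])
        (auto intro: \<xi>_regular)
    then have 1: "restrict (\<lambda>A. m i (\<xi> A)) (points V) \<in> carrier ?R" by (rule restrict_regular)
    have "(\<lambda>y. c i (\<lambda>p. \<chi> p y)) \<in> polynomial_funs (coords S)"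
      by (rule function_algebra.comp_polynomial_funs[OF function_algebra_polynomial_funs B(3)[OF i]])
        (auto intro!: polynomial_funs.coord \<chi>_coord)
    then have "restrict (\<lambda>y. c i (\<lambda>p. \<chi> p y)) (points S) \<in> carrier (coordinate_ring S)"
      by (intro restrict_regular polynomial_funs_regular)
    moreover have "c i (\<lambda>p. \<chi> p y) = 0" if "y \<in> Orb" for y
      using that by (intro B(4)[OF i]) (auto simp: orbit_values_def)
    ultimately have "restrict (\<lambda>y. c i (\<lambda>p. \<chi> p y)) (points S) \<in> vanishing_ideal S (zariski S closure_of Orb)"
      unfolding vanishing_ideal_closure[OF Orb] using Orb by (auto simp: vanishing_ideal_def)
    then have "pullback V \<psi> (restrict (\<lambda>y. c i (\<lambda>p. \<chi> p y)) (points S)) \<in> ?I"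
      unfolding fiber_ideal_def by (intro subsetD[OF R.genideal_self[OF gen]] imageI)
    from I.I_l_closed[OF this 1] show "h i \<in> ?I"
      by (simp add: h_def pullback_def coordinate_ring_def \<psi>_points cong: restrict_cong)
  qed
  have "(\<lambda>A\<in>points V. \<Sum>i\<in>B'. h i A) \<in> ?I" if "B' \<subseteq> B" for B'
    using finite_subset[OF that B(1)] that
  proof (induction B' rule: finite_induct)
    case empty
    have "\<zero>\<^bsub>?R\<^esub> = (\<lambda>A\<in>points V. \<Sum>i\<in>{}. h i A)"
      by (auto simp: coordinate_ring_def restrict_def)
    then show ?case using I.zero_closed by (simp only:)
  next
    case (insert i B')
    have "h i \<oplus>\<^bsub>?R\<^esub> (\<lambda>A\<in>points V. \<Sum>i\<in>B'. h i A) \<in> ?I"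
      by (rule I.a_closed[OF h insert.IH]) (use insert.prems in auto)
    moreover have "h i \<oplus>\<^bsub>?R\<^esub> (\<lambda>A\<in>points V. \<Sum>i\<in>B'. h i A) = (\<lambda>A\<in>points V. \<Sum>i\<in>insert i B'. h i A)"
      using insert(1,2) by (auto simp: coordinate_ring_def restrict_def)
    ultimately show ?case by (simp only:)
  qed
  from this[OF subset_refl] have "(\<lambda>A\<in>points V. \<Sum>i\<in>B. h i A) \<in> ?I" .
  also have "(\<lambda>A\<in>points V. \<Sum>i\<in>B. h i A) = restrict f (points V)"
  proof (rule restrict_ext)
    fix A assume A: "A \<in> points V"
    show "(\<Sum>i\<in>B. h i A) = f A"
      using fun_cong[OF B(5), of "\<xi> A"] A by (simp add: h_def pt_\<xi>)
  qed
  finally show ?thesis .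
qed

lemma fiber_ideal_subset:
  assumes "Orb \<subseteq> points S" "\<Omega> \<subseteq> points V" "\<psi> ` \<Omega> \<subseteq> Orb"
  shows "fiber_ideal V \<psi> S (zariski S closure_of Orb) \<subseteq> vanishing_ideal V \<Omega>"
proof -
  interpret R: cring "coordinate_ring V" by (rule cring_coordinate_ring)
  show ?thesis
    unfolding fiber_ideal_def vanishing_ideal_closure[OF assms(1)]
  proof (rule R.genideal_minimal[OF vanishing_ideal_ideal[OF assms(2)]])
    show "pullback V \<psi> ` vanishing_ideal S Orb \<subseteq> vanishing_ideal V \<Omega>"
      using assms pullback_carrier by (auto simp: vanishing_ideal_def pullback_def subset_iff)
  qed
qed

text \<open>The ideal is squeezed: it lies in the vanishing ideal of \<open>\<Omega>\<close> because
  \<open>\<psi>\<close> maps \<open>\<Omega>\<close> into the orbit, and a function vanishing on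
  \<open>\<Omega>\<close> vanishes on the chart part by \<open>dense\<close> and so belongs to the
  ideal. \<open>dense\<close> is weaker than containment of the chart part in
  \<open>\<Omega>\<close>; the pairings need this weaker form.\<close>

theorem fiber_irreducible:
  assumes Orb: "Orb \<subseteq> points S"
    and \<Omega>: "\<Omega> \<subseteq> points V" "\<Omega> \<noteq> {}" "\<psi> ` \<Omega> \<subseteq> Orb"
    and dense: "\<And>f A. f \<in> polynomial_funs (coords V) \<Longrightarrow> (\<And>x. x \<in> \<Omega> \<Longrightarrow> f x = 0) \<Longrightarrow> A \<in> points V \<Longrightarrow>
      \<psi> A \<in> Orb \<Longrightarrow> \<Delta> A \<noteq> 0 \<Longrightarrow> f A = 0"
    and curve: "\<And>z z'. z \<in> Orb \<Longrightarrow> z' \<in> Orb \<Longrightarrow>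
      \<exists>\<zeta> E. (\<forall>p\<in>P. (\<lambda>t. \<chi> p (\<zeta> t)) \<in> rational_funs {0, 1}) \<and> \<zeta> 0 = z \<and> \<zeta> 1 = z' \<and>
        E \<in> rational_funs {0, 1} \<and> E 0 \<noteq> 0 \<and> E 1 \<noteq> 0 \<and> (\<forall>t. E t \<noteq> 0 \<longrightarrow> \<zeta> t \<in> Orb)"
  defines "I \<equiv> fiber_ideal V \<psi> S (zariski S closure_of Orb)"
  shows "reduced_irreducible_closed_subvariety V I \<and> zero_locus V I = zariski V closure_of \<Omega>"
proof -
  \<comment> \<open>A function nonzero somewhere on \<open>\<Omega>\<close> is nonzero somewhere on
    the chart part, for otherwise it would be in the ideal. Hence the curves can be drawn inside the
    chart although \<open>\<Omega>\<close> may leave it.\<close>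
  have nonzero: "\<exists>a. \<psi> (pt a) \<in> Orb \<and> \<Delta> (pt a) \<noteq> 0 \<and> f (pt a) \<noteq> 0"
    if f: "f \<in> polynomial_funs (coords V)" and x: "x \<in> \<Omega>" "f x \<noteq> 0" for f x
  proof (rule ccontr)
    assume "\<not> ?thesis"
    then have "restrict f (points V) \<in> I"
      unfolding I_def by (intro vanishing_mem_fiber_ideal[OF Orb f]) blast
    then have "restrict f (points V) \<in> vanishing_ideal V \<Omega>"
      using fiber_ideal_subset[OF Orb \<Omega>(1,3)] by (auto simp: I_def)
    then show False using vanishing_ideal_restrictD[OF _ \<Omega>(1) x(1)] x(2) by blast
  qed
  have sub: "vanishing_ideal V \<Omega> \<subseteq> I"
  proof
    fix f assume f: "f \<in> vanishing_ideal V \<Omega>"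
    then obtain f' where f': "f' \<in> polynomial_funs (coords V)" "f = restrict f' (points V)"
      by (auto simp: vanishing_ideal_def elim: carrier_coordinate_ringE)
    have 0: "f' x = 0" if "x \<in> \<Omega>" for x
      using f unfolding f'(2) by (rule vanishing_ideal_restrictD[OF _ \<Omega>(1) that])
    show "f \<in> I"
      unfolding f'(2) I_def
      by (rule vanishing_mem_fiber_ideal[OF Orb f'(1)]) (rule dense[OF f'(1) 0 pt_points])
  qed
  have I: "I = vanishing_ideal V \<Omega>"
    by (rule equalityI[OF fiber_ideal_subset[OF Orb \<Omega>(1,3), folded I_def] sub])
  have "(\<forall>x\<in>\<Omega>. f x = 0) \<or> (\<forall>x\<in>\<Omega>. f' x = 0)"
    if f: "f \<in> polynomial_funs (coords V)" "f' \<in> polynomial_funs (coords V)"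
      and van: "\<forall>x\<in>\<Omega>. f x * f' x = 0" for f f'
  proof (rule ccontr)
    assume "\<not> ?thesis"
    then obtain x y where xy: "x \<in> \<Omega>" "f x \<noteq> 0" "y \<in> \<Omega>" "f' y \<noteq> 0" by blast
    obtain a where a: "\<psi> (pt a) \<in> Orb" "\<Delta> (pt a) \<noteq> 0" "f (pt a) \<noteq> 0"
      using nonzero[OF f(1) xy(1,2)] by blast
    obtain b where b: "\<psi> (pt b) \<in> Orb" "\<Delta> (pt b) \<noteq> 0" "f' (pt b) \<noteq> 0"
      using nonzero[OF f(2) xy(3,4)] by blast
    obtain \<zeta> E where \<zeta>: "\<And>p. p \<in> P \<Longrightarrow> (\<lambda>t. \<chi> p (\<zeta> t)) \<in> rational_funs {0, 1}"
      "\<zeta> 0 = \<psi> (pt a)" "\<zeta> 1 = \<psi> (pt b)"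
      "E \<in> rational_funs {0, 1}" "E 0 \<noteq> 0" "E 1 \<noteq> 0" "\<And>t. E t \<noteq> 0 \<Longrightarrow> \<zeta> t \<in> Orb"
      using curve[OF a(1) b(1)] by blast
    have "f (pt a) = 0 \<or> f' (pt b) = 0"
    proof (rule irreducible_family[OF comp_pt[OF f(1)] comp_pt[OF f(2)], of "orbit_values Orb" a b
          "\<lambda>t p. if p \<in> P then \<chi> p (\<zeta> t) else 0" E])
      fix a' z assume *: "z \<in> orbit_values Orb" "\<Delta> (pt a') \<noteq> 0" "\<forall>p\<in>P. \<chi> p (\<psi> (pt a')) = z p"
      \<comment> \<open>\<open>dense\<close> is applied to the product, because the point itself
        need not lie in \<open>\<Omega>\<close>.\<close>
      show "f (pt a') * f' (pt a') = 0"
        by (rule dense[OF polynomial_funs.mult[OF f]])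
          (use van * orbit_values_psi[OF Orb *(1,3)] pt_points in auto)
    next
      fix p show "(\<lambda>t. if p \<in> P then \<chi> p (\<zeta> t) else 0) \<in> rational_funs {0, 1}"
        using \<zeta>(1)[of p] function_algebra.const[OF function_algebra_rational_funs] by (cases "p \<in> P") auto
    next
      fix t assume "E t \<noteq> 0"
      then show "(\<lambda>p. if p \<in> P then \<chi> p (\<zeta> t) else 0) \<in> orbit_values Orb"
        using \<zeta>(7)[of t] by (auto simp: orbit_values_def)
    next
      show "\<forall>p\<in>P. \<chi> p (\<psi> (pt a)) = (if p \<in> P then \<chi> p (\<zeta> 0) else 0)"
        "\<forall>p\<in>P. \<chi> p (\<psi> (pt b)) = (if p \<in> P then \<chi> p (\<zeta> 1) else 0)"
        by (simp_all add: \<zeta>(2,3))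
    qed (fact a(2) b(2) \<zeta>(4-6))+
    then show False using a(3) b(3) by simp
  qed
  from vanishing_ideal_irreducible[OF \<Omega>(1,2) this] zero_locus_vanishing_ideal[OF \<Omega>(1)] show ?thesis
    unfolding I by (rule conjI)
qed

end

section \<open>The two families of quadratic equations\<close>

text \<open>Both permutations have the same sum of squares, so the difference of the two sides is
  half of the sum of the \<open>(\<pi> k - \<pi>0 k)^2\<close>. With weights bilinear in row and
  column this makes one term of a determinant dominate.\<close>

lemma rearrangement_strict:
  assumes "\<pi> permutes {0..<n}" "\<pi>0 permutes {0..<n}" "\<pi> \<noteq> \<pi>0"
  shows "(\<Sum>k<n. int (\<pi>0 k) * int (\<pi> k)) < (\<Sum>k<n. int (\<pi>0 k) * int (\<pi>0 k))"
proof -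
  obtain k where k: "k < n" "\<pi> k \<noteq> \<pi>0 k"
  proof -
    obtain k where "\<pi> k \<noteq> \<pi>0 k" using assms(3) by blast
    moreover from this have "k < n"
      using assms(1,2) by (metis atLeastLessThan_iff le0 permutes_not_in)
    ultimately show ?thesis using that by blast
  qed
  have sq: "(\<Sum>k<n. (int (\<sigma> k))\<^sup>2) = (\<Sum>k<n. (int k)\<^sup>2)" if "\<sigma> permutes {0..<n}" for \<sigma>
    using sum.permute[OF that, of "\<lambda>k. (int k)\<^sup>2"] by (simp add: atLeast0LessThan)
  have "0 < (\<Sum>k<n. (int (\<pi> k) - int (\<pi>0 k))\<^sup>2)"
    using k by (intro sum_pos2[of _ k]) auto
  also have "\<dots> = (\<Sum>k<n. (int (\<pi> k))\<^sup>2) + (\<Sum>k<n. (int (\<pi>0 k))\<^sup>2) - 2 * (\<Sum>k<n. int (\<pi>0 k) * int (\<pi> k))"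
    by (simp add: power2_diff sum.distrib sum_subtractf sum_distrib_left algebra_simps)
  finally show ?thesis
    using sq[OF assms(1)] sq[OF assms(2)] by (simp add: power2_eq_square)
qed

lemma lead_det:
  fixes x :: "nat \<Rightarrow> nat \<Rightarrow> 'v"
  assumes "\<pi>0 permutes {0..<n}"
    and "\<And>\<pi>. \<pi> permutes {0..<n} \<Longrightarrow> \<pi> \<noteq> \<pi>0 \<Longrightarrow> (\<Sum>k<n. w (x k (\<pi> k))) < (\<Sum>k<n. w (x k (\<pi>0 k)))"
  shows "lead w (image_mset (\<lambda>k. x k (\<pi>0 k)) (mset_set {0..<n})) (\<lambda>a. det (mat n n (\<lambda>(k, i). a (x k i))))"
proof -
  define M where "M \<pi> = image_mset (\<lambda>k. x k (\<pi> k)) (mset_set {0..<n})" for \<pi>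
  have wt: "wt w (M \<pi>) = (\<Sum>k<n. w (x k (\<pi> k)))" for \<pi>
    by (simp add: wt_def M_def atLeast0LessThan sum_unfold_sum_mset image_mset.compositionality o_def)
  have monf: "monf (M \<pi>) a = (\<Prod>k\<in>{0..<n}. a (x k (\<pi> k)))" for \<pi> and a :: "'v \<Rightarrow> complex"
    by (simp add: monf_def M_def prod_unfold_prod_mset image_mset.compositionality o_def)
  have "lead w (M \<pi>0) (\<lambda>a. \<Sum>\<pi>\<in>{\<pi>. \<pi> permutes {0..<n}}. signof \<pi> * monf (M \<pi>) a)"
    by (rule lead_sum) (use assms in \<open>auto simp: finite_permutations wt sign_def\<close>)
  also have "(\<lambda>a. \<Sum>\<pi>\<in>{\<pi>. \<pi> permutes {0..<n}}. signof \<pi> * monf (M \<pi>) a) =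
      (\<lambda>a. det (mat n n (\<lambda>(k, i). a (x k i))))"
  proof
    fix a :: "'v \<Rightarrow> complex"
    have *: "(\<Prod>k\<in>{0..<n}. a (x k (\<pi> k))) = (\<Prod>k\<in>{0..<n}. mat n n (\<lambda>(k, i). a (x k i)) $$ (k, \<pi> k))"
      if "\<pi> permutes {0..<n}" for \<pi>
      using that by (intro prod.cong) (auto simp: permutes_in_image)
    show "(\<Sum>\<pi>\<in>{\<pi>. \<pi> permutes {0..<n}}. signof \<pi> * monf (M \<pi>) a) =
        det (mat n n (\<lambda>(k, i). a (x k i)))"
      unfolding det_def'[OF mat_carrier] monf
      by (intro sum.cong refl arg_cong2[of _ _ _ _ "(*)"] *) simp
  qed
  finally show ?thesis by (simp add: M_def)
qed

lemma sum_adj_mat: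
  assumes A: "A \<in> carrier_mat n n" and ij: "i' < n" "i < n"
  shows "(\<Sum>k<n. A $$ (k, i) * adj_mat A $$ (i', k)) = (if i = i' then det A else 0)"
proof -
  have "(adj_mat A * A) $$ (i', i) = (\<Sum>k<n. adj_mat A $$ (i', k) * A $$ (k, i))"
    using adj_mat(1)[OF A] A ij by (simp add: scalar_prod_def atLeast0LessThan)
  then show ?thesis using adj_mat(3)[OF A] ij by (cases "i = i'") (simp_all add: mult.commute)
qed

text \<open>Cramer's rule before division: the adjugate solves the linear system with matrix
  \<open>A\<^sup>T\<close> up to the factor \<open>det A\<close>.\<close>

lemma sum_adj_mat_solve:
  assumes A: "A \<in> carrier_mat n n" and i: "i < n"
  shows "(\<Sum>k<n. A $$ (k, i) * (\<Sum>i'<n. adj_mat A $$ (i', k) * e i')) = det A * e i"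
proof -
  have "(\<Sum>k<n. A $$ (k, i) * (\<Sum>i'<n. adj_mat A $$ (i', k) * e i')) =
      (\<Sum>i'<n. (\<Sum>k<n. A $$ (k, i) * adj_mat A $$ (i', k)) * e i')"
    unfolding sum_distrib_left sum_distrib_right by (subst sum.swap) (simp add: mult.assoc)
  also have "\<dots> = (\<Sum>i'<n. (if i = i' then det A else 0) * e i')"
    by (intro sum.cong refl) (simp add: sum_adj_mat[OF A] i)
  also have "\<dots> = det A * e i" using i by (simp add: if_distrib[of "\<lambda>x. x * _"] cong: if_cong)
  finally show ?thesis .
qed

lemma corrected_family_cong:
  assumes "corrected_family w P \<mu> \<nu> g \<delta> T" "\<And>p. p \<in> P \<Longrightarrow> g' p = g p"
  shows "corrected_family w P \<mu> \<nu> g' \<delta> T"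
proof -
  interpret g: corrected_family w P \<mu> \<nu> g \<delta> T by (rule assms(1))
  interpret g': coprime_family w P \<mu> \<nu> g' \<delta>
    by standard (use g.finite_P g.lead_g g.lead_\<delta> g.wt_\<mu> g.wt_\<nu> g.disjoint_\<mu> g.disjoint_\<nu> assms(2) in auto)
  have eq: "(\<Sum>p\<in>P. (g' p a - z p) * h p a) = (\<Sum>p\<in>P. (g p a - z p) * h p a)" for z h a
    by (intro sum.cong) (simp_all add: assms(2))
  have "g'.fiber_polys = g.fiber_polys"
    by (intro ext) (simp add: g.fiber_polys_def g'.fiber_polys_def eq)
  then show ?thesis
    by unfold_locales (use g.T_fiber g.T_correct g.T_\<delta> g.T_rational assms(2) in auto)
qed

text \<open>
  A variable \<open>(s, c, k, i)\<close> is the entry in row \<open>k\<close> and column \<open>i\<close> of the block \<open>c\<close> of the factor \<open>s\<close>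
  of \<open>W = W\<^sup>+ \<times> W\<^sup>-\<close>.
\<close>

type_synonym var = "bool \<times> nat \<times> nat \<times> nat"

subsection \<open>Symmetric and alternating forms\<close>

text \<open>
  The blocks 0 and 1 are the components of a matrix along two dual isotropic subspaces, and block 2
  (present only for symmetric forms) its component along their orthogonal complement. The weights make
  an off-diagonal equation \<open>(i, j)\<close> lead with \<open>u(k, i) v(k, j)\<close> for \<open>k = j - i - 1\<close>, a diagonal one
  with \<open>r(0, i)\<^sup>2\<close>, and the determinant of the first rows of \<open>u\<close> with its antidiagonal.
\<close>

locale form_family =
  fixes n :: nat and N1 N2 :: "bool \<Rightarrow> nat" and \<epsilon> :: complex
  assumes n_pos: "0 < n" and n_le: "n \<le> N1 s"
    and \<epsilon>: "\<epsilon> = 1 \<and> (\<forall>s. 0 < N2 s) \<or> \<epsilon> = -1 \<and> (\<forall>s. N2 s = 0)"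
begin

text \<open>The remaining entries of the form follow by \<open>\<epsilon>\<close>-symmetry, and for
  \<open>\<epsilon> = -1\<close> the diagonal vanishes.\<close>

definition eqs :: "(bool \<times> nat \<times> nat) set" where
  "eqs = {(s, i, j). j < n \<and> (i < j \<or> i = j \<and> \<epsilon> = 1)}"

definition form :: "bool \<times> nat \<times> nat \<Rightarrow> (var \<Rightarrow> complex) \<Rightarrow> complex" where
  "form = (\<lambda>(s, i, j) a.
    (\<Sum>k<N1 s. a (s, 0, k, i) * a (s, 1, k, j) + \<epsilon> * (a (s, 1, k, i) * a (s, 0, k, j))) +
    (\<Sum>l<N2 s. a (s, 2, l, i) * a (s, 2, l, j)))"

definition U :: "bool \<Rightarrow> (var \<Rightarrow> complex) \<Rightarrow> complex mat" where
  "U s a = mat n n (\<lambda>(k, i). a (s, 0, k, i))"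

definition dU :: "(var \<Rightarrow> complex) \<Rightarrow> complex" where
  "dU a = det (U True a) * det (U False a)"

text \<open>A shift common to all variables that keeps the weights in range nonnegative, so that
  \<open>nat\<close> loses nothing. It has no influence on comparisons, since all monomials compared
  have equal degree.\<close>

definition bound :: int where
  "bound = (int (N1 True) + int (N1 False))\<^sup>2 + 4 * (int (N1 True) + int (N1 False)) * int n + 1"

text \<open>By completing the square, \<open>u(k, i) v(k, j)\<close> weighs
  \<open>2 * bound + 2 * (j - i)^2 - 2 * ((k + 1) - (j - i))^2\<close>; for \<open>i < j\<close> the
  unique maximum is at \<open>k + 1 = j - i\<close>. For \<open>j \<le> i\<close> the weight stays
  below \<open>2 * bound\<close>, the weight of \<open>r(0, i)^2\<close>. With \<open>k\<close> in
  place of \<open>k + 1\<close> row 0 would tie with that square on the diagonal.\<close>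

definition w :: "var \<Rightarrow> nat" where
  "w = (\<lambda>(s, c, k, i). nat (bound +
    (if c = 0 then - (int k + 1)\<^sup>2 - 4 * (int k + 1) * int i
     else if c = 1 then - (int k + 1)\<^sup>2 + 4 * (int k + 1) * int i
     else if k = 0 then 0 else - 1)))"

definition lead_eq :: "bool \<times> nat \<times> nat \<Rightarrow> var multiset" where
  "lead_eq = (\<lambda>(s, i, j). if i < j then {#(s, 0, j - i - 1, i), (s, 1, j - i - 1, j)#}
    else {#(s, 2, 0, i), (s, 2, 0, i)#})"

definition lead_U :: "bool \<Rightarrow> var multiset" where
  "lead_U s = image_mset (\<lambda>k. (s, 0, k, n - 1 - k)) (mset_set {0..<n})"

text \<open>The defect \<open>form - z\<close>, continued from the listed equations to a full
  \<open>\<epsilon>\<close>-symmetric matrix.\<close>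

definition err :: "(bool \<times> nat \<times> nat \<Rightarrow> complex) \<Rightarrow> bool \<Rightarrow> nat \<Rightarrow> nat \<Rightarrow> (var \<Rightarrow> complex) \<Rightarrow> complex" where
  "err z s i j a = (if (s, i, j) \<in> eqs then form (s, i, j) a - z (s, i, j)
    else if (s, j, i) \<in> eqs then \<epsilon> * (form (s, j, i) a - z (s, j, i)) else 0)"

text \<open>Only \<open>v\<close> moves, by half of the solution of a linear system with matrix
  \<open>U\<^sup>T\<close> and right-hand side \<open>err\<close>: the two mirrored terms of the
  form each remove half of the defect. The factor \<open>det (U (\<not> s) a)\<close> compensates
  for the common denominator \<open>dU\<close>, which contains the minors of both values of
  \<open>s\<close>.\<close>

definition corr :: "(bool \<times> nat \<times> nat \<Rightarrow> complex) \<Rightarrow> var \<Rightarrow> (var \<Rightarrow> complex) \<Rightarrow> complex" where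
  "corr z = (\<lambda>(s, c, k, j) a. if c = 1 \<and> k < n \<and> j < n
    then (\<Sum>i<n. adj_mat (U s a) $$ (i, k) * err z s i j a) * det (U (\<not> s) a) / 2 else 0)"

lemma dU_eq: "dU a = det (U s a) * det (U (\<not> s) a)"
  by (cases s) (simp_all add: dU_def mult.commute)

lemma U_carrier [simp]: "U s a \<in> carrier_mat n n"
  by (simp add: U_def)

lemma bound_ge:
  assumes "k < N1 s" "i < n"
  shows "(int k + 1)\<^sup>2 + 4 * (int k + 1) * int i < bound"
proof -
  let ?N = "int (N1 True) + int (N1 False)"
  have k: "int k + 1 \<le> ?N" using assms(1) by (cases s) auto
  have "(int k + 1)\<^sup>2 \<le> ?N\<^sup>2" using k by (intro power_mono) auto
  moreover have "(int k + 1) * int i \<le> ?N * int n" using k assms(2) by (intro mult_mono) auto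
  ultimately show ?thesis unfolding bound_def mult.assoc by linarith
qed

lemma bound_pos: "1 \<le> bound"
  by (simp add: bound_def)

lemma w_u: "k < N1 s \<Longrightarrow> i < n \<Longrightarrow> int (w (s, 0, k, i)) = bound - (int k + 1)\<^sup>2 - 4 * (int k + 1) * int i"
  using bound_ge[of k s i] by (simp add: w_def)

lemma w_v: "k < N1 s \<Longrightarrow> i < n \<Longrightarrow> int (w (s, 1, k, i)) = bound - (int k + 1)\<^sup>2 + 4 * (int k + 1) * int i"
proof -
  assume "k < N1 s" "i < n"
  then have "(int k + 1)\<^sup>2 + 4 * (int k + 1) * int i < bound" by (rule bound_ge)
  moreover have "0 \<le> 4 * (int k + 1) * int i" by simp
  ultimately have "0 \<le> bound + (- (int k + 1)\<^sup>2 + 4 * (int k + 1) * int i)" by linarith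
  then show ?thesis by (simp add: w_def)
qed

lemma w_r: "int (w (s, 2, k, i)) = bound + (if k = 0 then 0 else - 1)"
  using bound_pos by (simp add: w_def)

lemma lead_form:
  assumes "p \<in> eqs"
  shows "lead w (lead_eq p) (form p)"
proof -
  obtain s i j where p: "p = (s, i, j)" by (cases p)
  let ?uv = "\<lambda>i j k. {#(s, 0, k, i), (s, 1, k, j)#}"
  let ?r = "\<lambda>k. {#(s, 2, k, i), (s, 2, k, j)#}"
  have j: "j < n" "i \<le> j" using assms by (auto simp: eqs_def p)
  have uv: "int (wt w (?uv i j k)) = 2 * bound - 2 * (int k + 1)\<^sup>2 + 4 * (int k + 1) * (int j - int i)"
    if "k < N1 s" "i < n" "j < n" for i j k
    using w_u[OF that(1,2)] w_v[OF that(1,3)] by (simp add: algebra_simps)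
  have r: "int (wt w (?r k)) = 2 * bound + (if k = 0 then 0 else - 2)" for k
    using w_r[of s k i] w_r[of s k j] by simp
  show ?thesis
  proof (cases "i < j")
    case True
    define k0 where "k0 = j - i - 1"
    have k0: "k0 < N1 s" "int k0 + 1 = int j - int i" using True j n_le[of s] by (auto simp: k0_def)
    have top: "int (wt w (?uv i j k0)) = 2 * bound + 2 * (int j - int i)\<^sup>2"
      using uv[of k0 i j] k0 True j by (simp add: power2_eq_square)
    have "lead w (?uv i j k0) (\<lambda>a. \<Sum>k<N1 s. 1 * monf (?uv i j k) a)"
    proof (rule lead_sum)
      fix k assume k: "k \<in> {..<N1 s}" "k \<noteq> k0"
      have "0 < (int k + 1 - (int j - int i))\<^sup>2" using k k0 by auto
      then have "- 2 * (int k + 1)\<^sup>2 + 4 * (int k + 1) * (int j - int i) < 2 * (int j - int i)\<^sup>2"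
        by (simp add: power2_eq_square algebra_simps)
      then have "int (wt w (?uv i j k)) < int (wt w (?uv i j k0))"
        using uv[of k i j] top k j True by simp
      then show "1 = (0 :: complex) \<or> wt w (?uv i j k) < wt w (?uv i j k0)" by simp
    qed (use k0 in auto)
    \<comment> \<open>The mirrored products and those of block 2 weigh at most
      \<open>2 * bound\<close>, which is less than the leading weight since
      \<open>i < j\<close>.\<close>
    moreover have "(\<lambda>a. (\<Sum>k<N1 s. \<epsilon> * monf (?uv j i k) a) + (\<Sum>l<N2 s. monf (?r l) a))
        \<in> low w (wt w (?uv i j k0))"
    proof (intro low_add low_sum low_scale low_monf)
      fix k assume k: "k \<in> {..<N1 s}"
      have "4 * (int k + 1) * (int i - int j) \<le> 0" "0 < (int j - int i)\<^sup>2" "0 \<le> (int k + 1)\<^sup>2"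
        using True by (auto simp: mult_le_0_iff)
      moreover have "int (wt w (?uv j i k)) = 2 * bound - 2 * (int k + 1)\<^sup>2 + 4 * (int k + 1) * (int i - int j)"
        using k j True by (intro uv) auto
      ultimately have "int (wt w (?uv j i k)) < int (wt w (?uv i j k0))" using top by linarith
      then show "wt w (?uv j i k) < wt w (?uv i j k0)" by simp
    next
      fix l
      have "0 < (int j - int i)\<^sup>2" using True by auto
      moreover have "int (wt w (?r l)) \<le> 2 * bound" using r[of l] by simp
      ultimately have "int (wt w (?r l)) < int (wt w (?uv i j k0))" using top by linarith
      then show "wt w (?r l) < wt w (?uv i j k0)" by simp
    qed
    ultimately have "lead w (?uv i j k0) (\<lambda>a. (\<Sum>k<N1 s. 1 * monf (?uv i j k) a) +
        ((\<Sum>k<N1 s. \<epsilon> * monf (?uv j i k) a) + (\<Sum>l<N2 s. monf (?r l) a)))"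
      by (rule lead_add_low)
    moreover have "form p = (\<lambda>a. (\<Sum>k<N1 s. 1 * monf (?uv i j k) a) +
        ((\<Sum>k<N1 s. \<epsilon> * monf (?uv j i k) a) + (\<Sum>l<N2 s. monf (?r l) a)))"
      by (auto simp: form_def p sum.distrib mult.commute)
    ultimately show ?thesis using True by (simp add: lead_eq_def p k0_def)
  next
    case False
    then have ij: "i = j" and eps: "\<epsilon> = 1" and N2: "0 < N2 s" using assms \<epsilon> by (auto simp: eqs_def p)
    have top: "int (wt w (?r 0)) = 2 * bound" using r[of 0] by simp
    have "lead w (?r 0) (\<lambda>a. \<Sum>l<N2 s. 1 * monf (?r l) a)"
    proof (rule lead_sum)
      fix l assume "l \<in> {..<N2 s}" "l \<noteq> 0"
      then have "int (wt w (?r l)) < int (wt w (?r 0))" using r[of l] top by simp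
      then show "1 = (0 :: complex) \<or> wt w (?r l) < wt w (?r 0)" by simp
    qed (use N2 in auto)
    moreover have "(\<lambda>a. \<Sum>k<N1 s. 2 * monf (?uv i j k) a) \<in> low w (wt w (?r 0))"
    proof (intro low_sum low_scale low_monf)
      fix k assume k: "k \<in> {..<N1 s}"
      have "int (wt w (?uv i j k)) < int (wt w (?r 0))"
        using uv[of k i j] top k j ij by (simp add: zero_less_power2)
      then show "wt w (?uv i j k) < wt w (?r 0)" by simp
    qed
    ultimately have "lead w (?r 0) (\<lambda>a. (\<Sum>l<N2 s. 1 * monf (?r l) a) + (\<Sum>k<N1 s. 2 * monf (?uv i j k) a))"
      by (rule lead_add_low)
    moreover have "form p = (\<lambda>a. (\<Sum>l<N2 s. 1 * monf (?r l) a) + (\<Sum>k<N1 s. 2 * monf (?uv i j k) a))"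
    proof
      fix a :: "var \<Rightarrow> complex"
      have "(\<Sum>k<N1 s. a (s, 0, k, i) * a (s, 1, k, j) + \<epsilon> * (a (s, 1, k, i) * a (s, 0, k, j))) =
          (\<Sum>k<N1 s. 2 * monf (?uv i j k) a)"
        by (intro sum.cong) (simp_all add: ij eps)
      then show "form p a = (\<Sum>l<N2 s. 1 * monf (?r l) a) + (\<Sum>k<N1 s. 2 * monf (?uv i j k) a)"
        by (simp add: form_def p)
    qed
    ultimately show ?thesis using ij by (simp add: lead_eq_def p)
  qed
qed

text \<open>Since \<open>k + 1 = n - \<pi>0 k\<close>, the weight of a term is, up to a part common
  to all permutations, four times the sum of the \<open>\<pi>0 k * \<pi> k\<close>; so
  \<open>\<pi>0\<close> wins by rearrangement.\<close>

lemma lead_det_U: "lead w (lead_U s) (\<lambda>a. det (U s a))"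
proof -
  define \<pi>0 where "\<pi>0 k = (if k < n then n - 1 - k else k)" for k
  have inv: "\<pi>0 (\<pi>0 k) = k" for k by (auto simp: \<pi>0_def)
  have perm0: "\<pi>0 permutes {0..<n}"
    by (rule bij_imp_permutes) (auto simp: \<pi>0_def intro!: bij_betwI[of _ _ _ \<pi>0])
  have "lead w (image_mset (\<lambda>k. (s, 0, k, \<pi>0 k)) (mset_set {0..<n}))
      (\<lambda>a. det (mat n n (\<lambda>(k, i). a (s, 0, k, i))))"
  proof (rule lead_det[OF perm0, of w "\<lambda>k i. (s, 0, k, i)"])
    fix \<pi> assume \<pi>: "\<pi> permutes {0..<n}" "\<pi> \<noteq> \<pi>0"
    define c where "c = (\<Sum>k<n. bound - (int k + 1)\<^sup>2) - 4 * int n * (\<Sum>k<n. int k)"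
    have eq: "int (\<Sum>k<n. w (s, 0, k, \<sigma> k)) = c + 4 * (\<Sum>k<n. int (\<pi>0 k) * int (\<sigma> k))"
      if \<sigma>: "\<sigma> permutes {0..<n}" for \<sigma>
    proof -
      have "int (\<Sum>k<n. w (s, 0, k, \<sigma> k)) =
          (\<Sum>k<n. bound - (int k + 1)\<^sup>2 - 4 * int n * int (\<sigma> k) + 4 * (int (\<pi>0 k) * int (\<sigma> k)))"
        unfolding of_nat_sum
      proof (rule sum.cong[OF refl])
        fix k assume k: "k \<in> {..<n}"
        then have "\<sigma> k < n" using permutes_in_image[OF \<sigma>, of k] by auto
        then have wk: "int (w (s, 0, k, \<sigma> k)) = bound - (int k + 1)\<^sup>2 - 4 * (int k + 1) * int (\<sigma> k)"
          using k n_le[of s] by (intro w_u) auto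
        have pk: "int (\<pi>0 k) = int n - 1 - int k" using k by (auto simp: \<pi>0_def)
        show "int (w (s, 0, k, \<sigma> k)) =
            bound - (int k + 1)\<^sup>2 - 4 * int n * int (\<sigma> k) + 4 * (int (\<pi>0 k) * int (\<sigma> k))"
          unfolding wk pk by (simp add: algebra_simps)
      qed
      also have "\<dots> = (\<Sum>k<n. bound - (int k + 1)\<^sup>2) - 4 * int n * (\<Sum>k<n. int (\<sigma> k)) +
          4 * (\<Sum>k<n. int (\<pi>0 k) * int (\<sigma> k))"
        by (simp add: sum.distrib sum_subtractf sum_distrib_left)
      also have "(\<Sum>k<n. int (\<sigma> k)) = (\<Sum>k<n. int k)"
        using sum.permute[OF \<sigma>, of int] by (simp add: atLeast0LessThan)
      finally show ?thesis by (simp add: c_def)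
    qed
    have "int (\<Sum>k<n. w (s, 0, k, \<pi> k)) < int (\<Sum>k<n. w (s, 0, k, \<pi>0 k))"
      unfolding eq[OF \<pi>(1)] eq[OF perm0] using rearrangement_strict[OF \<pi>(1) perm0 \<pi>(2)] by simp
    then show "(\<Sum>k<n. w (s, 0, k, \<pi> k)) < (\<Sum>k<n. w (s, 0, k, \<pi>0 k))"
      by (simp only: of_nat_less_iff)
  qed
  moreover have "image_mset (\<lambda>k. (s, 0, k, \<pi>0 k)) (mset_set {0..<n}) = lead_U s"
    unfolding lead_U_def by (intro image_mset_cong) (auto simp: \<pi>0_def)
  ultimately show ?thesis by (simp add: U_def)
qed

sublocale coprime_family w eqs lead_eq "lead_U True + lead_U False" form dU
proof
  have "eqs \<subseteq> UNIV \<times> {..<n} \<times> {..<n}" by (auto simp: eqs_def)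
  then show "finite eqs" by (rule finite_subset) auto
  show "lead w (lead_eq p) (form p)" if "p \<in> eqs" for p by (rule lead_form[OF that])
  show "lead w (lead_U True + lead_U False) dU"
    unfolding dU_def [abs_def] by (intro lead_mult lead_det_U)
  show "0 < wt w (lead_eq p)" if "p \<in> eqs" for p
  proof -
    obtain s i j where p: "p = (s, i, j)" by (cases p)
    show ?thesis
    proof (cases "i < j")
      case True
      define k where "k = j - i - 1"
      have k: "k < N1 s" "j < n" using True that n_le[of s] by (auto simp: k_def p eqs_def)
      have "0 \<le> 4 * (int k + 1) * int j" by simp
      then have "0 < int (w (s, 1, k, j))"
        using bound_ge[OF k] unfolding w_v[OF k] by linarith
      then have "0 < int (w (s, 1, j - i - 1, j))" by (simp only: k_def)
      then show ?thesis using True by (simp add: p lead_eq_def)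
    next
      case False
      have "0 < int (w (s, 2, 0, i))" using w_r[of s 0 i] bound_pos by simp
      then show ?thesis using False by (simp add: p lead_eq_def)
    qed
  qed
  have "0 < int (w (True, 0, 0, n - 1))"
    using w_u[of 0 True "n - 1"] bound_ge[of 0 True "n - 1"] n_pos n_le[of True] by simp
  moreover have "{#(True, 0, 0, n - 1)#} \<subseteq># lead_U True"
    using n_pos by (simp add: lead_U_def image_iff)
  then obtain R where "lead_U True = {#(True, 0, 0, n - 1)#} + R" by (metis mset_subset_eq_exists_conv)
  ultimately show "0 < wt w (lead_U True + lead_U False)" by (simp add: wt_add)
  \<comment> \<open>Each of \<open>u(j - i - 1, i)\<close> and \<open>v(j - i - 1, j)\<close>
    determines the pair \<open>(i, j)\<close>.\<close>
  show "set_mset (lead_eq p) \<inter> set_mset (lead_eq p') = {}" if "p \<in> eqs" "p' \<in> eqs" "p \<noteq> p'" for p p'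
    using that by (auto simp: lead_eq_def eqs_def split: if_splits)
  \<comment> \<open>For the \<open>u\<close> in an equation, row plus column is
    \<open>j - 1 < n - 1\<close>; on the antidiagonal it is \<open>n - 1\<close>.\<close>
  show "set_mset (lead_eq p) \<inter> set_mset (lead_U True + lead_U False) = {}" if "p \<in> eqs" for p
    using that by (auto simp: lead_eq_def lead_U_def eqs_def split: if_splits)
qed

lemma U_funs:
  assumes "function_algebra UNIV F" "\<And>x. (\<lambda>t. \<alpha> t x) \<in> F"
  shows "(\<lambda>t. U s (\<alpha> t)) \<in> function_algebra.mat_funs UNIV F n n"
  unfolding U_def by (rule function_algebra.mat_funs_mat[OF assms(1) assms(2)])

lemma corrected: "corrected_family w eqs lead_eq (lead_U True + lead_U False) form dU corr"
proof
  interpret A: function_algebra UNIV "assignment_polys :: ((var \<Rightarrow> complex) \<Rightarrow> complex) set"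
    by (rule function_algebra_polynomial_funs)
  have U: "(\<lambda>a. U s a) \<in> A.mat_funs n n" for s
    by (rule U_funs[OF A.function_algebra_axioms]) (auto intro: polynomial_funs.coord)
  have err: "err z s i j \<in> fiber_polys z" for z s i j
    by (cases "(s, i, j) \<in> eqs"; cases "(s, j, i) \<in> eqs")
      (simp_all add: err_def [abs_def] fiber_polys_gen fiber_polys_zero fiber_polys_mult[OF fiber_polys_gen A.const])
  show "corr z x \<in> fiber_polys z" for z x
  proof -
    obtain s c k j where x: "x = (s, c, k, j)" by (metis surj_pair)
    show ?thesis
    proof (cases "c = 1 \<and> k < n \<and> j < n")
      case True
      have "(\<lambda>a. \<Sum>i<n. adj_mat (U s a) $$ (i, k) * err z s i j a) \<in> fiber_polys z"
        using True by (intro fiber_polys_sum fiber_polys_mult[OF err] A.mat_funs_entry[OF A.adj_mat_funs[OF U]]) auto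
      then have "(\<lambda>a. det (U (\<not> s) a) * (1 / 2) * (\<Sum>i<n. adj_mat (U s a) $$ (i, k) * err z s i j a)) \<in> fiber_polys z"
        by (intro fiber_polys_mult A.mult A.const A.det_mat_funs[OF U])
      then show ?thesis using True by (simp add: x corr_def mult.commute)
    next
      case False
      then have "corr z x = (\<lambda>_. 0)" by (auto simp: x corr_def)
      then show ?thesis by (simp add: fiber_polys_zero)
    qed
  qed
  fix \<alpha> :: "complex \<Rightarrow> var \<Rightarrow> complex" and \<zeta> :: "complex \<Rightarrow> bool \<times> nat \<times> nat \<Rightarrow> complex" and Z x
  assume \<alpha>: "\<And>y. (\<lambda>t. \<alpha> t y) \<in> rational_funs Z" and \<zeta>: "\<And>p. (\<lambda>t. \<zeta> t p) \<in> rational_funs Z"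
  interpret R: function_algebra UNIV "rational_funs Z" by (rule function_algebra_rational_funs)
  have form: "(\<lambda>t. form p (\<alpha> t)) \<in> rational_funs Z" for p
    by (cases p) (auto simp: form_def intro!: R.add R.sum R.mult R.const \<alpha>)
  have err': "(\<lambda>t. err (\<zeta> t) s i j (\<alpha> t)) \<in> rational_funs Z" for s i j
    by (cases "(s, i, j) \<in> eqs"; cases "(s, j, i) \<in> eqs")
      (simp_all add: err_def R.mult R.diff R.const form \<zeta>)
  have U': "(\<lambda>t. U s (\<alpha> t)) \<in> R.mat_funs n n" for s by (rule U_funs[OF R.function_algebra_axioms \<alpha>])
  show "(\<lambda>t. corr (\<zeta> t) x (\<alpha> t)) \<in> rational_funs Z"
  proof -
    obtain s c k j where x: "x = (s, c, k, j)" by (metis surj_pair)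
    show ?thesis
    proof (cases "c = 1 \<and> k < n \<and> j < n")
      case True
      then have "(\<lambda>t. (\<Sum>i<n. adj_mat (U s (\<alpha> t)) $$ (i, k) * err (\<zeta> t) s i j (\<alpha> t)) * det (U (\<not> s) (\<alpha> t)) * (1 / 2))
          \<in> rational_funs Z"
        by (intro R.mult R.sum R.const err' R.det_mat_funs[OF U'] R.mat_funs_entry[OF R.adj_mat_funs[OF U']]) auto
      then show ?thesis using True by (simp add: x corr_def)
    next
      case False
      then have "corr (\<zeta> t) x (\<alpha> t) = 0" for t by (auto simp: x corr_def)
      then show ?thesis by (simp add: R.const)
    qed
  qed
next
  fix a :: "var \<Rightarrow> complex" and z
  assume nz: "dU a \<noteq> 0"
  define a' where "a' = (\<lambda>x. a x - corr z x a / dU a)"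
  have a'_u: "a' (s, 0, k, i) = a (s, 0, k, i)" "a' (s, 2, k, i) = a (s, 2, k, i)" for s k i
    by (simp_all add: a'_def corr_def)
  \<comment> \<open>The displacement of \<open>v\<close>. Rows from \<open>n\<close> on do not move,
    so that only the square block \<open>U\<close> enters the linear system.\<close>
  define C where "C s k j = (if k < n then (\<Sum>i<n. adj_mat (U s a) $$ (i, k) * err z s i j a) / (2 * det (U s a)) else 0)"
    for s k j
  have a'_v: "a' (s, 1, k, j) = a (s, 1, k, j) - C s k j" if "j < n" for s k j
    using that nz dU_eq[of a s] by (simp add: a'_def corr_def C_def)
  have "U s a' = U s a" for s by (simp add: U_def a'_u)
  then have "dU a' = dU a" by (simp add: dU_def)
  then show "dU (\<lambda>x. a x - corr z x a / dU a) = dU a" by (simp only: a'_def)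
  fix p assume p: "p \<in> eqs"
  obtain s i j where ps: "p = (s, i, j)" by (cases p)
  have ij: "i < n" "j < n" using p by (auto simp: eqs_def ps)
  have uC: "(\<Sum>k<N1 s. a (s, 0, k, i) * C s k j) = err z s i j a / 2" if "i < n" for i j
  proof -
    have "(\<Sum>k<N1 s. a (s, 0, k, i) * C s k j) = (\<Sum>k<n. a (s, 0, k, i) * C s k j)"
      using n_le[of s] by (intro sum.mono_neutral_right) (auto simp: C_def)
    also have "\<dots> = (\<Sum>k<n. U s a $$ (k, i) * (\<Sum>i'<n. adj_mat (U s a) $$ (i', k) * err z s i' j a)) / (2 * det (U s a))"
      unfolding sum_divide_distrib using that by (intro sum.cong) (auto simp: C_def U_def)
    also have "\<dots> = err z s i j a / 2"
      using sum_adj_mat_solve[OF U_carrier that, of s a "\<lambda>i'. err z s i' j a"] nz dU_eq[of a s] by simp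
    finally show ?thesis .
  qed
  have "form p a' = (\<Sum>k<N1 s. (a (s, 0, k, i) * a (s, 1, k, j) + \<epsilon> * (a (s, 1, k, i) * a (s, 0, k, j))) -
      a (s, 0, k, i) * C s k j - \<epsilon> * (a (s, 0, k, j) * C s k i)) + (\<Sum>l<N2 s. a (s, 2, l, i) * a (s, 2, l, j))"
    unfolding form_def ps using ij by (simp add: a'_u a'_v algebra_simps del: One_nat_def)
  also have "\<dots> = form p a - err z s i j a / 2 - \<epsilon> * (err z s j i a / 2)"
    unfolding form_def ps by (simp add: sum_subtractf uC ij flip: sum_distrib_left)
  \<comment> \<open>\<open>err\<close> is \<open>\<epsilon>\<close>-symmetric and
    \<open>\<epsilon>\<close> squares to one, so the two halves add up to the whole defect.\<close>
  also have "\<dots> = z p"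
    using p \<epsilon> by (auto simp: err_def ps eqs_def field_simps)
  finally show "form p (\<lambda>x. a x - corr z x a / dU a) = z p" by (simp add: a'_def)
qed

end

subsection \<open>Pairings\<close>

text \<open>
  The equation \<open>(i, j)\<close> leads with \<open>a(i + j, i) b(i + j, j)\<close>, and the minor of the rows
  \<open>N, \<dots>, N + M - 1\<close> of \<open>a\<close> with its diagonal.
\<close>

locale pairing_family =
  fixes M N R :: "bool \<Rightarrow> nat"
  assumes M_pos: "0 < M s" and rows: "M s + N s \<le> R s"
begin

definition eqs :: "(bool \<times> nat \<times> nat) set" where
  "eqs = {(s, i, j). i < M s \<and> j < N s}"

definition form :: "bool \<times> nat \<times> nat \<Rightarrow> (var \<Rightarrow> complex) \<Rightarrow> complex" where
  "form = (\<lambda>(s, i, j) a. \<Sum>k<R s. a (s, 0, k, i) * a (s, 1, k, j))"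

definition U :: "bool \<Rightarrow> (var \<Rightarrow> complex) \<Rightarrow> complex mat" where
  "U s a = mat (M s) (M s) (\<lambda>(k, i). a (s, 0, N s + k, i))"

definition dU :: "(var \<Rightarrow> complex) \<Rightarrow> complex" where
  "dU a = det (U True a) * det (U False a)"

definition bound :: int where
  "bound = (int (R True) + int (R False))\<^sup>2 + 1"

text \<open>The product \<open>a(k, i) b(k, j)\<close> weighs
  \<open>2 * bound + 2 * (i + j)^2 - 2 * (k - (i + j))^2\<close>, with unique maximum at
  \<open>k = i + j\<close>. The same term \<open>4 * k * i\<close> favours the diagonal of a
  minor.\<close>

definition w :: "var \<Rightarrow> nat" where
  "w = (\<lambda>(s, c, k, i). nat (bound - (int k)\<^sup>2 + 4 * int k * int i))"

definition lead_eq :: "bool \<times> nat \<times> nat \<Rightarrow> var multiset" where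
  "lead_eq = (\<lambda>(s, i, j). {#(s, 0, i + j, i), (s, 1, i + j, j)#})"

definition lead_U :: "bool \<Rightarrow> var multiset" where
  "lead_U s = image_mset (\<lambda>k. (s, 0, N s + k, k)) (mset_set {0..<M s})"

text \<open>Only \<open>b\<close> moves, and only in the rows of the minor. An equation contains
  \<open>b\<close> in a single sum, so no factor 1/2 appears here.\<close>

definition corr :: "(bool \<times> nat \<times> nat \<Rightarrow> complex) \<Rightarrow> var \<Rightarrow> (var \<Rightarrow> complex) \<Rightarrow> complex" where
  "corr z = (\<lambda>(s, c, k, j) a. if c = 1 \<and> N s \<le> k \<and> k < N s + M s \<and> j < N s
    then (\<Sum>i<M s. adj_mat (U s a) $$ (i, k - N s) * (form (s, i, j) a - z (s, i, j))) * det (U (\<not> s) a)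
    else 0)"

lemma dU_eq: "dU a = det (U s a) * det (U (\<not> s) a)"
  by (cases s) (simp_all add: dU_def mult.commute)

lemma U_carrier [simp]: "U s a \<in> carrier_mat (M s) (M s)"
  by (simp add: U_def)

lemma w_eq:
  assumes "k < R s"
  shows "int (w (s, c, k, i)) = bound - (int k)\<^sup>2 + 4 * int k * int i" and "0 < w (s, c, k, i)"
proof -
  have "int k \<le> int (R True) + int (R False)" using assms by (cases s) auto
  then have "(int k)\<^sup>2 \<le> (int (R True) + int (R False))\<^sup>2" by (intro power_mono) auto
  moreover have "0 \<le> 4 * int k * int i" by simp
  ultimately have pos: "0 < bound - (int k)\<^sup>2 + 4 * int k * int i" unfolding bound_def by linarith
  then show "int (w (s, c, k, i)) = bound - (int k)\<^sup>2 + 4 * int k * int i" by (simp add: w_def)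
  with pos show "0 < w (s, c, k, i)" by linarith
qed

lemma lead_form:
  assumes "p \<in> eqs"
  shows "lead w (lead_eq p) (form p)"
proof -
  obtain s i j where p: "p = (s, i, j)" by (cases p)
  let ?ab = "\<lambda>k. {#(s, 0, k, i), (s, 1, k, j)#}"
  have ij: "i + j < R s" using assms rows[of s] by (auto simp: eqs_def p)
  have ab: "int (wt w (?ab k)) = 2 * bound - 2 * (int k)\<^sup>2 + 4 * int k * (int i + int j)"
    if "k < R s" for k
    using w_eq(1)[OF that, of 0 i] w_eq(1)[OF that, of 1 j] by (simp add: algebra_simps)
  have "lead w (?ab (i + j)) (\<lambda>a. \<Sum>k<R s. 1 * monf (?ab k) a)"
  proof (rule lead_sum)
    fix k assume k: "k \<in> {..<R s}" "k \<noteq> i + j"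
    have "0 < (int k - (int i + int j))\<^sup>2" using k by auto
    then have "- 2 * (int k)\<^sup>2 + 4 * int k * (int i + int j) < 2 * (int i + int j)\<^sup>2"
      by (simp add: power2_eq_square algebra_simps)
    moreover have "int (wt w (?ab (i + j))) = 2 * bound + 2 * (int i + int j)\<^sup>2"
      using ab[OF ij] by (simp add: power2_eq_square)
    ultimately have "int (wt w (?ab k)) < int (wt w (?ab (i + j)))"
      using ab[of k] k(1) by simp
    then show "1 = (0 :: complex) \<or> wt w (?ab k) < wt w (?ab (i + j))" by simp
  qed (use ij in auto)
  moreover have "form p = (\<lambda>a. \<Sum>k<R s. 1 * monf (?ab k) a)"
    by (auto simp: form_def p)
  ultimately show ?thesis by (simp add: lead_eq_def p)
qed

lemma lead_det_U: "lead w (lead_U s) (\<lambda>a. det (U s a))"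
proof -
  have id: "id permutes {0..<M s}" by (rule permutes_id)
  have "lead w (image_mset (\<lambda>k. (s, 0, N s + k, id k)) (mset_set {0..<M s}))
      (\<lambda>a. det (mat (M s) (M s) (\<lambda>(k, i). a (s, 0, N s + k, i))))"
  proof (rule lead_det[OF id, of w "\<lambda>k i. (s, 0, N s + k, i)"])
    fix \<pi> assume \<pi>: "\<pi> permutes {0..<M s}" "\<pi> \<noteq> id"
    define c where "c = (\<Sum>k<M s. bound - (int (N s + k))\<^sup>2) + 4 * int (N s) * (\<Sum>k<M s. int k)"
    have eq: "int (\<Sum>k<M s. w (s, 0, N s + k, \<sigma> k)) = c + 4 * (\<Sum>k<M s. int (id k) * int (\<sigma> k))"
      if \<sigma>: "\<sigma> permutes {0..<M s}" for \<sigma>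
    proof -
      have "int (\<Sum>k<M s. w (s, 0, N s + k, \<sigma> k)) =
          (\<Sum>k<M s. bound - (int (N s + k))\<^sup>2 + 4 * int (N s) * int (\<sigma> k) + 4 * (int (id k) * int (\<sigma> k)))"
        unfolding of_nat_sum
      proof (rule sum.cong[OF refl])
        fix k assume "k \<in> {..<M s}"
        then have k: "N s + k < R s" using rows[of s] by simp
        show "int (w (s, 0, N s + k, \<sigma> k)) =
            bound - (int (N s + k))\<^sup>2 + 4 * int (N s) * int (\<sigma> k) + 4 * (int (id k) * int (\<sigma> k))"
          unfolding w_eq(1)[OF k] by (simp add: algebra_simps)
      qed
      also have "\<dots> = (\<Sum>k<M s. bound - (int (N s + k))\<^sup>2) + 4 * int (N s) * (\<Sum>k<M s. int (\<sigma> k)) +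
          4 * (\<Sum>k<M s. int (id k) * int (\<sigma> k))"
        unfolding sum.distrib sum_distrib_left ..
      also have "(\<Sum>k<M s. int (\<sigma> k)) = (\<Sum>k<M s. int k)"
        using sum.permute[OF \<sigma>, of int] by (simp add: atLeast0LessThan)
      finally show ?thesis by (simp add: c_def)
    qed
    have "int (\<Sum>k<M s. w (s, 0, N s + k, \<pi> k)) < int (\<Sum>k<M s. w (s, 0, N s + k, id k))"
      unfolding eq[OF \<pi>(1)] eq[OF id] using rearrangement_strict[OF \<pi>(1) id \<pi>(2)] by simp
    then show "(\<Sum>k<M s. w (s, 0, N s + k, \<pi> k)) < (\<Sum>k<M s. w (s, 0, N s + k, id k))"
      by (simp only: of_nat_less_iff)
  qed
  then show ?thesis by (simp add: U_def lead_U_def)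
qed

sublocale coprime_family w eqs lead_eq "lead_U True + lead_U False" form dU
proof
  have "eqs \<subseteq> UNIV \<times> {..<M True + M False} \<times> {..<N True + N False}"
  proof
    fix x assume "x \<in> eqs"
    then show "x \<in> UNIV \<times> {..<M True + M False} \<times> {..<N True + N False}"
      by (cases x; cases "fst x") (auto simp: eqs_def)
  qed
  then show "finite eqs" by (rule finite_subset) auto
  show "lead w (lead_eq p) (form p)" if "p \<in> eqs" for p by (rule lead_form[OF that])
  show "lead w (lead_U True + lead_U False) dU"
    unfolding dU_def [abs_def] by (intro lead_mult lead_det_U)
  show "0 < wt w (lead_eq p)" if "p \<in> eqs" for p
  proof -
    obtain s i j where p: "p = (s, i, j)" by (cases p)
    have "i + j < R s" using that rows[of s] by (auto simp: eqs_def p)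
    then have "0 < w (s, 0, i + j, i)" by (rule w_eq(2))
    then show ?thesis by (simp add: p lead_eq_def)
  qed
  have "0 < w (True, 0, N True, 0)" using rows[of True] M_pos[of True] by (intro w_eq(2)) simp
  moreover have "{#(True, 0, N True, 0)#} \<subseteq># lead_U True"
    using M_pos[of True] by (simp add: lead_U_def image_iff)
  then obtain Q where "lead_U True = {#(True, 0, N True, 0)#} + Q" by (metis mset_subset_eq_exists_conv)
  ultimately show "0 < wt w (lead_U True + lead_U False)" by (simp add: wt_add)
  show "set_mset (lead_eq p) \<inter> set_mset (lead_eq p') = {}" if "p \<in> eqs" "p' \<in> eqs" "p \<noteq> p'" for p p'
    using that by (auto simp: lead_eq_def eqs_def)
  \<comment> \<open>Row minus column is \<open>j < N s\<close> for the \<open>a\<close> in an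
    equation and \<open>N s\<close> on the diagonal of the minor.\<close>
  show "set_mset (lead_eq p) \<inter> set_mset (lead_U True + lead_U False) = {}" if "p \<in> eqs" for p
    using that by (auto simp: lead_eq_def lead_U_def eqs_def)
qed

lemma U_funs:
  assumes "function_algebra UNIV F" "\<And>x. (\<lambda>t. \<alpha> t x) \<in> F"
  shows "(\<lambda>t. U s (\<alpha> t)) \<in> function_algebra.mat_funs UNIV F (M s) (M s)"
  unfolding U_def by (rule function_algebra.mat_funs_mat[OF assms(1) assms(2)])

lemma corrected: "corrected_family w eqs lead_eq (lead_U True + lead_U False) form dU corr"
proof
  interpret A: function_algebra UNIV "assignment_polys :: ((var \<Rightarrow> complex) \<Rightarrow> complex) set"
    by (rule function_algebra_polynomial_funs)
  have U: "(\<lambda>a. U s a) \<in> A.mat_funs (M s) (M s)" for s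
    by (rule U_funs[OF A.function_algebra_axioms]) (auto intro: polynomial_funs.coord)
  show "corr z x \<in> fiber_polys z" for z x
  proof -
    obtain s c k j where x: "x = (s, c, k, j)" by (metis surj_pair)
    show ?thesis
    proof (cases "c = 1 \<and> N s \<le> k \<and> k < N s + M s \<and> j < N s")
      case True
      have "(\<lambda>a. form (s, i, j) a - z (s, i, j)) \<in> fiber_polys z" if "i < M s" for i
        using that True by (intro fiber_polys_gen) (simp add: eqs_def)
      then have "(\<lambda>a. \<Sum>i<M s. adj_mat (U s a) $$ (i, k - N s) * (form (s, i, j) a - z (s, i, j))) \<in> fiber_polys z"
        using True by (intro fiber_polys_sum fiber_polys_mult A.mat_funs_entry[OF A.adj_mat_funs[OF U]]) auto
      then have "(\<lambda>a. det (U (\<not> s) a) *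
          (\<Sum>i<M s. adj_mat (U s a) $$ (i, k - N s) * (form (s, i, j) a - z (s, i, j)))) \<in> fiber_polys z"
        by (intro fiber_polys_mult A.det_mat_funs[OF U])
      then show ?thesis using True by (simp add: x corr_def mult.commute)
    next
      case False
      then have "corr z x = (\<lambda>_. 0)" by (auto simp: x corr_def)
      then show ?thesis by (simp add: fiber_polys_zero)
    qed
  qed
  fix \<alpha> :: "complex \<Rightarrow> var \<Rightarrow> complex" and \<zeta> :: "complex \<Rightarrow> bool \<times> nat \<times> nat \<Rightarrow> complex" and Z x
  assume \<alpha>: "\<And>y. (\<lambda>t. \<alpha> t y) \<in> rational_funs Z" and \<zeta>: "\<And>p. (\<lambda>t. \<zeta> t p) \<in> rational_funs Z"
  interpret R: function_algebra UNIV "rational_funs Z" by (rule function_algebra_rational_funs)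
  have form: "(\<lambda>t. form p (\<alpha> t)) \<in> rational_funs Z" for p
    by (cases p) (auto simp: form_def intro!: R.sum R.mult \<alpha>)
  have U': "(\<lambda>t. U s (\<alpha> t)) \<in> R.mat_funs (M s) (M s)" for s by (rule U_funs[OF R.function_algebra_axioms \<alpha>])
  show "(\<lambda>t. corr (\<zeta> t) x (\<alpha> t)) \<in> rational_funs Z"
  proof -
    obtain s c k j where x: "x = (s, c, k, j)" by (metis surj_pair)
    show ?thesis
    proof (cases "c = 1 \<and> N s \<le> k \<and> k < N s + M s \<and> j < N s")
      case True
      then have "(\<lambda>t. (\<Sum>i<M s. adj_mat (U s (\<alpha> t)) $$ (i, k - N s) * (form (s, i, j) (\<alpha> t) - \<zeta> t (s, i, j))) *
          det (U (\<not> s) (\<alpha> t))) \<in> rational_funs Z"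
        by (intro R.mult R.sum R.diff form \<zeta> R.det_mat_funs[OF U'] R.mat_funs_entry[OF R.adj_mat_funs[OF U']]) auto
      then show ?thesis using True by (simp add: x corr_def)
    next
      case False
      then have "corr (\<zeta> t) x (\<alpha> t) = 0" for t by (auto simp: x corr_def)
      then show ?thesis by (simp add: R.const)
    qed
  qed
next
  fix a :: "var \<Rightarrow> complex" and z
  assume nz: "dU a \<noteq> 0"
  define a' where "a' = (\<lambda>x. a x - corr z x a / dU a)"
  have a'_a: "a' (s, 0, k, i) = a (s, 0, k, i)" for s k i
    by (simp add: a'_def corr_def)
  have "U s a' = U s a" for s by (simp add: U_def a'_a)
  then have "dU a' = dU a" by (simp add: dU_def)
  then show "dU (\<lambda>x. a x - corr z x a / dU a) = dU a" by (simp only: a'_def)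
  fix p assume p: "p \<in> eqs"
  obtain s i j where ps: "p = (s, i, j)" by (cases p)
  have ij: "i < M s" "j < N s" using p by (auto simp: eqs_def ps)
  define e where "e i = form (s, i, j) a - z (s, i, j)" for i
  define C where "C k = (if N s \<le> k \<and> k < N s + M s
    then (\<Sum>i<M s. adj_mat (U s a) $$ (i, k - N s) * e i) / det (U s a) else 0)" for k
  have a'_b: "a' (s, 1, k, j) = a (s, 1, k, j) - C k" for k
    using ij nz dU_eq[of a s] by (simp add: a'_def corr_def C_def e_def)
  have "(\<Sum>k<R s. a (s, 0, k, i) * C k) = (\<Sum>k\<in>{N s..<N s + M s}. a (s, 0, k, i) * C k)"
    using rows[of s] by (intro sum.mono_neutral_right) (auto simp: C_def)
  also have "\<dots> = (\<Sum>k<M s. a (s, 0, N s + k, i) * C (N s + k))"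
    using sum.shift_bounds_nat_ivl[of "\<lambda>k. a (s, 0, k, i) * C k" 0 "N s" "M s"]
    by (simp add: atLeast0LessThan add.commute)
  also have "\<dots> = (\<Sum>k<M s. U s a $$ (k, i) * (\<Sum>i'<M s. adj_mat (U s a) $$ (i', k) * e i')) / det (U s a)"
    unfolding sum_divide_distrib using ij by (intro sum.cong) (auto simp: C_def U_def)
  also have "\<dots> = e i"
    using sum_adj_mat_solve[OF U_carrier ij(1), of a e] nz dU_eq[of a s] by simp
  finally have aC: "(\<Sum>k<R s. a (s, 0, k, i) * C k) = e i" .
  have "form p a' = form p a - (\<Sum>k<R s. a (s, 0, k, i) * C k)"
    unfolding form_def ps by (simp add: a'_a a'_b right_diff_distrib sum_subtractf del: One_nat_def)
  also have "\<dots> = z p" unfolding aC by (simp add: e_def ps)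
  finally show "form p (\<lambda>x. a x - corr z x a / dU a) = z p" by (simp only: a'_def)
qed

end

section \<open>Matrix groups\<close>

text \<open>The ring laws are restated with dimensions instead of carriers, so that the simplifier
  can discharge their side conditions from \<open>carrier_matD\<close>.\<close>

lemma mat_assoc:
  "dim_col A = dim_row B \<Longrightarrow> dim_col B = dim_row C \<Longrightarrow> A * B * C = A * (B * (C :: complex mat))"
  by (rule assoc_mult_mat[of A "dim_row A" "dim_row B" B "dim_row C" C "dim_col C"]) auto

lemma mat_mult_minus:
  "dim_col A = dim_row B \<Longrightarrow> dim_row B = dim_row C \<Longrightarrow> dim_col B = dim_col C \<Longrightarrow>
    A * (B - C) = A * B - A * (C :: complex mat)"
  by (rule mult_minus_distrib_mat[of A "dim_row A" "dim_row C" B "dim_col C"]) auto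

lemma mat_minus_mult:
  "dim_col A = dim_row C \<Longrightarrow> dim_row A = dim_row B \<Longrightarrow> dim_col A = dim_col B \<Longrightarrow>
    (A - B) * C = A * C - B * (C :: complex mat)"
  by (rule minus_mult_distrib_mat[of A "dim_row B" "dim_row C" B C "dim_col C"]) auto

lemma mat_mult_add:
  "dim_col A = dim_row B \<Longrightarrow> dim_row B = dim_row C \<Longrightarrow> dim_col B = dim_col C \<Longrightarrow>
    A * (B + C) = A * B + A * (C :: complex mat)"
  by (rule mult_add_distrib_mat[of A "dim_row A" "dim_row C" B "dim_col C"]) auto

lemma mat_add_mult:
  "dim_col A = dim_row C \<Longrightarrow> dim_row A = dim_row B \<Longrightarrow> dim_col A = dim_col B \<Longrightarrow>
    (A + B) * C = A * C + B * (C :: complex mat)"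
  by (rule add_mult_distrib_mat[of A "dim_row B" "dim_row C" B C "dim_col C"]) auto

lemma mat_mult_smult: "dim_col A = dim_row B \<Longrightarrow> A * (c \<cdot>\<^sub>m B) = c \<cdot>\<^sub>m (A * (B :: complex mat))"
  by (rule mult_smult_distrib[of A "dim_row A" "dim_row B" B "dim_col B"]) auto

lemma mat_smult_mult: "dim_col A = dim_row B \<Longrightarrow> (c \<cdot>\<^sub>m A) * B = c \<cdot>\<^sub>m (A * (B :: complex mat))"
  by (rule mult_smult_assoc_mat[of A "dim_row A" "dim_row B" B "dim_col B"]) auto

lemma mat_one_left: "dim_row A = n \<Longrightarrow> 1\<^sub>m n * A = (A :: complex mat)"
  by (rule left_mult_one_mat[of A n "dim_col A"]) auto

lemma mat_one_right: "dim_col A = n \<Longrightarrow> A * 1\<^sub>m n = (A :: complex mat)"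
  by (rule right_mult_one_mat[of A "dim_row A"]) auto

lemma mat_transpose_mult: "dim_col A = dim_row B \<Longrightarrow> (A * B)\<^sup>T = B\<^sup>T * (A :: complex mat)\<^sup>T"
  by (rule transpose_mult[of A "dim_row A" "dim_row B" B "dim_col B"]) auto

lemma mat_transpose_minus:
  "dim_row A = dim_row B \<Longrightarrow> dim_col A = dim_col B \<Longrightarrow> (A - B)\<^sup>T = A\<^sup>T - (B :: complex mat)\<^sup>T"
  by (rule transpose_minus[of A "dim_row B" "dim_col B"]) auto

lemma mat_transpose_add:
  "dim_row A = dim_row B \<Longrightarrow> dim_col A = dim_col B \<Longrightarrow> (A + B)\<^sup>T = A\<^sup>T + (B :: complex mat)\<^sup>T"
  by (rule transpose_add[of A "dim_row B" "dim_col B"]) auto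

lemma mat_transpose_smult: "(c \<cdot>\<^sub>m A)\<^sup>T = c \<cdot>\<^sub>m (A :: complex mat)\<^sup>T"
  by (rule eq_matI) auto

lemma mat_smult_smult: "c \<cdot>\<^sub>m (d \<cdot>\<^sub>m A) = (c * d) \<cdot>\<^sub>m (A :: complex mat)"
  by (rule eq_matI) auto

lemma mat_smult_one: "1 \<cdot>\<^sub>m A = (A :: complex mat)"
  by (rule eq_matI) auto

lemmas mat_ring = mat_assoc mat_mult_minus mat_minus_mult mat_mult_add mat_add_mult mat_mult_smult
  mat_smult_mult mat_one_left mat_one_right mat_transpose_mult mat_transpose_minus mat_transpose_add
  mat_transpose_smult mat_smult_smult mat_smult_one

section \<open>General linear groups\<close>

lemma monoid_ring_mat: "monoid (ring_mat TYPE(complex) n ())"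
  using ring_mat[where ?'a = complex, of n "()"] by (simp add: ring_def)

lemma Units_ring_mat:
  "g \<in> Units (ring_mat TYPE(complex) n ()) \<longleftrightarrow>
    g \<in> carrier_mat n n \<and> (\<exists>h\<in>carrier_mat n n. h * g = 1\<^sub>m n \<and> g * h = 1\<^sub>m n)"
  by (simp add: Units_def ring_mat_simps ring_mat_def)

lemma carrier_GL: "carrier (GL n) = Units (ring_mat TYPE(complex) n ())"
  by (simp add: GL_def units_of_carrier)

lemma GL_carrier_mat: "g \<in> carrier (GL n) \<Longrightarrow> g \<in> carrier_mat n n"
  by (simp add: carrier_GL Units_ring_mat)

lemma gl_inv_eq:
  assumes "g \<in> carrier_mat n n" "h \<in> carrier_mat n n" "h * g = 1\<^sub>m n"
  shows "g \<in> carrier (GL n)" "gl_inv g = h"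
proof -
  have gh: "g * h = 1\<^sub>m n" by (rule mat_mult_left_right_inverse[OF assms(2,1,3)])
  then have U: "g \<in> Units (ring_mat TYPE(complex) n ())" "h \<in> Units (ring_mat TYPE(complex) n ())"
    unfolding Units_ring_mat using assms by blast+
  then show "g \<in> carrier (GL n)" by (simp add: carrier_GL)
  interpret group "GL n" unfolding GL_def by (rule monoid.units_group[OF monoid_ring_mat])
  have "inv\<^bsub>GL n\<^esub> g = h"
    by (rule inv_equality)
      (use U assms(3) in \<open>simp_all add: GL_def units_of_carrier units_of_mult units_of_one ring_mat_simps\<close>)
  then show "gl_inv g = h" using assms(1) by (simp add: gl_inv_def)
qed

lemma gl_inv:
  assumes "g \<in> carrier (GL n)"
  shows "gl_inv g \<in> carrier_mat n n" "gl_inv g * g = 1\<^sub>m n" "g * gl_inv g = 1\<^sub>m n"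
proof -
  obtain h where h: "g \<in> carrier_mat n n" "h \<in> carrier_mat n n" "h * g = 1\<^sub>m n" "g * h = 1\<^sub>m n"
    using assms by (auto simp: carrier_GL Units_ring_mat)
  then show "gl_inv g \<in> carrier_mat n n" "gl_inv g * g = 1\<^sub>m n" "g * gl_inv g = 1\<^sub>m n"
    using gl_inv_eq(2)[OF h(1-3)] by auto
qed

lemma GL_det: "g \<in> carrier (GL n) \<Longrightarrow> det g \<noteq> 0"
  using det_mult[of "gl_inv g" n g] gl_inv[of g n] GL_carrier_mat[of g n] by auto

lemma gl_inv_adj:
  assumes "g \<in> carrier_mat n n" "det g \<noteq> 0"
  shows "g \<in> carrier (GL n)" "gl_inv g = (1 / det g) \<cdot>\<^sub>m adj_mat g"
proof -
  have "((1 / det g) \<cdot>\<^sub>m adj_mat g) * g = 1\<^sub>m n"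
    using adj_mat[OF assms(1)] assms by (simp add: mat_ring)
  then show "g \<in> carrier (GL n)" "gl_inv g = (1 / det g) \<cdot>\<^sub>m adj_mat g"
    using gl_inv_eq[OF assms(1), of "(1 / det g) \<cdot>\<^sub>m adj_mat g"] adj_mat(1)[OF assms(1)] by auto
qed

text \<open>The segment between two invertible matrices consists, up to finitely many points, of invertible ones.\<close>

definition gl_path :: "complex mat \<Rightarrow> complex mat \<Rightarrow> complex \<Rightarrow> complex mat" where
  "gl_path g h t = (1 - t) \<cdot>\<^sub>m g + t \<cdot>\<^sub>m h"

text \<open>Equal to \<open>gl_inv\<close> on invertible matrices by \<open>gl_inv_adj\<close>, but
  visibly rational in the entries.\<close>

definition adj_inv :: "complex mat \<Rightarrow> complex mat" where
  "adj_inv g = (1 / det g) \<cdot>\<^sub>m adj_mat g"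

lemma gl_path:
  assumes g: "g \<in> carrier (GL n)" and h: "h \<in> carrier (GL n)"
  shows "gl_path g h 0 = g" "gl_path g h 1 = h" "gl_path g h t \<in> carrier_mat n n"
    and "gl_path g h \<in> function_algebra.mat_funs UNIV (rational_funs {0, 1}) n n"
    and "(\<lambda>t. det (gl_path g h t)) \<in> rational_funs {0, 1}"
    and "(\<lambda>t. adj_inv (gl_path g h t)) \<in> function_algebra.mat_funs UNIV (rational_funs {0, 1}) n n"
proof -
  note c = GL_carrier_mat[OF g] GL_carrier_mat[OF h]
  show e: "gl_path g h 0 = g" "gl_path g h 1 = h" using c by (auto simp: gl_path_def intro!: eq_matI)
  show "gl_path g h t \<in> carrier_mat n n" using c by (simp add: gl_path_def)
  interpret R: function_algebra UNIV "rational_funs {0, 1}" by (rule function_algebra_rational_funs)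
  show 1: "gl_path g h \<in> R.mat_funs n n"
    unfolding gl_path_def [abs_def]
    by (intro R.mat_funs_add R.mat_funs_smult R.mat_funs_const R.diff R.const rational_funs_ident c)
  show 2: "(\<lambda>t. det (gl_path g h t)) \<in> rational_funs {0, 1}" by (rule R.det_mat_funs[OF 1])
  show "(\<lambda>t. adj_inv (gl_path g h t)) \<in> R.mat_funs n n"
    unfolding adj_inv_def
    by (intro R.mat_funs_smult R.adj_mat_funs 1 rational_funs_inverse 2) (use e GL_det[OF g] GL_det[OF h] in auto)
qed

subsection \<open>Isometries\<close>

definition isometries :: "nat \<Rightarrow> complex mat \<Rightarrow> complex mat set" where
  "isometries N S = {k \<in> carrier_mat N N. k\<^sup>T * S * k = S}"

lemma isometries_mult:
  assumes "k \<in> isometries N S" "l \<in> isometries N S" "S \<in> carrier_mat N N"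
  shows "k * l \<in> isometries N S"
proof -
  have c: "k \<in> carrier_mat N N" "l \<in> carrier_mat N N" and e: "k\<^sup>T * S * k = S" "l\<^sup>T * S * l = S"
    using assms by (auto simp: isometries_def)
  have "(k * l)\<^sup>T * S * (k * l) = l\<^sup>T * (k\<^sup>T * S * k) * l"
    using c assms(3) by (simp add: mat_ring)
  also have "\<dots> = S" unfolding e ..
  finally show ?thesis using c by (simp add: isometries_def)
qed

lemma isometries_form:
  assumes "k \<in> isometries N S" "S \<in> carrier_mat N N" "A \<in> carrier_mat N n" "B \<in> carrier_mat N m"
  shows "(k * A)\<^sup>T * S * (k * B) = A\<^sup>T * S * B"
proof -
  have c: "k \<in> carrier_mat N N" and e: "k\<^sup>T * S * k = S"
    using assms by (auto simp: isometries_def)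
  have "(k * A)\<^sup>T * S * (k * B) = A\<^sup>T * (k\<^sup>T * S * k) * B"
    using c assms by (simp add: mat_ring)
  also have "\<dots> = A\<^sup>T * S * B" unfolding e ..
  finally show ?thesis .
qed

lemma isometries_GL:
  assumes "k \<in> isometries N S" "S \<in> carrier_mat N N" "S' \<in> carrier_mat N N" "S' * S = 1\<^sub>m N"
  shows "k \<in> carrier (GL N)"
proof (rule gl_inv_eq(1))
  have c: "k \<in> carrier_mat N N" and e: "k\<^sup>T * S * k = S" using assms(1) by (auto simp: isometries_def)
  then show "k \<in> carrier_mat N N" "S' * k\<^sup>T * S \<in> carrier_mat N N" using assms by auto
  have "S' * k\<^sup>T * S * k = S' * (k\<^sup>T * S * k)" using c assms by (simp add: mat_ring)
  then show "S' * k\<^sup>T * S * k = 1\<^sub>m N" unfolding e using assms(4) by simp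
qed

text \<open>
  A generalized reflection: \<open>k = 1 - E (E\<^sup>T S A)\<^sup>-\<^sup>1 E\<^sup>T S\<close> with \<open>E = A - B\<close> maps \<open>A\<close> to \<open>B\<close>, and it is an
  isometry because \<open>E\<^sup>T S E = E\<^sup>T S A + A\<^sup>T S E\<close>.
\<close>

lemma ex_reflection:
  assumes A: "A \<in> carrier_mat N n" and B: "B \<in> carrier_mat N n" and S: "S \<in> carrier_mat N N"
    and sym: "S\<^sup>T = \<epsilon> \<cdot>\<^sub>m S" and \<epsilon>: "\<epsilon> * \<epsilon> = 1"
    and eq: "A\<^sup>T * S * A = B\<^sup>T * S * B"
    and nz: "det ((A - B)\<^sup>T * S * A) \<noteq> 0"
  shows "\<exists>k\<in>isometries N S. k * A = B"
proof -
  define E where "E = A - B"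
  define Q where "Q = E\<^sup>T * S"
  define D where "D = Q * A"
  define C where "C = adj_inv D"
  have E: "E \<in> carrier_mat N n" using B by (simp add: E_def minus_carrier_mat)
  then have Q: "Q \<in> carrier_mat n N" using S by (simp add: Q_def)
  have D: "D \<in> carrier_mat n n" using Q A by (simp add: D_def)
  have "det D \<noteq> 0" using nz by (simp add: D_def Q_def E_def)
  from gl_inv[OF gl_inv_adj(1)[OF D this]] gl_inv_adj(2)[OF D this]
  have C: "C \<in> carrier_mat n n" "C * D = 1\<^sub>m n" "D * C = 1\<^sub>m n" by (simp_all add: C_def adj_inv_def)
  define k where "k = 1\<^sub>m N - E * (C * Q)"
  have k: "k \<in> carrier_mat N N" using E C(1) Q by (simp add: k_def minus_carrier_mat)
  note dims = carrier_matD[OF A] carrier_matD[OF B] carrier_matD[OF S] carrier_matD[OF E]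
    carrier_matD[OF Q] carrier_matD[OF D] carrier_matD[OF C(1)] carrier_matD[OF k]
  have kA: "k * A = B"
  proof -
    have "k * A = A - E * (C * D)" unfolding k_def D_def by (simp add: mat_ring dims)
    also have "\<dots> = B" unfolding C(2) using A B by (intro eq_matI) (auto simp: mat_ring dims E_def)
    finally show ?thesis .
  qed
  have QT: "Q\<^sup>T = \<epsilon> \<cdot>\<^sub>m (S * E)" unfolding Q_def by (simp add: mat_ring dims sym)
  have DT: "\<epsilon> \<cdot>\<^sub>m D\<^sup>T = A\<^sup>T * (S * E)" unfolding D_def by (simp add: mat_ring dims QT \<epsilon>)
  have QE: "Q * E = D + \<epsilon> \<cdot>\<^sub>m D\<^sup>T"
  proof -
    have "B = A - E" using A B by (intro eq_matI) (auto simp: E_def)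
    have "A\<^sup>T * (S * A) = (A\<^sup>T - E\<^sup>T) * (S * (A - E))"
      using eq unfolding \<open>B = A - E\<close> by (simp add: mat_ring dims)
    also have "\<dots> = A\<^sup>T * (S * A) - A\<^sup>T * (S * E) - (E\<^sup>T * (S * A) - E\<^sup>T * (S * E))"
      by (simp add: mat_ring dims) (intro eq_matI; simp add: dims)
    finally have *: "A\<^sup>T * (S * A) = A\<^sup>T * (S * A) - A\<^sup>T * (S * E) - (E\<^sup>T * (S * A) - E\<^sup>T * (S * E))" .
    have lin: "w = z + y" if "x = x - y - (z - w)" for x y z w :: complex
      using that by (simp add: algebra_simps)
    have "E\<^sup>T * (S * E) = E\<^sup>T * (S * A) + A\<^sup>T * (S * E)"
    proof (rule eq_matI)
      fix i j assume ij: "i < dim_row (E\<^sup>T * (S * A) + A\<^sup>T * (S * E))" "j < dim_col (E\<^sup>T * (S * A) + A\<^sup>T * (S * E))"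
      have entry: "(X - Y - (Z - W)) $$ (i, j) = X $$ (i, j) - Y $$ (i, j) - (Z $$ (i, j) - W $$ (i, j))"
        if "X \<in> carrier_mat n n" "Y \<in> carrier_mat n n" "Z \<in> carrier_mat n n" "W \<in> carrier_mat n n"
        for X Y Z W :: "complex mat"
        using that ij by (simp add: dims)
      have "(A\<^sup>T * (S * A)) $$ (i, j) = (A\<^sup>T * (S * A) - A\<^sup>T * (S * E) - (E\<^sup>T * (S * A) - E\<^sup>T * (S * E))) $$ (i, j)"
        using * by (rule arg_cong)
      also have "\<dots> = (A\<^sup>T * (S * A)) $$ (i, j) - (A\<^sup>T * (S * E)) $$ (i, j) - ((E\<^sup>T * (S * A)) $$ (i, j) - (E\<^sup>T * (S * E)) $$ (i, j))"
        by (rule entry) (use A S E in auto)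
      finally have "(E\<^sup>T * (S * E)) $$ (i, j) = (E\<^sup>T * (S * A)) $$ (i, j) + (A\<^sup>T * (S * E)) $$ (i, j)"
        by (rule lin)
      then show "(E\<^sup>T * (S * E)) $$ (i, j) = (E\<^sup>T * (S * A) + A\<^sup>T * (S * E)) $$ (i, j)"
        using ij by (simp add: dims del: index_mult_mat)
    qed (simp_all add: dims)
    then show ?thesis unfolding DT unfolding D_def Q_def by (simp add: mat_ring dims)
  qed
  have Sk: "S * k = S - S * (E * (C * Q))" unfolding k_def by (simp add: mat_ring dims)
  have kT: "k\<^sup>T = 1\<^sub>m N - \<epsilon> \<cdot>\<^sub>m (S * (E * (C\<^sup>T * E\<^sup>T)))"
    unfolding k_def by (simp add: mat_ring dims QT)
  \<comment> \<open>Sandwiching \<open>QE\<close> between \<open>C\<^sup>T\<close> and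
    \<open>C\<close> turns the part of \<open>k\<^sup>T S k\<close> quadratic in \<open>C\<close>
    into linear terms, which then cancel.\<close>
  have CC: "C\<^sup>T * ((Q * E) * C) = C\<^sup>T + \<epsilon> \<cdot>\<^sub>m C"
  proof -
    have "C\<^sup>T * (D\<^sup>T * C) = (D * C)\<^sup>T * C" by (simp add: mat_ring dims)
    also have "\<dots> = C" unfolding C(3) by (simp add: mat_ring dims)
    finally have 1: "C\<^sup>T * (D\<^sup>T * C) = C" .
    show ?thesis unfolding QE by (simp add: mat_ring dims C(3) 1)
  qed
  have "k\<^sup>T * S * k = k\<^sup>T * (S * k)" by (simp add: mat_ring dims)
  also have "\<dots> = (S - S * (E * (C * Q))) - \<epsilon> \<cdot>\<^sub>m (S * (E * (C\<^sup>T * (E\<^sup>T * (S - S * (E * (C * Q)))))))"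
    unfolding Sk kT by (simp add: mat_minus_mult mat_one_left mat_assoc mat_smult_mult dims)
  also have "E\<^sup>T * (S - S * (E * (C * Q))) = Q - Q * E * (C * Q)"
    unfolding Q_def by (simp add: mat_ring dims)
  also have "C\<^sup>T * (Q - Q * E * (C * Q)) = C\<^sup>T * Q - (C\<^sup>T * ((Q * E) * C)) * Q"
    by (simp add: mat_ring dims)
  also have "\<dots> = C\<^sup>T * Q - (C\<^sup>T * Q + \<epsilon> \<cdot>\<^sub>m (C * Q))"
    unfolding CC by (simp add: mat_ring dims)
  also have "\<dots> = - \<epsilon> \<cdot>\<^sub>m (C * Q)"
    by (intro eq_matI) (simp_all add: dims)
  also have "(S - S * (E * (C * Q))) - \<epsilon> \<cdot>\<^sub>m (S * (E * (- \<epsilon> \<cdot>\<^sub>m (C * Q)))) =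
      (S - S * (E * (C * Q))) - (- 1) \<cdot>\<^sub>m (S * (E * (C * Q)))"
    by (simp add: mat_ring dims \<epsilon>)
  also have "\<dots> = S"
    using S by (intro eq_matI) (simp_all add: dims del: index_mult_mat(1))
  finally have "k \<in> isometries N S" using k by (simp add: isometries_def)
  with kA show ?thesis by blast
qed

text \<open>The columns of \<open>e\<close> and of \<open>f\<close> span isotropic subspaces that
  are dual under \<open>S\<close>. As \<open>e\<^sup>T S f = 1\<close>, the matrix
  \<open>e\<^sup>T S A\<close> is the component of \<open>A\<close> along \<open>f\<close>; its
  determinant is the minor defining the chart.\<close>

locale isotropic_frames =
  fixes N n :: nat and S S' e f :: "complex mat" and \<epsilon> :: complex
  assumes S: "S \<in> carrier_mat N N" "S' \<in> carrier_mat N N" "S' * S = 1\<^sub>m N" "S\<^sup>T = \<epsilon> \<cdot>\<^sub>m S"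
    and \<epsilon>_sq: "\<epsilon> * \<epsilon> = 1"
    and e: "e \<in> carrier_mat N n" "e\<^sup>T * S * e = 0\<^sub>m n n"
    and f: "f \<in> carrier_mat N n" "f\<^sup>T * S * f = 0\<^sub>m n n" "e\<^sup>T * S * f = 1\<^sub>m n"
begin

lemma \<epsilon>_sq': "\<epsilon> * (\<epsilon> * c) = c"
  using \<epsilon>_sq by (simp flip: mult.assoc)

lemmas dims = carrier_matD[OF S(1)] carrier_matD[OF e(1)] carrier_matD[OF f(1)]

lemma products: "e\<^sup>T * (S * e) = 0\<^sub>m n n" "f\<^sup>T * (S * f) = 0\<^sub>m n n" "e\<^sup>T * (S * f) = 1\<^sub>m n"
    "f\<^sup>T * (S * e) = \<epsilon> \<cdot>\<^sub>m 1\<^sub>m n"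
proof -
  show 1: "e\<^sup>T * (S * e) = 0\<^sub>m n n" "f\<^sup>T * (S * f) = 0\<^sub>m n n" "e\<^sup>T * (S * f) = 1\<^sub>m n"
    using e(2) f(2,3) by (simp_all add: mat_assoc dims)
  have "(e\<^sup>T * (S * f))\<^sup>T = \<epsilon> \<cdot>\<^sub>m (f\<^sup>T * (S * e))"
    by (simp add: mat_ring dims S(4))
  then have "\<epsilon> \<cdot>\<^sub>m (\<epsilon> \<cdot>\<^sub>m (f\<^sup>T * (S * e))) = \<epsilon> \<cdot>\<^sub>m 1\<^sub>m n" by (simp add: 1)
  then show "f\<^sup>T * (S * e) = \<epsilon> \<cdot>\<^sub>m 1\<^sub>m n" by (simp add: mat_ring \<epsilon>_sq)
qed

lemma form_transpose:
  assumes "A \<in> carrier_mat N n" "B \<in> carrier_mat N m"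
  shows "(A\<^sup>T * S * B)\<^sup>T = \<epsilon> \<cdot>\<^sub>m (B\<^sup>T * S * A)"
  using assms by (simp add: mat_ring dims S(4))

text \<open>The points \<open>e / \<tau> + \<tau> f X / 2\<close> of the fiber over \<open>X\<close> connect any two points of the chart.\<close>

lemma transitive:
  assumes A: "A \<in> carrier_mat N n" and B: "B \<in> carrier_mat N n"
    and eq: "A\<^sup>T * S * A = B\<^sup>T * S * B"
    and nz: "det (e\<^sup>T * S * A) \<noteq> 0" "det (e\<^sup>T * S * B) \<noteq> 0"
  shows "\<exists>k\<in>isometries N S. k * A = B"
proof -
  define X where "X = A\<^sup>T * S * A"
  have X: "X \<in> carrier_mat n n" using A S(1) by (simp add: X_def)
  have XT: "X\<^sup>T = \<epsilon> \<cdot>\<^sub>m X" unfolding X_def by (rule form_transpose[OF A A])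
  have BX: "B\<^sup>T * S * B = X" by (simp add: X_def eq)
  define s where "s \<tau> = (1 / \<tau>) \<cdot>\<^sub>m e + (\<tau> / 2) \<cdot>\<^sub>m (f * X)" for \<tau>
  have s: "s \<tau> \<in> carrier_mat N n" for \<tau> using e(1) f(1) X by (simp add: s_def)
  note dims' = dims carrier_matD[OF A] carrier_matD[OF B] carrier_matD[OF X] carrier_matD[OF s]
  have sT: "(s \<tau>)\<^sup>T = (1 / \<tau>) \<cdot>\<^sub>m e\<^sup>T + (\<tau> / 2 * \<epsilon>) \<cdot>\<^sub>m (X * f\<^sup>T)" for \<tau>
    unfolding s_def by (simp add: mat_ring dims' XT)
  have ss: "(s \<tau>)\<^sup>T * S * s \<tau> = X" if "\<tau> \<noteq> 0" for \<tau>
  proof -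
    have p: "f\<^sup>T * (S * (f * X)) = 0\<^sub>m n n" "e\<^sup>T * (S * (f * X)) = X"
      using products(2,3) X by (simp_all add: dims' mat_one_left flip: mat_assoc)
    have "(\<alpha> \<cdot>\<^sub>m e\<^sup>T + (\<beta> * \<epsilon>) \<cdot>\<^sub>m (X * f\<^sup>T)) * S * (\<alpha> \<cdot>\<^sub>m e + \<beta> \<cdot>\<^sub>m (f * X)) = (2 * \<alpha> * \<beta>) \<cdot>\<^sub>m X"
      for \<alpha> \<beta>
    proof -
      have "(\<alpha> \<cdot>\<^sub>m e\<^sup>T + (\<beta> * \<epsilon>) \<cdot>\<^sub>m (X * f\<^sup>T)) * S * (\<alpha> \<cdot>\<^sub>m e + \<beta> \<cdot>\<^sub>m (f * X)) =
          \<alpha> \<cdot>\<^sub>m (\<alpha> \<cdot>\<^sub>m (e\<^sup>T * (S * e)) + \<beta> \<cdot>\<^sub>m (e\<^sup>T * (S * (f * X)))) +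
          (\<beta> * \<epsilon>) \<cdot>\<^sub>m (\<alpha> \<cdot>\<^sub>m (X * (f\<^sup>T * (S * e))) + \<beta> \<cdot>\<^sub>m (X * (f\<^sup>T * (S * (f * X)))))"
        by (simp add: mat_assoc mat_add_mult mat_mult_add mat_mult_smult mat_smult_mult dims')
          (intro eq_matI; simp add: dims' algebra_simps del: index_mult_mat(1))
      also have "\<dots> = (2 * \<alpha> * \<beta>) \<cdot>\<^sub>m X"
        unfolding p products using X
        by (intro eq_matI) (simp_all add: mat_mult_smult mat_one_right dims' algebra_simps \<epsilon>_sq \<epsilon>_sq')
      finally show ?thesis .
    qed
    from this[of "1 / \<tau>" "\<tau> / 2"] show ?thesis
      unfolding sT unfolding s_def using that by (simp add: mat_smult_one)
  qed
  \<comment> \<open>This is \<open>\<tau>\<close> times the matrix whose determinant must be nonzero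
    for a reflection from \<open>M\<close> to \<open>s \<tau>\<close> (see \<open>H_eq\<close>),
    freed from its pole at zero. At \<open>\<tau> = 0\<close> it equals
    \<open>- e\<^sup>T S M\<close>, which is invertible in the chart.\<close>
  define H where "H M \<tau> = \<tau> \<cdot>\<^sub>m X + (- 1) \<cdot>\<^sub>m (e\<^sup>T * S * M) + ((- \<epsilon> / 2) * (\<tau> * \<tau>)) \<cdot>\<^sub>m (X * (f\<^sup>T * (S * M)))" for M \<tau>
  interpret R: function_algebra UNIV "rational_funs {0, 1}" by (rule function_algebra_rational_funs)
  have H_rat: "(\<lambda>\<tau>. det (H M \<tau>)) \<in> rational_funs {0, 1}" if "M \<in> carrier_mat N n" for M
  proof -
    have c: "e\<^sup>T * S * M \<in> carrier_mat n n" "X * (f\<^sup>T * (S * M)) \<in> carrier_mat n n"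
      using that X e(1) f(1) S(1) by auto
    have "H M \<in> R.mat_funs n n"
      unfolding H_def [abs_def]
      by (rule R.mat_funs_add[OF R.mat_funs_add[OF R.mat_funs_smult[OF R.mat_funs_const[OF X] rational_funs_ident]
            R.mat_funs_smult[OF R.mat_funs_const[OF c(1)] R.const]]
          R.mat_funs_smult[OF R.mat_funs_const[OF c(2)] R.mult[OF R.const R.mult[OF rational_funs_ident rational_funs_ident]]]])
    then show ?thesis by (rule R.det_mat_funs)
  qed
  have H0: "det (H M 0) \<noteq> 0" if "M \<in> carrier_mat N n" "det (e\<^sup>T * S * M) \<noteq> 0" for M
  proof -
    have "H M 0 = (- 1) \<cdot>\<^sub>m (e\<^sup>T * S * M)"
      unfolding H_def using that(1) X by (intro eq_matI) (simp_all add: dims' del: index_mult_mat(1))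
    then show ?thesis using that(2) by simp
  qed
  have H_eq: "H M \<tau> = \<tau> \<cdot>\<^sub>m ((M - s \<tau>)\<^sup>T * S * M)" if "M \<in> carrier_mat N n" "M\<^sup>T * S * M = X" "\<tau> \<noteq> 0" for M \<tau>
  proof -
    note dM = carrier_matD[OF that(1)]
    have "(M - s \<tau>)\<^sup>T * S * M = M\<^sup>T * S * M - (s \<tau>)\<^sup>T * S * M"
      by (simp add: mat_ring dims' dM)
    also have "\<dots> = X - ((1 / \<tau>) \<cdot>\<^sub>m (e\<^sup>T * S * M) + (\<tau> / 2 * \<epsilon>) \<cdot>\<^sub>m (X * (f\<^sup>T * (S * M))))"
      unfolding that(2) sT by (simp add: mat_assoc mat_add_mult mat_smult_mult dims' dM)
    finally show ?thesis unfolding H_def using that(3)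
      by (intro eq_matI) (simp_all add: dims' dM field_simps del: index_mult_mat(1))
  qed
  have "\<exists>\<tau>. \<tau> \<noteq> 0 \<and> det (H A \<tau>) \<noteq> 0 \<and> det (H B \<tau>) \<noteq> 0"
  proof (rule ccontr)
    assume no: "\<not> ?thesis"
    \<comment> \<open>The parameter itself is the second factor, evaluated at 1; this forces a
      common \<open>\<tau>\<close> that is also nonzero.\<close>
    have "det (H A 0) * det (H B 0) = 0 \<or> (1 :: complex) = 0"
    proof (rule rational_funs_mult_eq_0[OF R.mult[OF H_rat[OF A] H_rat[OF B]] rational_funs_ident R.const[of 1]])
      fix t
      have "t = 0 \<or> det (H A t) = 0 \<or> det (H B t) = 0" using no by blast
      then show "det (H A t) * det (H B t) * t = 0" by (elim disjE) simp_all
    qed simp_all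
    then show False using H0[OF A nz(1)] H0[OF B nz(2)] by simp
  qed
  then obtain \<tau> where \<tau>: "\<tau> \<noteq> 0" "det (H A \<tau>) \<noteq> 0" "det (H B \<tau>) \<noteq> 0" by blast
  have "det ((A - s \<tau>)\<^sup>T * S * A) \<noteq> 0"
    using \<tau>(2) unfolding H_eq[OF A X_def[symmetric] \<tau>(1)] by auto
  then obtain k where k: "k \<in> isometries N S" "k * A = s \<tau>"
    using ex_reflection[OF A s S(1,4) \<epsilon>_sq] ss[OF \<tau>(1)] X_def by metis
  have "det ((B - s \<tau>)\<^sup>T * S * B) \<noteq> 0"
    using \<tau>(3) unfolding H_eq[OF B BX \<tau>(1)] by auto
  \<comment> \<open>The second reflection goes from \<open>s \<tau>\<close> to \<open>B\<close>.
    Since both lie over \<open>X\<close>, its matrix is up to \<open>\<epsilon>\<close> the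
    transpose of the one just treated.\<close>
  moreover have "((B - s \<tau>)\<^sup>T * S * B)\<^sup>T = \<epsilon> \<cdot>\<^sub>m ((s \<tau> - B)\<^sup>T * S * s \<tau>)"
  proof -
    have "((B - s \<tau>)\<^sup>T * S * B)\<^sup>T = \<epsilon> \<cdot>\<^sub>m (B\<^sup>T * S * (B - s \<tau>))"
      by (rule form_transpose[OF minus_carrier_mat[OF s] B])
    also have "B\<^sup>T * S * (B - s \<tau>) = X - B\<^sup>T * S * s \<tau>"
      unfolding BX[symmetric] by (rule mat_mult_minus) (simp_all add: dims')
    also have "X - B\<^sup>T * S * s \<tau> = (s \<tau> - B)\<^sup>T * S * s \<tau>"
    proof -
      have "(s \<tau> - B)\<^sup>T * S * s \<tau> = (s \<tau>)\<^sup>T * S * s \<tau> - B\<^sup>T * S * s \<tau>"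
      by (simp add: mat_ring dims')
      then show ?thesis unfolding ss[OF \<tau>(1)] ..
    qed
    finally show ?thesis .
  qed
  moreover have "det ((B - s \<tau>)\<^sup>T * S * B) = det (((B - s \<tau>)\<^sup>T * S * B)\<^sup>T)"
    by (rule det_transpose[symmetric, of _ n]) (use B S(1) s in \<open>auto intro!: mult_carrier_mat minus_carrier_mat\<close>)
  ultimately have "det ((s \<tau> - B)\<^sup>T * S * s \<tau>) \<noteq> 0" by auto
  then obtain l where l: "l \<in> isometries N S" "l * s \<tau> = B"
    using ex_reflection[OF s B S(1,4) \<epsilon>_sq] ss[OF \<tau>(1)] BX by metis
  have "l * k * A = l * (k * A)"
    using k(1) l(1) A by (intro mat_assoc) (auto simp: isometries_def)
  then have "l * k * A = B" by (simp only: k(2) l(2))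
  then show ?thesis using isometries_mult[OF l(1) k(1) S(1)] by blast
qed

text \<open>An explicit point of the chart over \<open>X\<close>: the isotropic parts contribute
  nothing and the two cross terms contribute \<open>X / 2\<close> each.\<close>

lemma base_point:
  assumes X: "X \<in> carrier_mat n n" "X\<^sup>T = \<epsilon> \<cdot>\<^sub>m X"
  defines "b \<equiv> f + (\<epsilon> / 2) \<cdot>\<^sub>m (e * X)"
  shows "b \<in> carrier_mat N n" "b\<^sup>T * S * b = X" "e\<^sup>T * S * b = 1\<^sub>m n"
proof -
  show b: "b \<in> carrier_mat N n" using e(1) f(1) X by (simp add: b_def)
  note dims' = dims carrier_matD[OF X(1)]
  have p: "e\<^sup>T * (S * (e * X)) = 0\<^sub>m n n" "f\<^sup>T * (S * (e * X)) = \<epsilon> \<cdot>\<^sub>m X"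
    using products(1,4) X by (simp_all add: dims' mat_one_left mat_smult_mult flip: mat_assoc)
  show "e\<^sup>T * S * b = 1\<^sub>m n"
    unfolding b_def using X by (simp add: mat_assoc mat_mult_add mat_mult_smult dims' products p)
  have bT: "b\<^sup>T = f\<^sup>T + (\<epsilon> * \<epsilon> / 2) \<cdot>\<^sub>m (X * e\<^sup>T)"
    unfolding b_def by (simp add: mat_ring dims' X(2) algebra_simps)
  show "b\<^sup>T * S * b = X"
    unfolding bT unfolding b_def using X(1)
    by (simp add: mat_assoc mat_add_mult mat_mult_add mat_mult_smult mat_smult_mult mat_smult_smult dims' products p \<epsilon>_sq)
      (intro eq_matI; simp add: field_simps \<epsilon>_sq \<epsilon>_sq')
qed

end

section \<open>The fibers of the moment maps\<close>

lemma points_prod_variety [simp]: "points (V \<times>\<^sub>V V') = points V \<times> points V'"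
  by (simp add: prod_variety_def)

lemma coords_prod_variety: "coords (V \<times>\<^sub>V V') = (\<lambda>f w. f (fst w)) ` coords V \<union> (\<lambda>f w. f (snd w)) ` coords V'"
  by (auto simp: prod_variety_def o_def)

lemma mat_space_simps [simp]: "points (mat_space a b) = carrier_mat a b" "coords (mat_space a b) = mat_coords a b"
  by (simp_all add: mat_space_def)

lemma polynomial_fst: "f \<in> polynomial_funs (coords V) \<Longrightarrow> (\<lambda>w. f (fst w)) \<in> polynomial_funs (coords (V \<times>\<^sub>V V'))"
  by (rule function_algebra.comp_polynomial_funs[OF function_algebra_polynomial_funs])
    (auto simp: coords_prod_variety intro!: polynomial_funs.coord)

lemma polynomial_snd: "f \<in> polynomial_funs (coords V') \<Longrightarrow> (\<lambda>w. f (snd w)) \<in> polynomial_funs (coords (V \<times>\<^sub>V V'))"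
  by (rule function_algebra.comp_polynomial_funs[OF function_algebra_polynomial_funs])
    (auto simp: coords_prod_variety intro!: polynomial_funs.coord)

lemma polynomial_entry: "i < a \<Longrightarrow> j < b \<Longrightarrow> (\<lambda>A. A $$ (i, j)) \<in> polynomial_funs (mat_coords a b)"
  by (intro polynomial_funs.coord) (auto simp: mat_coords_def)

lemma rational_adj_inv_cong:
  assumes "g \<in> carrier (GL n)" "h \<in> carrier (GL n)"
    and "\<phi> \<in> rational_funs {0, 1}" "\<And>t. det (gl_path g h t) \<noteq> 0 \<Longrightarrow> \<psi> t = \<phi> t"
  shows "\<psi> \<in> rational_funs {0, 1}"
  by (rule rational_funs_cong_nonzero[OF assms(3) gl_path(5)[OF assms(1,2)]])
    (use gl_path(1,2)[OF assms(1,2)] GL_det[OF assms(1)] GL_det[OF assms(2)] assms(4) in auto)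

subsection \<open>Symmetric and alternating forms\<close>

text \<open>\<open>cmp\<close> is the change of coordinates that brings \<open>S\<close> into the
  split shape of \<open>form\<close>, and \<open>cd\<close> reads the split coordinates off a
  matrix.\<close>

locale form_model = form_family n N1 N2 \<epsilon> for n N1 N2 \<epsilon> +
  fixes sz :: "bool \<Rightarrow> nat" and S S' e f :: "bool \<Rightarrow> complex mat"
    and cmp :: "bool \<Rightarrow> (nat \<times> nat \<times> nat \<Rightarrow> complex) \<Rightarrow> complex mat"
    and cd :: "bool \<Rightarrow> complex mat \<Rightarrow> nat \<times> nat \<times> nat \<Rightarrow> complex"
    and Sv :: "(complex mat \<times> complex mat) variety"
    and \<psi> :: "complex mat \<times> complex mat \<Rightarrow> complex mat \<times> complex mat"
  assumes frames: "isotropic_frames (sz s) n (S s) (S' s) (e s) (f s) \<epsilon>"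
    and cmp_carrier: "cmp s b \<in> carrier_mat (sz s) n"
    and cmp_poly: "r < sz s \<Longrightarrow> i < n \<Longrightarrow> (\<lambda>a. cmp s (\<lambda>x. a (s, x)) $$ (r, i)) \<in> assignment_polys"
    and cmp_cd: "A \<in> carrier_mat (sz s) n \<Longrightarrow> cmp s (cd s A) = A"
    and cd_poly: "(\<lambda>A. cd s A x) \<in> polynomial_funs (mat_coords (sz s) n)"
    and cmp_form: "i < n \<Longrightarrow> j < n \<Longrightarrow>
      ((cmp s (\<lambda>x. a (s, x)))\<^sup>T * S s * cmp s (\<lambda>x. a (s, x))) $$ (i, j) = form (s, i, j) a"
    and cmp_U: "(e s)\<^sup>T * S s * cmp s b = mat n n (\<lambda>(k, i). b (0, k, i))"
    and Sv_points: "points Sv = {X \<in> carrier_mat n n. X\<^sup>T = \<epsilon> \<cdot>\<^sub>m X} \<times> {X \<in> carrier_mat n n. X\<^sup>T = \<epsilon> \<cdot>\<^sub>m X}"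
    and Sv_coords: "coords Sv = coords (mat_space n n \<times>\<^sub>V mat_space n n)"
    and \<psi>: "A \<in> carrier_mat (sz True) n \<Longrightarrow> B \<in> carrier_mat (sz False) n \<Longrightarrow>
      \<psi> (A, B) = (A\<^sup>T * S True * A, B\<^sup>T * S False * B)"
begin

sublocale F: isotropic_frames "sz s" n "S s" "S' s" "e s" "f s" \<epsilon> for s
  by (rule frames)

definition W :: "(complex mat \<times> complex mat) variety" where
  "W = mat_space (sz True) n \<times>\<^sub>V mat_space (sz False) n"

definition pt :: "(var \<Rightarrow> complex) \<Rightarrow> complex mat \<times> complex mat" where
  "pt a = (cmp True (\<lambda>x. a (True, x)), cmp False (\<lambda>x. a (False, x)))"

definition \<xi> :: "complex mat \<times> complex mat \<Rightarrow> var \<Rightarrow> complex" where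
  "\<xi> v = (\<lambda>(s, x). if s then cd True (fst v) x else cd False (snd v) x)"

definition \<chi> :: "bool \<times> nat \<times> nat \<Rightarrow> complex mat \<times> complex mat \<Rightarrow> complex" where
  "\<chi> = (\<lambda>(s, i, j) z. if s then fst z $$ (i, j) else snd z $$ (i, j))"

definition \<Delta> :: "complex mat \<times> complex mat \<Rightarrow> complex" where
  "\<Delta> v = det ((e True)\<^sup>T * S True * fst v) * det ((e False)\<^sup>T * S False * snd v)"

definition orb :: "complex mat \<times> complex mat \<Rightarrow> (complex mat \<times> complex mat) set" where
  "orb z = (\<lambda>g. (g * fst z * g\<^sup>T, (gl_inv g)\<^sup>T * snd z * gl_inv g)) ` carrier (GL n)"

text \<open>Isometries act directly on both factors. The symplectic pair acts on its second factor
  by inverse transposes, which gives the same set by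
  \<open>symplectic_contragredient\<close>.\<close>

definition \<Omega> :: "complex mat \<times> complex mat \<Rightarrow> (complex mat \<times> complex mat) set" where
  "\<Omega> v = {(k * fst v * g\<^sup>T, l * snd v * gl_inv g) | k l g.
    k \<in> isometries (sz True) (S True) \<and> l \<in> isometries (sz False) (S False) \<and> g \<in> carrier (GL n)}"

lemma form_value: "A \<in> carrier_mat (sz s) n \<Longrightarrow> A\<^sup>T * S s * A \<in> {X \<in> carrier_mat n n. X\<^sup>T = \<epsilon> \<cdot>\<^sub>m X}"
  using F.form_transpose[of A s A n] F.S(1)[of s] by (auto intro!: mult_carrier_mat)

lemma corrected_model: "corrected_family w eqs lead_eq (lead_U True + lead_U False)
    (\<lambda>p a. \<chi> p (\<psi> (pt a))) (\<lambda>a. \<Delta> (pt a)) corr"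
proof -
  have "(\<lambda>a. \<Delta> (pt a)) = dU"
    by (auto simp: \<Delta>_def pt_def dU_def U_def cmp_U)
  moreover have "(\<lambda>a. \<chi> p (\<psi> (pt a))) = form p" if "p \<in> eqs" for p
  proof
    fix a
    obtain s i j where p: "p = (s, i, j)" by (cases p)
    have ij: "i < n" "j < n" using that by (auto simp: eqs_def p)
    show "\<chi> p (\<psi> (pt a)) = form p a"
      using cmp_form[OF ij, of s a] by (cases s) (simp_all add: p pt_def \<psi> cmp_carrier \<chi>_def)
  qed
  ultimately show ?thesis by (auto intro: corrected_family_cong[OF corrected])
qed

sublocale fm: fiber_model W Sv \<psi> pt \<xi> \<chi> \<Delta> w eqs lead_eq "lead_U True + lead_U False" corr
proof (rule fiber_model.intro)
  interpret A: function_algebra UNIV "assignment_polys :: ((var \<Rightarrow> complex) \<Rightarrow> complex) set"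
    by (rule function_algebra_polynomial_funs)
  interpret V: function_algebra "points W" "regular_funs W" by (rule function_algebra_regular_funs)
  show "corrected_family w eqs lead_eq (lead_U True + lead_U False)
    (\<lambda>p a. \<chi> p (\<psi> (pt a))) (\<lambda>a. \<Delta> (pt a)) corr" by (rule corrected_model)
  show "pt a \<in> points W" for a by (simp add: pt_def W_def cmp_carrier)
  show "pt (\<xi> A) = A" if "A \<in> points W" for A
    using that by (auto simp: pt_def \<xi>_def W_def cmp_cd)
  show "(\<lambda>A. \<xi> A x) \<in> regular_funs W" for x
  proof -
    obtain s y where x: "x = (s, y)" by (cases x)
    show ?thesis
    proof (cases s)
      case True
      have "(\<lambda>v. cd True (fst v) y) \<in> polynomial_funs (coords W)"
        unfolding W_def by (rule polynomial_fst[of "\<lambda>A. cd True A y"]) (simp add: cd_poly)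
      then show ?thesis using True by (simp add: x \<xi>_def polynomial_funs_regular)
    next
      case False
      have "(\<lambda>v. cd False (snd v) y) \<in> polynomial_funs (coords W)"
        unfolding W_def by (rule polynomial_snd[of "\<lambda>A. cd False A y"]) (simp add: cd_poly)
      then show ?thesis using False by (simp add: x \<xi>_def polynomial_funs_regular)
    qed
  qed
  show "(\<lambda>a. c (pt a)) \<in> assignment_polys" if "c \<in> coords W" for c
    using that by (auto simp: W_def coords_prod_variety mat_coords_def pt_def intro!: cmp_poly)
  show "\<psi> A \<in> points Sv" if "A \<in> points W" for A
    using that form_value by (cases A) (auto simp: W_def \<psi> Sv_points)
  show "(\<lambda>A. d (\<psi> A)) \<in> regular_funs W" if "d \<in> coords Sv" for d
  proof -
    have fst: "(\<lambda>v. fst v) \<in> V.mat_funs (sz True) n"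
      by (intro V.mat_funsI) (auto simp: W_def intro!: polynomial_funs_regular polynomial_fst polynomial_entry)
    have snd: "(\<lambda>v. snd v) \<in> V.mat_funs (sz False) n"
      by (intro V.mat_funsI) (auto simp: W_def intro!: polynomial_funs_regular polynomial_snd polynomial_entry)
    have f: "(\<lambda>v. ((fst v)\<^sup>T * S True * fst v) $$ (i, j)) \<in> regular_funs W"
        "(\<lambda>v. ((snd v)\<^sup>T * S False * snd v) $$ (i, j)) \<in> regular_funs W" if "i < n" "j < n" for i j
      by (rule V.mat_funs_entry[OF V.mat_funs_mult[OF V.mat_funs_mult[OF V.mat_funs_transpose[OF fst]
              V.mat_funs_const[OF F.S(1)]] fst] that],
          rule V.mat_funs_entry[OF V.mat_funs_mult[OF V.mat_funs_mult[OF V.mat_funs_transpose[OF snd]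
              V.mat_funs_const[OF F.S(1)]] snd] that])
    from \<open>d \<in> coords Sv\<close> obtain i j where ij: "i < n" "j < n"
      and d: "d = (\<lambda>z. fst z $$ (i, j)) \<or> d = (\<lambda>z. snd z $$ (i, j))"
      by (auto simp: Sv_coords coords_prod_variety mat_coords_def)
    from d show ?thesis
    proof
      assume d: "d = (\<lambda>z. fst z $$ (i, j))"
      show ?thesis by (rule V.cong[OF f(1)[OF ij]]) (auto simp: d W_def \<psi>)
    next
      assume d: "d = (\<lambda>z. snd z $$ (i, j))"
      show ?thesis by (rule V.cong[OF f(2)[OF ij]]) (auto simp: d W_def \<psi>)
    qed
  qed
  show "\<chi> p \<in> coords Sv" if p: "p \<in> eqs" for p
  proof -
    obtain s i j where ps: "p = (s, i, j)" by (cases p)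
    have ij: "i < n" "j < n" using p by (auto simp: eqs_def ps)
    then have "(\<lambda>A. A $$ (i, j)) \<in> mat_coords n n" by (auto simp: mat_coords_def)
    then show ?thesis by (cases s) (auto simp: ps \<chi>_def Sv_coords coords_prod_variety)
  qed
  show "z = z'" if z: "z \<in> points Sv" "z' \<in> points Sv" and eq: "\<And>p. p \<in> eqs \<Longrightarrow> \<chi> p z = \<chi> p z'" for z z'
  proof -
    \<comment> \<open>Entries below the diagonal follow by \<open>\<epsilon>\<close>-symmetry; for
      \<open>\<epsilon> = -1\<close> a diagonal entry equals its negative.\<close>
    have key: "X = X'" if X: "X \<in> carrier_mat n n" "X\<^sup>T = \<epsilon> \<cdot>\<^sub>m X" and X': "X' \<in> carrier_mat n n" "X'\<^sup>T = \<epsilon> \<cdot>\<^sub>m X'"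
      and e: "\<And>i j. (s, i, j) \<in> eqs \<Longrightarrow> X $$ (i, j) = X' $$ (i, j)" for X X' :: "complex mat" and s
    proof (rule eq_matI)
      fix i j assume "i < dim_row X'" "j < dim_col X'"
      then have ij: "i < n" "j < n" using X' by auto
      have sym: "Y $$ (j, i) = \<epsilon> * Y $$ (i, j)" if "Y \<in> carrier_mat n n" "Y\<^sup>T = \<epsilon> \<cdot>\<^sub>m Y" for Y :: "complex mat"
        using arg_cong[OF that(2), of "\<lambda>M. M $$ (i, j)"] that(1) ij by simp
      consider "i < j" | "j < i" | "i = j" "\<epsilon> = 1" | "i = j" "\<epsilon> = -1" using \<epsilon> by linarith
      then show "X $$ (i, j) = X' $$ (i, j)"
      proof cases
        case 1
        then show ?thesis using e[of i j] ij by (simp add: eqs_def)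
      next
        case 2
        then have "X $$ (j, i) = X' $$ (j, i)" using e[of j i] ij by (simp add: eqs_def)
        then show ?thesis using sym[OF X] sym[OF X'] \<epsilon> by auto
      next
        case 3
        have "(s, i, j) \<in> eqs" unfolding eqs_def using 3 ij by auto
        then show ?thesis by (rule e)
      next
        case 4
        then show ?thesis using sym[OF X] sym[OF X'] by simp
      qed
    qed (use X X' in auto)
    obtain X Y X' Y' where zz: "z = (X, Y)" "z' = (X', Y')" by (metis surj_pair)
    have "X = X'" by (rule key[of _ _ True]) (use z eq[of "(True, _, _)"] in \<open>auto simp: zz Sv_points \<chi>_def\<close>)
    moreover have "Y = Y'" by (rule key[of _ _ False]) (use z eq[of "(False, _, _)"] in \<open>auto simp: zz Sv_points \<chi>_def\<close>)
    ultimately show ?thesis by (simp add: zz)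
  qed
qed

text \<open>The base point over \<open>z0\<close>, translated by \<open>g\<close>, is a chart point
  over the translate of \<open>z0\<close>. By \<open>F.transitive\<close> every chart point with the
  same image is conjugate to it under isometries, so the chart part is contained in
  \<open>\<Omega>\<close>.\<close>

lemma form_fiber:
  assumes z0: "z0 \<in> points Sv"
  shows "\<exists>v\<in>points W. reduced_irreducible_closed_subvariety W (fiber_ideal W \<psi> Sv (zariski Sv closure_of orb z0)) \<and>
    zero_locus W (fiber_ideal W \<psi> Sv (zariski Sv closure_of orb z0)) = zariski W closure_of \<Omega> v"
proof -
  obtain X Y where z0_eq: "z0 = (X, Y)" by (cases z0)
  have X: "X \<in> carrier_mat n n" "X\<^sup>T = \<epsilon> \<cdot>\<^sub>m X" and Y: "Y \<in> carrier_mat n n" "Y\<^sup>T = \<epsilon> \<cdot>\<^sub>m Y"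
    using z0 by (auto simp: z0_eq Sv_points)
  define A0 where "A0 = f True + (\<epsilon> / 2) \<cdot>\<^sub>m (e True * X)"
  define B0 where "B0 = f False + (\<epsilon> / 2) \<cdot>\<^sub>m (e False * Y)"
  note A0 = F.base_point[OF X, of True, folded A0_def]
  note B0 = F.base_point[OF Y, of False, folded B0_def]
  have S_form: "(A * h)\<^sup>T * S s * (A * h) = h\<^sup>T * (A\<^sup>T * S s * A) * h" "(e s)\<^sup>T * S s * (A * h) = (e s)\<^sup>T * S s * A * h"
    if "A \<in> carrier_mat (sz s) n" "h \<in> carrier_mat n n" for A h s
    using that F.S(1)[of s] F.e(1)[of s] by (simp_all add: mat_ring)
  have assoc: "k * A0 * g\<^sup>T = k * (A0 * g\<^sup>T)" "l * B0 * gl_inv g = l * (B0 * gl_inv g)"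
    if "k \<in> isometries (sz True) (S True)" "l \<in> isometries (sz False) (S False)" "g \<in> carrier (GL n)" for k l g
    using that A0(1) B0(1) GL_carrier_mat[OF that(3)] gl_inv(1)[OF that(3)]
    by (auto simp: mat_assoc isometries_def)
  have carr: "k * (A0 * g\<^sup>T) \<in> carrier_mat (sz True) n" "l * (B0 * gl_inv g) \<in> carrier_mat (sz False) n"
      "A0 * g\<^sup>T \<in> carrier_mat (sz True) n" "B0 * gl_inv g \<in> carrier_mat (sz False) n"
    if "k \<in> isometries (sz True) (S True)" "l \<in> isometries (sz False) (S False)" "g \<in> carrier (GL n)" for k l g
    using that A0(1) B0(1) GL_carrier_mat[OF that(3)] gl_inv(1)[OF that(3)]
    by (auto simp: isometries_def intro!: mult_carrier_mat)
  have base: "(A0 * g\<^sup>T)\<^sup>T * S True * (A0 * g\<^sup>T) = g * X * g\<^sup>T"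
      "(B0 * gl_inv g)\<^sup>T * S False * (B0 * gl_inv g) = (gl_inv g)\<^sup>T * Y * gl_inv g"
      "det ((e True)\<^sup>T * S True * (A0 * g\<^sup>T)) \<noteq> 0" "det ((e False)\<^sup>T * S False * (B0 * gl_inv g)) \<noteq> 0"
    if g: "g \<in> carrier (GL n)" for g
  proof -
    note c = GL_carrier_mat[OF g] gl_inv(1)[OF g]
    show "(A0 * g\<^sup>T)\<^sup>T * S True * (A0 * g\<^sup>T) = g * X * g\<^sup>T"
      "(B0 * gl_inv g)\<^sup>T * S False * (B0 * gl_inv g) = (gl_inv g)\<^sup>T * Y * gl_inv g"
      using S_form(1)[OF A0(1), of "g\<^sup>T"] S_form(1)[OF B0(1), of "gl_inv g"] c by (simp_all add: A0(2) B0(2))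
    have "(e True)\<^sup>T * S True * (A0 * g\<^sup>T) = g\<^sup>T" "(e False)\<^sup>T * S False * (B0 * gl_inv g) = gl_inv g"
      using S_form(2)[OF A0(1), of "g\<^sup>T"] S_form(2)[OF B0(1), of "gl_inv g"] c by (simp_all add: A0(3) B0(3))
    moreover have "det (g\<^sup>T) \<noteq> 0" using det_transpose[OF c(1)] GL_det[OF g] by simp
    moreover have "det (gl_inv g) \<noteq> 0" using det_mult[OF c(2,1)] gl_inv(2)[OF g] by auto
    ultimately show "det ((e True)\<^sup>T * S True * (A0 * g\<^sup>T)) \<noteq> 0" "det ((e False)\<^sup>T * S False * (B0 * gl_inv g)) \<noteq> 0"
      by simp_all
  qed
  have one: "1\<^sub>m N \<in> isometries N T" if "T \<in> carrier_mat N N" for N T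
    using that by (simp add: isometries_def)
  have one_GL: "1\<^sub>m n \<in> carrier (GL n)" by (rule gl_inv_eq(1)[of _ _ "1\<^sub>m n"]) auto
  have "reduced_irreducible_closed_subvariety W (fiber_ideal W \<psi> Sv (zariski Sv closure_of orb z0)) \<and>
    zero_locus W (fiber_ideal W \<psi> Sv (zariski Sv closure_of orb z0)) = zariski W closure_of \<Omega> (A0, B0)"
  proof (rule fm.fiber_irreducible)
    show "\<Omega> (A0, B0) \<subseteq> points W"
      using carr by (auto simp: \<Omega>_def W_def assoc)
    show "\<Omega> (A0, B0) \<noteq> {}"
      unfolding \<Omega>_def using one[OF F.S(1)[of True]] one[OF F.S(1)[of False]] one_GL by blast
    show "\<psi> ` \<Omega> (A0, B0) \<subseteq> orb z0"
    proof
      fix y assume "y \<in> \<psi> ` \<Omega> (A0, B0)"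
      then obtain k l g where *: "k \<in> isometries (sz True) (S True)" "l \<in> isometries (sz False) (S False)"
        "g \<in> carrier (GL n)" "y = \<psi> (k * A0 * g\<^sup>T, l * B0 * gl_inv g)" by (auto simp: \<Omega>_def)
      note ca = carr[OF *(1-3)]
      have "y = (g * X * g\<^sup>T, (gl_inv g)\<^sup>T * Y * gl_inv g)"
        unfolding *(4) assoc[OF *(1-3)] \<psi>[OF ca(1,2)]
          isometries_form[OF *(1) F.S(1) ca(3,3)] isometries_form[OF *(2) F.S(1) ca(4,4)] base[OF *(3)] ..
      then show "y \<in> orb z0" using *(3) by (auto simp: orb_def z0_eq)
    qed
    show "orb z0 \<subseteq> points Sv"
    proof
      fix y assume "y \<in> orb z0"
      then obtain g where g: "g \<in> carrier (GL n)" "y = (g * X * g\<^sup>T, (gl_inv g)\<^sup>T * Y * gl_inv g)"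
        by (auto simp: orb_def z0_eq)
      note ca = carr[OF one[OF F.S(1)] one[OF F.S(1)] g(1)]
      show "y \<in> points Sv"
        using form_value[OF ca(3)] form_value[OF ca(4)] base(1,2)[OF g(1)] by (simp add: g(2) Sv_points)
    qed
    fix h A assume van: "\<And>x. x \<in> \<Omega> (A0, B0) \<Longrightarrow> h x = 0" and A: "A \<in> points W" "\<psi> A \<in> orb z0" "\<Delta> A \<noteq> 0"
    obtain M M' where AM: "A = (M, M')" by (cases A)
    have M: "M \<in> carrier_mat (sz True) n" "M' \<in> carrier_mat (sz False) n" using A(1) by (auto simp: AM W_def)
    obtain g where g: "g \<in> carrier (GL n)" "\<psi> A = (g * X * g\<^sup>T, (gl_inv g)\<^sup>T * Y * gl_inv g)"
      using A(2) by (auto simp: orb_def z0_eq)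
    note ca = carr[OF one[OF F.S(1)] one[OF F.S(1)] g(1)]
    have eq: "(A0 * g\<^sup>T)\<^sup>T * S True * (A0 * g\<^sup>T) = M\<^sup>T * S True * M"
      "(B0 * gl_inv g)\<^sup>T * S False * (B0 * gl_inv g) = M'\<^sup>T * S False * M'"
      using g(2) base(1,2)[OF g(1)] by (simp_all add: AM \<psi>[OF M])
    have nz: "det ((e True)\<^sup>T * S True * M) \<noteq> 0" "det ((e False)\<^sup>T * S False * M') \<noteq> 0"
      using A(3) by (auto simp: \<Delta>_def AM)
    obtain k where k: "k \<in> isometries (sz True) (S True)" "k * (A0 * g\<^sup>T) = M"
      using F.transitive[OF ca(3) M(1) eq(1) base(3)[OF g(1)] nz(1)] by blast
    obtain l where l: "l \<in> isometries (sz False) (S False)" "l * (B0 * gl_inv g) = M'"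
      using F.transitive[OF ca(4) M(2) eq(2) base(4)[OF g(1)] nz(2)] by blast
    have "A = (k * A0 * g\<^sup>T, l * B0 * gl_inv g)" using assoc[OF k(1) l(1) g(1)] k(2) l(2) by (simp add: AM)
    then have "A \<in> \<Omega> (A0, B0)" using k(1) l(1) g(1) by (auto simp: \<Omega>_def)
    then show "h A = 0" by (rule van)
  next
    fix z z' assume "z \<in> orb z0" "z' \<in> orb z0"
    then obtain g h where g: "g \<in> carrier (GL n)" "z = (g * X * g\<^sup>T, (gl_inv g)\<^sup>T * Y * gl_inv g)"
      and h: "h \<in> carrier (GL n)" "z' = (h * X * h\<^sup>T, (gl_inv h)\<^sup>T * Y * gl_inv h)"
      by (auto simp: orb_def z0_eq)
    \<comment> \<open>The orbit is an image of \<open>GL n\<close>, so the curve comes from the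
      segment between the two group elements, and the determinant along it serves as
      \<open>E\<close>.\<close>
    define p where "p = gl_path g h"
    note path = gl_path[OF g(1) h(1), folded p_def]
    interpret R: function_algebra UNIV "rational_funs {0, 1}" by (rule function_algebra_rational_funs)
    define \<zeta> where "\<zeta> t = (p t * X * (p t)\<^sup>T, (gl_inv (p t))\<^sup>T * Y * gl_inv (p t))" for t
    have inv: "gl_inv (p t) = adj_inv (p t)" "p t \<in> carrier (GL n)" if "det (p t) \<noteq> 0" for t
      using gl_inv_adj[OF path(3) that] by (simp_all add: adj_inv_def)
    have rat: "(\<lambda>t. \<chi> q (\<zeta> t)) \<in> rational_funs {0, 1}" if "q \<in> eqs" for q
    proof -
      obtain s i j where q: "q = (s, i, j)" by (cases q)
      have ij: "i < n" "j < n" using that by (auto simp: eqs_def q)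
      show ?thesis
      proof (cases s)
        case True
        have "(\<lambda>t. (p t * X * (p t)\<^sup>T) $$ (i, j)) \<in> rational_funs {0, 1}"
          by (rule R.mat_funs_entry[OF R.mat_funs_mult[OF R.mat_funs_mult[OF path(4) R.mat_funs_const[OF X(1)]]
                R.mat_funs_transpose[OF path(4)]] ij])
        then show ?thesis using True by (simp add: q \<chi>_def \<zeta>_def)
      next
        case False
        have "(\<lambda>t. ((adj_inv (p t))\<^sup>T * Y * adj_inv (p t)) $$ (i, j)) \<in> rational_funs {0, 1}"
          by (rule R.mat_funs_entry[OF R.mat_funs_mult[OF R.mat_funs_mult[OF R.mat_funs_transpose[OF path(6)]
                R.mat_funs_const[OF Y(1)]] path(6)] ij])
        then show ?thesis
          by (rule rational_adj_inv_cong[OF g(1) h(1)]) (use False inv in \<open>simp add: q \<chi>_def \<zeta>_def p_def\<close>)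
      qed
    qed
    have "\<zeta> t \<in> orb z0" if "det (p t) \<noteq> 0" for t
      using inv(2)[OF that] by (auto simp: \<zeta>_def orb_def z0_eq)
    then show "\<exists>\<zeta> E. (\<forall>p\<in>eqs. (\<lambda>t. \<chi> p (\<zeta> t)) \<in> rational_funs {0, 1}) \<and> \<zeta> 0 = z \<and> \<zeta> 1 = z' \<and>
        E \<in> rational_funs {0, 1} \<and> E 0 \<noteq> 0 \<and> E 1 \<noteq> 0 \<and> (\<forall>t. E t \<noteq> 0 \<longrightarrow> \<zeta> t \<in> orb z0)"
      using rat path(1,2,5) GL_det[OF g(1)] GL_det[OF h(1)] g(2) h(2)
      by (intro exI[of _ \<zeta>] exI[of _ "\<lambda>t. det (p t)"]) (auto simp: \<zeta>_def)
  qed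
  moreover have "(A0, B0) \<in> points W" using A0(1) B0(1) by (simp add: W_def)
  ultimately show ?thesis by blast
qed

end

subsection \<open>Pairings\<close>

text \<open>Orthogonality of \<open>e\<close> and \<open>f\<close> keeps the two Gauss steps in
  \<open>normal_form\<close> apart: the first preserves \<open>f\<^sup>T B\<close>, and the second
  fixes \<open>e\<close>.\<close>

locale dual_frames =
  fixes R M N :: nat and e f :: "complex mat"
  assumes e: "e \<in> carrier_mat R M" and f: "f \<in> carrier_mat R N"
    and ee: "e\<^sup>T * e = 1\<^sub>m M" and ff: "f\<^sup>T * f = 1\<^sub>m N" and ef: "e\<^sup>T * f = 0\<^sub>m M N"
begin

lemmas dims = carrier_matD[OF e] carrier_matD[OF f]

lemma fe: "f\<^sup>T * e = 0\<^sub>m N M"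
proof -
  have "f\<^sup>T * e = (e\<^sup>T * f)\<^sup>T" by (simp add: mat_transpose_mult dims)
  then show ?thesis by (simp add: ef)
qed

text \<open>Pairs of a matrix and its inverse transpose, given by an equation so that no
  \<open>gl_inv\<close> enters the computations.\<close>

definition contragredient :: "(complex mat \<times> complex mat) set" where
  "contragredient = {(g, h). g \<in> carrier_mat R R \<and> h \<in> carrier_mat R R \<and> h\<^sup>T * g = 1\<^sub>m R}"

lemma contragredient_mult:
  assumes "(g, h) \<in> contragredient" "(g', h') \<in> contragredient"
  shows "(g * g', h * h') \<in> contragredient"
proof -
  have c: "g \<in> carrier_mat R R" "h \<in> carrier_mat R R" "g' \<in> carrier_mat R R" "h' \<in> carrier_mat R R"
    and eq: "h\<^sup>T * g = 1\<^sub>m R" "h'\<^sup>T * g' = 1\<^sub>m R" using assms by (auto simp: contragredient_def)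
  have "(h * h')\<^sup>T * (g * g') = h'\<^sup>T * ((h\<^sup>T * g) * g')"
    using c by (simp add: mat_ring)
  then show ?thesis using c by (simp add: contragredient_def eq)
qed

lemma contragredient_inverse:
  assumes "(g, h) \<in> contragredient"
  shows "(h\<^sup>T, g\<^sup>T) \<in> contragredient"
  using assms mat_mult_left_right_inverse[of "h\<^sup>T" R g] by (auto simp: contragredient_def)

text \<open>Two unipotent-by-Gauss steps bring a generic pair into a normal form depending only on \<open>A\<^sup>T B\<close>.\<close>

lemma normal_form:
  assumes A: "A \<in> carrier_mat R M" and B: "B \<in> carrier_mat R N"
    and nz: "det (e\<^sup>T * A) \<noteq> 0" "det (f\<^sup>T * B) \<noteq> 0"
  shows "\<exists>(g, h) \<in> contragredient. g * A = e \<and> h * B = e * (A\<^sup>T * B) + f"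
proof -
  note dAB = dims carrier_matD[OF A] carrier_matD[OF B]
  have cA: "e\<^sup>T * A \<in> carrier_mat M M" and cB: "f\<^sup>T * B \<in> carrier_mat N N" using e f A B by auto
  define C where "C = adj_inv (e\<^sup>T * A)"
  define D where "D = adj_inv (f\<^sup>T * B)"
  have C: "C \<in> carrier_mat M M" "C * (e\<^sup>T * A) = 1\<^sub>m M"
    using gl_inv[OF gl_inv_adj(1)[OF cA nz(1)]] gl_inv_adj(2)[OF cA nz(1)] by (simp_all add: C_def adj_inv_def)
  have D: "D \<in> carrier_mat N N" "D * (f\<^sup>T * B) = 1\<^sub>m N"
    using gl_inv[OF gl_inv_adj(1)[OF cB nz(2)]] gl_inv_adj(2)[OF cB nz(2)] by (simp_all add: D_def adj_inv_def)
  define E where "E = A - e"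
  have E: "E \<in> carrier_mat R M" using e by (simp add: E_def minus_carrier_mat)
  \<comment> \<open>\<open>g1\<close> sends \<open>A\<close> to \<open>e\<close>. It differs from
    the identity by a product with inner dimension \<open>M\<close>, so its inverse is again of this
    kind, namely \<open>1 + E e\<^sup>T\<close>, the transpose of \<open>h1\<close>.\<close>
  define g1 where "g1 = 1\<^sub>m R - E * (C * e\<^sup>T)"
  define h1 where "h1 = 1\<^sub>m R + e * E\<^sup>T"
  have g1: "g1 \<in> carrier_mat R R" using E C(1) e by (simp add: g1_def minus_carrier_mat)
  have h1: "h1 \<in> carrier_mat R R" using E e by (simp add: h1_def)
  note d1 = dAB carrier_matD[OF C(1)] carrier_matD[OF D(1)] carrier_matD[OF E] carrier_matD[OF g1] carrier_matD[OF h1]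
  have g1A: "g1 * A = e"
  proof -
    have "g1 * A = A - E * (C * (e\<^sup>T * A))" unfolding g1_def by (simp add: mat_ring d1)
    also have "\<dots> = e" unfolding C(2) using A e by (intro eq_matI) (auto simp: mat_ring d1 E_def)
    finally show ?thesis .
  qed
  have gh1: "(g1, h1) \<in> contragredient"
  proof -
    have eE: "e\<^sup>T * E = e\<^sup>T * A - 1\<^sub>m M" unfolding E_def by (simp add: mat_ring d1 ee)
    have "g1 * h1\<^sup>T = 1\<^sub>m R + E * e\<^sup>T - E * ((C + C * (e\<^sup>T * E)) * e\<^sup>T)"
      unfolding g1_def h1_def
      by (simp add: mat_ring d1) (intro eq_matI; simp add: d1 del: index_mult_mat(1))
    also have "C + C * (e\<^sup>T * E) = 1\<^sub>m M"
    proof -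
      have "C * (e\<^sup>T * E) = 1\<^sub>m M - C" unfolding eE using C by (simp add: mat_mult_minus mat_one_right d1)
      then show ?thesis using C(1) by (intro eq_matI) auto
    qed
    also have "1\<^sub>m R + E * e\<^sup>T - E * (1\<^sub>m M * e\<^sup>T) = 1\<^sub>m R"
      by (simp add: mat_one_left d1) (intro eq_matI; simp add: d1 del: index_mult_mat(1))
    finally have "h1\<^sup>T * g1 = 1\<^sub>m R" using mat_mult_left_right_inverse[OF g1, of "h1\<^sup>T"] h1 by simp
    then show ?thesis using g1 h1 by (simp add: contragredient_def)
  qed
  define X where "X = A\<^sup>T * B"
  have X: "X \<in> carrier_mat M N" using A B by (simp add: X_def)
  define B1 where "B1 = h1 * B"
  have B1: "B1 \<in> carrier_mat R N" using h1 B by (simp add: B1_def)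
  note d2 = d1 carrier_matD[OF X] carrier_matD[OF B1]
  have eB1: "e\<^sup>T * B1 = X"
  proof -
    have "e\<^sup>T * B1 = A\<^sup>T * ((g1\<^sup>T * h1) * B)" unfolding g1A[symmetric] B1_def by (simp add: mat_ring d2)
    also have "g1\<^sup>T * h1 = (h1\<^sup>T * g1)\<^sup>T" by (simp add: mat_ring d2)
    also have "h1\<^sup>T * g1 = 1\<^sub>m R" using gh1 by (simp add: contragredient_def)
    finally show ?thesis by (simp add: mat_one_left d2 X_def)
  qed
  have fB1: "f\<^sup>T * B1 = f\<^sup>T * B"
  proof -
    have "f\<^sup>T * B1 = f\<^sup>T * B + (f\<^sup>T * e) * (E\<^sup>T * B)" unfolding B1_def h1_def by (simp add: mat_ring d2)
    also have "(f\<^sup>T * e) * (E\<^sup>T * B) = 0\<^sub>m N N" unfolding fe using E B by (intro left_mult_zero_mat) auto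
    finally show ?thesis using cB by simp
  qed
  \<comment> \<open>The same recipe with the roles of \<open>g\<close> and \<open>h\<close>
    exchanged. The target keeps the value \<open>X\<close> of \<open>e\<^sup>T B1\<close>, so that
    \<open>e\<^sup>T F = 0\<close> and \<open>g2\<close> leaves \<open>e\<close> alone.\<close>
  define F where "F = B1 - (e * X + f)"
  have F: "F \<in> carrier_mat R N" using e f X by (simp add: F_def minus_carrier_mat)
  define h2 where "h2 = 1\<^sub>m R - F * (D * f\<^sup>T)"
  define g2 where "g2 = 1\<^sub>m R + f * F\<^sup>T"
  have h2: "h2 \<in> carrier_mat R R" using F D(1) f by (simp add: h2_def minus_carrier_mat)
  have g2: "g2 \<in> carrier_mat R R" using F f by (simp add: g2_def)
  note d3 = d2 carrier_matD[OF F] carrier_matD[OF g2] carrier_matD[OF h2]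
  have h2B: "h2 * B1 = e * X + f"
  proof -
    have "h2 * B1 = B1 - F * (D * (f\<^sup>T * B1))" unfolding h2_def by (simp add: mat_ring d3)
    also have "\<dots> = B1 - F" unfolding fB1 D(2) by (simp add: mat_one_right d3)
    also have "\<dots> = e * X + f" unfolding F_def using e f X B1
      by (intro eq_matI) (simp_all add: d3 del: index_mult_mat(1))
    finally show ?thesis .
  qed
  have gh2: "(g2, h2) \<in> contragredient"
  proof -
    have "f\<^sup>T * (e * X) = (f\<^sup>T * e) * X" by (simp add: mat_assoc d3)
    also have "\<dots> = 0\<^sub>m N N" unfolding fe using X by simp
    finally have fF: "f\<^sup>T * F = f\<^sup>T * B - 1\<^sub>m N"
      unfolding F_def using cB by (simp add: mat_ring d3 ff fB1)
    have g2T: "g2\<^sup>T = 1\<^sub>m R + F * f\<^sup>T" unfolding g2_def by (simp add: mat_ring d3)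
    have "h2 * g2\<^sup>T = 1\<^sub>m R + F * f\<^sup>T - F * ((D + D * (f\<^sup>T * F)) * f\<^sup>T)"
      unfolding g2T unfolding h2_def
      by (simp add: mat_ring d3) (intro eq_matI; simp add: d3 del: index_mult_mat(1))
    also have "D + D * (f\<^sup>T * F) = 1\<^sub>m N"
    proof -
      have "D * (f\<^sup>T * F) = 1\<^sub>m N - D" unfolding fF using D by (simp add: mat_mult_minus mat_one_right d3)
      then show ?thesis using D(1) by (intro eq_matI) auto
    qed
    also have "1\<^sub>m R + F * f\<^sup>T - F * (1\<^sub>m N * f\<^sup>T) = 1\<^sub>m R"
      by (simp add: mat_one_left d3) (intro eq_matI; simp add: d3 del: index_mult_mat(1))
    finally have "(h2 * g2\<^sup>T)\<^sup>T = 1\<^sub>m R" by simp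
    moreover have "(h2 * g2\<^sup>T)\<^sup>T = g2 * h2\<^sup>T" by (simp add: mat_ring d3)
    ultimately have "h2\<^sup>T * g2 = 1\<^sub>m R" using mat_mult_left_right_inverse[OF g2, of "h2\<^sup>T"] h2 by simp
    then show ?thesis using g2 h2 by (simp add: contragredient_def)
  qed
  have g2e: "g2 * e = e"
  proof -
    have "e\<^sup>T * (e * X) = X" using X by (simp add: ee mat_one_left flip: mat_assoc add: d3)
    then have "e\<^sup>T * F = 0\<^sub>m M N" unfolding F_def using X
      by (simp add: mat_mult_minus mat_mult_add d3 ef eB1)
    then have "(e\<^sup>T * F)\<^sup>T = 0\<^sub>m N M" by simp
    then have "F\<^sup>T * e = 0\<^sub>m N M" by (simp add: mat_ring d3)
    then show ?thesis unfolding g2_def using e f by (simp add: mat_ring d3)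
  qed
  have "g2 * g1 * A = e" using g1A g2e by (simp add: mat_assoc d3)
  moreover have "h2 * h1 * B = e * (A\<^sup>T * B) + f" using h2B by (simp add: mat_assoc d3 B1_def X_def)
  ultimately show ?thesis using contragredient_mult[OF gh2 gh1] by blast
qed

lemma transitive:
  assumes A: "A \<in> carrier_mat R M" and B: "B \<in> carrier_mat R N"
    and A': "A' \<in> carrier_mat R M" and B': "B' \<in> carrier_mat R N"
    and eq: "A\<^sup>T * B = A'\<^sup>T * B'"
    and nz: "det (e\<^sup>T * A) \<noteq> 0" "det (f\<^sup>T * B) \<noteq> 0" "det (e\<^sup>T * A') \<noteq> 0" "det (f\<^sup>T * B') \<noteq> 0"
  shows "\<exists>g\<in>carrier (GL R). g * A = A' \<and> (gl_inv g)\<^sup>T * B = B'"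
proof -
  obtain g h where gh: "(g, h) \<in> contragredient" "g * A = e" "h * B = e * (A\<^sup>T * B) + f"
    using normal_form[OF A B nz(1,2)] by blast
  obtain k l where kl: "(k, l) \<in> contragredient" "k * A' = e" "l * B' = e * (A'\<^sup>T * B') + f"
    using normal_form[OF A' B' nz(3,4)] by blast
  note c = contragredient_mult[OF contragredient_inverse[OF kl(1)] gh(1)]
  have d: "g \<in> carrier_mat R R" "h \<in> carrier_mat R R" "k \<in> carrier_mat R R" "l \<in> carrier_mat R R"
    "l\<^sup>T * k = 1\<^sub>m R"
    using gh(1) kl(1) by (auto simp: contragredient_def)
  have kl': "k\<^sup>T * l = 1\<^sub>m R"
  proof -
    have "k\<^sup>T * l = (l\<^sup>T * k)\<^sup>T" using d(3,4) by (simp add: mat_transpose_mult)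
    then show ?thesis by (simp add: d(5))
  qed
  note ds = carrier_matD[OF d(1)] carrier_matD[OF d(2)] carrier_matD[OF d(3)] carrier_matD[OF d(4)]
    carrier_matD[OF A] carrier_matD[OF B] carrier_matD[OF A'] carrier_matD[OF B']
  have "l\<^sup>T * g * A = (l\<^sup>T * k) * A'" using gh(2) kl(2) by (simp add: mat_assoc ds)
  then have 1: "l\<^sup>T * g * A = A'" by (simp add: d(5) mat_one_left ds)
  have "k\<^sup>T * h * B = (k\<^sup>T * l) * B'" using gh(3) kl(3) eq by (simp add: mat_assoc ds)
  then have 2: "k\<^sup>T * h * B = B'" by (simp add: kl' mat_one_left ds)
  have 3: "l\<^sup>T * g \<in> carrier_mat R R" "(k\<^sup>T * h)\<^sup>T \<in> carrier_mat R R" "(k\<^sup>T * h)\<^sup>T * (l\<^sup>T * g) = 1\<^sub>m R"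
    using c d by (auto simp: contragredient_def)
  show ?thesis
    using gl_inv_eq[OF 3] 1 2 by (intro bexI[of _ "l\<^sup>T * g"]) simp_all
qed

lemma base_point:
  assumes X: "X \<in> carrier_mat M N"
  shows "e * X + f \<in> carrier_mat R N" "e\<^sup>T * (e * X + f) = X" "f\<^sup>T * (e * X + f) = 1\<^sub>m N"
proof -
  show "e * X + f \<in> carrier_mat R N" using f by simp
  note dX = dims carrier_matD[OF X]
  have "e\<^sup>T * (e * X) = X" "f\<^sup>T * (e * X) = 0\<^sub>m N N"
    using X by (simp_all add: ee fe mat_one_left flip: mat_assoc add: dX)
  then show "e\<^sup>T * (e * X + f) = X" "f\<^sup>T * (e * X + f) = 1\<^sub>m N"
    using X by (simp_all add: mat_mult_add dX ef ff)
qed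

text \<open>
  The chart only asks for \<open>e\<^sup>T A\<close> to be invertible; \<open>B\<close> is deformed within the fiber to a matrix for which
  \<open>f\<^sup>T B\<close> is invertible, too.
\<close>

lemma deformation:
  assumes A: "A \<in> carrier_mat R M" and B: "B \<in> carrier_mat R N" and nz: "det (e\<^sup>T * A) \<noteq> 0"
  shows "\<exists>B'\<in>carrier_mat R N. f\<^sup>T * B' = 1\<^sub>m N \<and> A\<^sup>T * B' = A\<^sup>T * B"
proof -
  have cA: "e\<^sup>T * A \<in> carrier_mat M M" using e A by auto
  define C where "C = adj_inv (e\<^sup>T * A)"
  have C: "C \<in> carrier_mat M M" "C * (e\<^sup>T * A) = 1\<^sub>m M"
    using gl_inv[OF gl_inv_adj(1)[OF cA nz]] gl_inv_adj(2)[OF cA nz] by (simp_all add: C_def adj_inv_def)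
  note d = dims carrier_matD[OF A] carrier_matD[OF B] carrier_matD[OF C(1)]
  define Y where "Y = A\<^sup>T * B - A\<^sup>T * f"
  have Y: "Y \<in> carrier_mat M N" using A B f by (simp add: Y_def minus_carrier_mat)
  have AC: "A\<^sup>T * (e * C\<^sup>T) = 1\<^sub>m M"
  proof -
    have "A\<^sup>T * (e * C\<^sup>T) = (C * (e\<^sup>T * A))\<^sup>T" by (simp add: mat_ring d)
    then show ?thesis by (simp add: C(2))
  qed
  \<comment> \<open>The columns of \<open>e\<close> are invisible to \<open>f\<^sup>T\<close>, while
    \<open>A\<^sup>T e\<close> is invertible; a multiple of \<open>e\<close> therefore adjusts
    \<open>A\<^sup>T B'\<close> freely.\<close>
  define B' where "B' = f + e * (C\<^sup>T * Y)"
  have "f\<^sup>T * (e * (C\<^sup>T * Y)) = (f\<^sup>T * e) * (C\<^sup>T * Y)" using Y by (simp add: mat_assoc d)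
  also have "\<dots> = 0\<^sub>m N N" unfolding fe using C(1) Y by (intro left_mult_zero_mat) auto
  finally have 1: "f\<^sup>T * B' = 1\<^sub>m N" unfolding B'_def using Y by (simp add: mat_mult_add d ff)
  have "A\<^sup>T * (e * (C\<^sup>T * Y)) = (A\<^sup>T * (e * C\<^sup>T)) * Y" using Y by (simp add: mat_assoc d)
  then have "A\<^sup>T * (e * (C\<^sup>T * Y)) = Y" unfolding AC using Y by simp
  then have "A\<^sup>T * B' = A\<^sup>T * f + Y" unfolding B'_def using Y by (simp add: mat_mult_add d)
  also have "\<dots> = A\<^sup>T * B" unfolding Y_def using A B f
    by (intro eq_matI) (simp_all add: d del: index_mult_mat(1))
  finally have "A\<^sup>T * B' = A\<^sup>T * B" .
  moreover have "B' \<in> carrier_mat R N" using e f C(1) Y by (simp add: B'_def)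
  ultimately show ?thesis using 1 by blast
qed

end

lemma mat_select_mult:
  assumes "A \<in> carrier_mat R c" "\<And>i. i < M \<Longrightarrow> \<phi> i < R"
  shows "(mat R M (\<lambda>(k, i). if k = \<phi> i then 1 else 0 :: complex))\<^sup>T * A = mat M c (\<lambda>(i, j). A $$ (\<phi> i, j))"
proof (rule eq_matI)
  fix i j assume "i < dim_row (mat M c (\<lambda>(i, j). A $$ (\<phi> i, j)))" "j < dim_col (mat M c (\<lambda>(i, j). A $$ (\<phi> i, j)))"
  then have ij: "i < M" "j < c" by auto
  have "((mat R M (\<lambda>(k, i). if k = \<phi> i then 1 else 0))\<^sup>T * A) $$ (i, j) = A $$ (\<phi> i, j)"
    using assms(1) assms(2)[OF ij(1)] ij
    by (simp add: scalar_prod_def if_distrib[of "\<lambda>x. x * _"] cong: if_cong)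
  then show "((mat R M (\<lambda>(k, i). if k = \<phi> i then 1 else 0))\<^sup>T * A) $$ (i, j) =
      mat M c (\<lambda>(i, j). A $$ (\<phi> i, j)) $$ (i, j)"
    using ij by simp
qed (use assms(1) in auto)

text \<open>The variables range over all indices, so the entries are continued by zero to make every
  coordinate a polynomial.\<close>

definition entry0 :: "nat \<Rightarrow> nat \<Rightarrow> complex mat \<Rightarrow> nat \<Rightarrow> nat \<Rightarrow> complex" where
  "entry0 a b A k i = (if k < a \<and> i < b then A $$ (k, i) else 0)"

lemma entry0_polynomial: "(\<lambda>A. entry0 a b A k i) \<in> polynomial_funs (mat_coords a b)"
proof (cases "k < a \<and> i < b")
  case True
  then show ?thesis using polynomial_entry[of k a i b] by (simp add: entry0_def)
next
  case False
  then have "(\<lambda>A. entry0 a b A k i) = (\<lambda>_. 0)" by (auto simp: entry0_def)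
  then show ?thesis by (simp add: polynomial_funs.const)
qed

lemma mat_entry0: "A \<in> carrier_mat a b \<Longrightarrow> mat a b (\<lambda>(k, i). entry0 a b A k i) = A"
  by (intro eq_matI) (auto simp: entry0_def)

section \<open>The two pairings of the unitary dual pair\<close>

locale pairing_model =
  fixes p q m n :: nat
  assumes mn_pos: "0 < m" "0 < n" and mn_le: "m + n \<le> p" "m + n \<le> q"
begin

text \<open>\<open>True\<close> is the pairing of \<open>A\<close> with \<open>B\<close>,
  \<open>False\<close> that of \<open>D\<close> with \<open>C\<close>. In the second one
  \<open>D\<close> is block 0, so \<open>m\<close> and \<open>n\<close> change places.\<close>

sublocale pairing_family "\<lambda>s. if s then m else n" "\<lambda>s. if s then n else m" "\<lambda>s. if s then p else q"
  by standard (use mn_pos mn_le in auto)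

text \<open>\<open>e1\<close> and \<open>e2\<close> select the rows of the minors of
  \<open>pairing_family\<close>, \<open>f1\<close> and \<open>f2\<close> the rows above
  them.\<close>

definition e1 :: "complex mat" where "e1 = mat p m (\<lambda>(k, i). if k = n + i then 1 else 0)"
definition f1 :: "complex mat" where "f1 = mat p n (\<lambda>(k, i). if k = i then 1 else 0)"
definition e2 :: "complex mat" where "e2 = mat q n (\<lambda>(k, i). if k = m + i then 1 else 0)"
definition f2 :: "complex mat" where "f2 = mat q m (\<lambda>(k, i). if k = i then 1 else 0)"

lemma frame_carriers: "e1 \<in> carrier_mat p m" "f1 \<in> carrier_mat p n" "e2 \<in> carrier_mat q n" "f2 \<in> carrier_mat q m"
  by (simp_all add: e1_def f1_def e2_def f2_def)

lemma e1_mult: "A \<in> carrier_mat p c \<Longrightarrow> e1\<^sup>T * A = mat m c (\<lambda>(i, j). A $$ (n + i, j))"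
  unfolding e1_def by (rule mat_select_mult) (use mn_le in auto)

lemma f1_mult: "A \<in> carrier_mat p c \<Longrightarrow> f1\<^sup>T * A = mat n c (\<lambda>(i, j). A $$ (i, j))"
  unfolding f1_def by (rule mat_select_mult) (use mn_le in auto)

lemma e2_mult: "A \<in> carrier_mat q c \<Longrightarrow> e2\<^sup>T * A = mat n c (\<lambda>(i, j). A $$ (m + i, j))"
  unfolding e2_def by (rule mat_select_mult) (use mn_le in auto)

lemma f2_mult: "A \<in> carrier_mat q c \<Longrightarrow> f2\<^sup>T * A = mat m c (\<lambda>(i, j). A $$ (i, j))"
  unfolding f2_def by (rule mat_select_mult) (use mn_le in auto)

sublocale F1: dual_frames p m n e1 f1
proof
  show "e1\<^sup>T * e1 = 1\<^sub>m m" "e1\<^sup>T * f1 = 0\<^sub>m m n"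
    unfolding e1_mult[OF frame_carriers(1)] e1_mult[OF frame_carriers(2)]
    using mn_le by (auto simp: e1_def f1_def intro!: eq_matI)
  show "f1\<^sup>T * f1 = 1\<^sub>m n"
    unfolding f1_mult[OF frame_carriers(2)] using mn_le by (auto simp: f1_def intro!: eq_matI)
qed (rule frame_carriers)+

sublocale F2: dual_frames q n m e2 f2
proof
  show "e2\<^sup>T * e2 = 1\<^sub>m n" "e2\<^sup>T * f2 = 0\<^sub>m n m"
    unfolding e2_mult[OF frame_carriers(3)] e2_mult[OF frame_carriers(4)]
    using mn_le by (auto simp: e2_def f2_def intro!: eq_matI)
  show "f2\<^sup>T * f2 = 1\<^sub>m m"
    unfolding f2_mult[OF frame_carriers(4)] using mn_le by (auto simp: f2_def intro!: eq_matI)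
qed (rule frame_carriers)+

definition W :: "((complex mat \<times> complex mat) \<times> (complex mat \<times> complex mat)) variety" where
  "W = (mat_space p m \<times>\<^sub>V mat_space p n) \<times>\<^sub>V (mat_space q m \<times>\<^sub>V mat_space q n)"

definition Sv :: "(complex mat \<times> complex mat) variety" where
  "Sv = mat_space m n \<times>\<^sub>V mat_space n m"

definition \<psi> :: "(complex mat \<times> complex mat) \<times> (complex mat \<times> complex mat) \<Rightarrow> complex mat \<times> complex mat" where
  "\<psi> = (\<lambda>((A, B), (C, D)). (A\<^sup>T * B, D\<^sup>T * C))"

definition pt :: "(var \<Rightarrow> complex) \<Rightarrow> (complex mat \<times> complex mat) \<times> (complex mat \<times> complex mat)" where
  "pt a = ((mat p m (\<lambda>(k, i). a (True, 0, k, i)), mat p n (\<lambda>(k, i). a (True, 1, k, i))),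
    (mat q m (\<lambda>(k, i). a (False, 1, k, i)), mat q n (\<lambda>(k, i). a (False, 0, k, i))))"

definition \<xi> :: "(complex mat \<times> complex mat) \<times> (complex mat \<times> complex mat) \<Rightarrow> var \<Rightarrow> complex" where
  "\<xi> v = (\<lambda>(s, c, k, i).
    if s then (if c = 0 then entry0 p m (fst (fst v)) k i else entry0 p n (snd (fst v)) k i)
    else (if c = 0 then entry0 q n (snd (snd v)) k i else entry0 q m (fst (snd v)) k i))"

definition \<chi> :: "bool \<times> nat \<times> nat \<Rightarrow> complex mat \<times> complex mat \<Rightarrow> complex" where
  "\<chi> = (\<lambda>(s, i, j) z. if s then fst z $$ (i, j) else snd z $$ (i, j))"

definition \<Delta> :: "(complex mat \<times> complex mat) \<times> (complex mat \<times> complex mat) \<Rightarrow> complex" where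
  "\<Delta> v = det (e1\<^sup>T * fst (fst v)) * det (e2\<^sup>T * snd (snd v))"

definition orb :: "complex mat \<times> complex mat \<Rightarrow> (complex mat \<times> complex mat) set" where
  "orb z = {(h1 * fst z * gl_inv h2, h2 * snd z * gl_inv h1) | h1 h2. h1 \<in> carrier (GL m) \<and> h2 \<in> carrier (GL n)}"

definition act :: "complex mat \<Rightarrow> complex mat \<Rightarrow> complex mat \<Rightarrow> complex mat \<Rightarrow>
    (complex mat \<times> complex mat) \<times> (complex mat \<times> complex mat) \<Rightarrow>
    (complex mat \<times> complex mat) \<times> (complex mat \<times> complex mat)" where
  "act g1 g2 h1 h2 = (\<lambda>((A, B), (C, D)).
       ((g1 * A * h1\<^sup>T, (gl_inv g1)\<^sup>T * B * gl_inv h2),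
        ((gl_inv g2)\<^sup>T * C * gl_inv h1, g2 * D * h2\<^sup>T)))"

definition \<Omega> :: "(complex mat \<times> complex mat) \<times> (complex mat \<times> complex mat) \<Rightarrow>
    ((complex mat \<times> complex mat) \<times> (complex mat \<times> complex mat)) set" where
  "\<Omega> v = {act g1 g2 h1 h2 v | g1 g2 h1 h2. g1 \<in> carrier (GL p) \<and> g2 \<in> carrier (GL q) \<and>
    h1 \<in> carrier (GL m) \<and> h2 \<in> carrier (GL n)}"

lemma corrected_model: "corrected_family w eqs lead_eq (lead_U True + lead_U False)
    (\<lambda>p a. \<chi> p (\<psi> (pt a))) (\<lambda>a. \<Delta> (pt a)) corr"
proof -
  have "U True a = e1\<^sup>T * fst (fst (pt a))" "U False a = e2\<^sup>T * snd (snd (pt a))" for a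
  proof -
    have "fst (fst (pt a)) \<in> carrier_mat p m" "snd (snd (pt a)) \<in> carrier_mat q n" by (simp_all add: pt_def)
    note * = e1_mult[OF this(1)] e2_mult[OF this(2)]
    show "U True a = e1\<^sup>T * fst (fst (pt a))" "U False a = e2\<^sup>T * snd (snd (pt a))"
      unfolding * using mn_le by (auto simp: pt_def U_def intro!: eq_matI)
  qed
  then have "(\<lambda>a. \<Delta> (pt a)) = dU" by (simp add: fun_eq_iff \<Delta>_def dU_def)
  moreover have "(\<lambda>a. \<chi> p (\<psi> (pt a))) = form p" if "p \<in> eqs" for p
  proof
    fix a
    obtain s i j where p: "p = (s, i, j)" by (cases p)
    show "\<chi> p (\<psi> (pt a)) = form p a"
      using that
      by (cases s) (auto simp: p pt_def \<psi>_def \<chi>_def form_def eqs_def scalar_prod_def atLeast0LessThan intro!: sum.cong)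
  qed
  ultimately show ?thesis by (auto intro: corrected_family_cong[OF corrected])
qed

lemma block_polynomials:
  "f \<in> polynomial_funs (mat_coords p m) \<Longrightarrow> (\<lambda>v. f (fst (fst v))) \<in> regular_funs W"
  "f \<in> polynomial_funs (mat_coords p n) \<Longrightarrow> (\<lambda>v. f (snd (fst v))) \<in> regular_funs W"
  "f \<in> polynomial_funs (mat_coords q m) \<Longrightarrow> (\<lambda>v. f (fst (snd v))) \<in> regular_funs W"
  "f \<in> polynomial_funs (mat_coords q n) \<Longrightarrow> (\<lambda>v. f (snd (snd v))) \<in> regular_funs W"
  unfolding W_def
  by (rule polynomial_funs_regular, rule polynomial_fst[OF polynomial_fst] polynomial_fst[OF polynomial_snd]
      polynomial_snd[OF polynomial_fst] polynomial_snd[OF polynomial_snd], simp)+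

sublocale fm: fiber_model W Sv \<psi> pt \<xi> \<chi> \<Delta> w eqs lead_eq "lead_U True + lead_U False" corr
proof (rule fiber_model.intro)
  interpret V: function_algebra "points W" "regular_funs W" by (rule function_algebra_regular_funs)
  show "corrected_family w eqs lead_eq (lead_U True + lead_U False)
    (\<lambda>p a. \<chi> p (\<psi> (pt a))) (\<lambda>a. \<Delta> (pt a)) corr" by (rule corrected_model)
  show "pt a \<in> points W" for a by (simp add: pt_def W_def)
  show "pt (\<xi> A) = A" if "A \<in> points W" for A
    using that by (auto simp: pt_def \<xi>_def W_def mat_entry0)
  show "(\<lambda>A. \<xi> A x) \<in> regular_funs W" for x
  proof -
    obtain s c k i where x: "x = (s, c, k, i)" by (metis surj_pair)
    show ?thesis
      using block_polynomials(1)[OF entry0_polynomial, of k i] block_polynomials(2)[OF entry0_polynomial, of k i]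
        block_polynomials(3)[OF entry0_polynomial, of k i] block_polynomials(4)[OF entry0_polynomial, of k i]
      by (cases s; cases "c = 0") (simp_all add: x \<xi>_def)
  qed
  show "(\<lambda>a. c (pt a)) \<in> assignment_polys" if "c \<in> coords W" for c
    using that by (auto simp: W_def coords_prod_variety mat_coords_def pt_def intro!: polynomial_funs.coord)
  show "\<psi> A \<in> points Sv" if "A \<in> points W" for A
    using that by (auto simp: W_def \<psi>_def Sv_def)
  show "(\<lambda>A. d (\<psi> A)) \<in> regular_funs W" if "d \<in> coords Sv" for d
  proof -
    have A: "(\<lambda>v. fst (fst v)) \<in> V.mat_funs p m" and B: "(\<lambda>v. snd (fst v)) \<in> V.mat_funs p n"
      and C: "(\<lambda>v. fst (snd v)) \<in> V.mat_funs q m" and D: "(\<lambda>v. snd (snd v)) \<in> V.mat_funs q n"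
      by (intro V.mat_funsI block_polynomials polynomial_entry; auto simp: W_def)+
    from that consider i j where "i < m" "j < n" "d = (\<lambda>z. fst z $$ (i, j))"
      | i j where "i < n" "j < m" "d = (\<lambda>z. snd z $$ (i, j))"
      by (auto simp: Sv_def coords_prod_variety mat_coords_def)
    then show ?thesis
    proof cases
      case 1
      show ?thesis
        by (rule V.cong[OF V.mat_funs_entry[OF V.mat_funs_mult[OF V.mat_funs_transpose[OF A] B] 1(1,2)]])
          (simp add: 1(3) \<psi>_def split_beta)
    next
      case 2
      show ?thesis
        by (rule V.cong[OF V.mat_funs_entry[OF V.mat_funs_mult[OF V.mat_funs_transpose[OF D] C] 2(1,2)]])
          (simp add: 2(3) \<psi>_def split_beta)
    qed
  qed
  show "\<chi> p \<in> coords Sv" if p: "p \<in> eqs" for p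
  proof -
    obtain s i j where ps: "p = (s, i, j)" by (cases p)
    have "(\<lambda>A. A $$ (i, j)) \<in> mat_coords (if s then m else n) (if s then n else m)"
      unfolding mat_coords_def
      by (rule CollectI, intro exI[of _ i] exI[of _ j]) (use p in \<open>simp add: eqs_def ps\<close>)
    then show ?thesis by (cases s) (auto simp: ps \<chi>_def Sv_def coords_prod_variety)
  qed
  show "z = z'" if z: "z \<in> points Sv" "z' \<in> points Sv" and eq: "\<And>p. p \<in> eqs \<Longrightarrow> \<chi> p z = \<chi> p z'" for z z'
  proof -
    obtain X Y X' Y' where zz: "z = (X, Y)" "z' = (X', Y')" by (metis surj_pair)
    have "X = X'" using z eq[of "(True, _, _)"] by (intro eq_matI) (auto simp: zz Sv_def \<chi>_def eqs_def)
    moreover have "Y = Y'" using z eq[of "(False, _, _)"] by (intro eq_matI) (auto simp: zz Sv_def \<chi>_def eqs_def)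
    ultimately show ?thesis by (simp add: zz)
  qed
qed

text \<open>In contrast to the forms, the chart part need not lie in \<open>\<Omega>\<close>:
  conjugacy also asks for invertible \<open>f1\<^sup>T B\<close> and \<open>f2\<^sup>T C\<close>,
  which \<open>\<Delta>\<close> does not ensure. Density is therefore proved by deforming
  \<open>B\<close> and \<open>C\<close> inside the fiber.\<close>

lemma pairing_fiber:
  assumes z0: "z0 \<in> points Sv"
  shows "\<exists>v\<in>points W. reduced_irreducible_closed_subvariety W (fiber_ideal W \<psi> Sv (zariski Sv closure_of orb z0)) \<and>
    zero_locus W (fiber_ideal W \<psi> Sv (zariski Sv closure_of orb z0)) = zariski W closure_of \<Omega> v"
proof -
  obtain X Y where z0_eq: "z0 = (X, Y)" by (cases z0)
  have X: "X \<in> carrier_mat m n" and Y: "Y \<in> carrier_mat n m" using z0 by (auto simp: z0_eq Sv_def)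
  define B0 where "B0 = e1 * X + f1"
  define C0 where "C0 = e2 * Y + f2"
  define v0 where "v0 = ((e1, B0), (C0, e2))"
  note B0 = F1.base_point[OF X, folded B0_def]
  note C0 = F2.base_point[OF Y, folded C0_def]
  have act: "act g1 g2 h1 h2 v0 = ((g1 * (e1 * h1\<^sup>T), (gl_inv g1)\<^sup>T * (B0 * gl_inv h2)),
      ((gl_inv g2)\<^sup>T * (C0 * gl_inv h1), g2 * (e2 * h2\<^sup>T)))"
    if "g1 \<in> carrier (GL p)" "g2 \<in> carrier (GL q)" "h1 \<in> carrier (GL m)" "h2 \<in> carrier (GL n)" for g1 g2 h1 h2
    using GL_carrier_mat[OF that(1)] GL_carrier_mat[OF that(2)] GL_carrier_mat[OF that(3)] GL_carrier_mat[OF that(4)]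
      gl_inv(1)[OF that(1)] gl_inv(1)[OF that(2)] gl_inv(1)[OF that(3)] gl_inv(1)[OF that(4)]
      frame_carriers B0(1) C0(1)
    by (simp add: act_def v0_def mat_assoc)
  have carr: "e1 * h1\<^sup>T \<in> carrier_mat p m" "B0 * gl_inv h2 \<in> carrier_mat p n"
      "C0 * gl_inv h1 \<in> carrier_mat q m" "e2 * h2\<^sup>T \<in> carrier_mat q n"
    if "h1 \<in> carrier (GL m)" "h2 \<in> carrier (GL n)" for h1 h2
    using GL_carrier_mat[OF that(1)] GL_carrier_mat[OF that(2)] gl_inv(1)[OF that(1)] gl_inv(1)[OF that(2)]
      frame_carriers B0(1) C0(1) by (auto intro!: mult_carrier_mat)
  have base: "(e1 * h1\<^sup>T)\<^sup>T * (B0 * gl_inv h2) = h1 * X * gl_inv h2"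
      "(e2 * h2\<^sup>T)\<^sup>T * (C0 * gl_inv h1) = h2 * Y * gl_inv h1"
      "e1\<^sup>T * (e1 * h1\<^sup>T) = h1\<^sup>T" "f1\<^sup>T * (B0 * gl_inv h2) = gl_inv h2"
      "e2\<^sup>T * (e2 * h2\<^sup>T) = h2\<^sup>T" "f2\<^sup>T * (C0 * gl_inv h1) = gl_inv h1"
    if "h1 \<in> carrier (GL m)" "h2 \<in> carrier (GL n)" for h1 h2
  proof -
    note c = GL_carrier_mat[OF that(1)] GL_carrier_mat[OF that(2)] gl_inv(1)[OF that(1)] gl_inv(1)[OF that(2)]
    note d = carrier_matD[OF c(1)] carrier_matD[OF c(2)] carrier_matD[OF c(3)] carrier_matD[OF c(4)]
      carrier_matD[OF B0(1)] carrier_matD[OF C0(1)] carrier_matD[OF X] carrier_matD[OF Y] F1.dims F2.dims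
    have "(e1 * h1\<^sup>T)\<^sup>T * (B0 * gl_inv h2) = h1 * (e1\<^sup>T * B0) * gl_inv h2" by (simp add: mat_ring d)
    then show "(e1 * h1\<^sup>T)\<^sup>T * (B0 * gl_inv h2) = h1 * X * gl_inv h2" by (simp add: B0(2))
    have "(e2 * h2\<^sup>T)\<^sup>T * (C0 * gl_inv h1) = h2 * (e2\<^sup>T * C0) * gl_inv h1" by (simp add: mat_ring d)
    then show "(e2 * h2\<^sup>T)\<^sup>T * (C0 * gl_inv h1) = h2 * Y * gl_inv h1" by (simp add: C0(2))
    have "e1\<^sup>T * (e1 * h1\<^sup>T) = (e1\<^sup>T * e1) * h1\<^sup>T" by (simp add: mat_assoc d)
    then show "e1\<^sup>T * (e1 * h1\<^sup>T) = h1\<^sup>T" by (simp add: F1.ee mat_one_left d)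
    have "e2\<^sup>T * (e2 * h2\<^sup>T) = (e2\<^sup>T * e2) * h2\<^sup>T" by (simp add: mat_assoc d)
    then show "e2\<^sup>T * (e2 * h2\<^sup>T) = h2\<^sup>T" by (simp add: F2.ee mat_one_left d)
    have "f1\<^sup>T * (B0 * gl_inv h2) = (f1\<^sup>T * B0) * gl_inv h2" by (simp add: mat_assoc d)
    then show "f1\<^sup>T * (B0 * gl_inv h2) = gl_inv h2" by (simp add: B0(3) mat_one_left d)
    have "f2\<^sup>T * (C0 * gl_inv h1) = (f2\<^sup>T * C0) * gl_inv h1" by (simp add: mat_assoc d)
    then show "f2\<^sup>T * (C0 * gl_inv h1) = gl_inv h1" by (simp add: C0(3) mat_one_left d)
  qed
  have det: "det (h\<^sup>T) \<noteq> 0" "det (gl_inv h) \<noteq> 0" if "h \<in> carrier (GL N)" for h N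
    using det_transpose[OF GL_carrier_mat[OF that]] GL_det[OF that]
      det_mult[OF gl_inv(1)[OF that] GL_carrier_mat[OF that]] gl_inv(2)[OF that] by auto
  have contra: "(g * A)\<^sup>T * ((gl_inv g)\<^sup>T * B) = A\<^sup>T * B" "((gl_inv g)\<^sup>T * B)\<^sup>T * (g * A) = B\<^sup>T * A"
    if "g \<in> carrier (GL N)" "A \<in> carrier_mat N a" "B \<in> carrier_mat N b" for g A B N a b
  proof -
    note c = GL_carrier_mat[OF that(1)] gl_inv(1)[OF that(1)]
    note d = carrier_matD[OF c(1)] carrier_matD[OF c(2)] carrier_matD[OF that(2)] carrier_matD[OF that(3)]
    have "g\<^sup>T * (gl_inv g)\<^sup>T = (gl_inv g * g)\<^sup>T" by (simp add: mat_ring d)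
    then have 1: "g\<^sup>T * (gl_inv g)\<^sup>T = 1\<^sub>m N" by (simp add: gl_inv(2)[OF that(1)])
    have "(g * A)\<^sup>T * ((gl_inv g)\<^sup>T * B) = A\<^sup>T * ((g\<^sup>T * (gl_inv g)\<^sup>T) * B)" by (simp add: mat_ring d)
    then show "(g * A)\<^sup>T * ((gl_inv g)\<^sup>T * B) = A\<^sup>T * B" by (simp add: 1 mat_one_left d)
    have "((gl_inv g)\<^sup>T * B)\<^sup>T * (g * A) = B\<^sup>T * ((gl_inv g * g) * A)" by (simp add: mat_ring d)
    then show "((gl_inv g)\<^sup>T * B)\<^sup>T * (g * A) = B\<^sup>T * A" by (simp add: gl_inv(2)[OF that(1)] mat_one_left d)
  qed
  have one_GL: "1\<^sub>m N \<in> carrier (GL N)" for N by (rule gl_inv_eq(1)[of _ _ "1\<^sub>m N"]) auto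
  have chart: "((A, B), (C, D)) \<in> \<Omega> v0"
    if A: "A \<in> carrier_mat p m" and B: "B \<in> carrier_mat p n" and C: "C \<in> carrier_mat q m" and D: "D \<in> carrier_mat q n"
      and orb: "(A\<^sup>T * B, D\<^sup>T * C) \<in> orb z0"
      and nz: "det (e1\<^sup>T * A) \<noteq> 0" "det (f1\<^sup>T * B) \<noteq> 0" "det (e2\<^sup>T * D) \<noteq> 0" "det (f2\<^sup>T * C) \<noteq> 0"
    for A B C D
  proof -
    obtain h1 h2 where h: "h1 \<in> carrier (GL m)" "h2 \<in> carrier (GL n)"
      "A\<^sup>T * B = h1 * X * gl_inv h2" "D\<^sup>T * C = h2 * Y * gl_inv h1"
      using orb by (auto simp: orb_def z0_eq)
    note ca = carr[OF h(1,2)] and ba = base[OF h(1,2)]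
    obtain g1 where g1: "g1 \<in> carrier (GL p)" "g1 * (e1 * h1\<^sup>T) = A" "(gl_inv g1)\<^sup>T * (B0 * gl_inv h2) = B"
      using F1.transitive[OF ca(1,2) A B] ba h(3) det[OF h(1)] det[OF h(2)] nz by auto
    obtain g2 where g2: "g2 \<in> carrier (GL q)" "g2 * (e2 * h2\<^sup>T) = D" "(gl_inv g2)\<^sup>T * (C0 * gl_inv h1) = C"
      using F2.transitive[OF ca(4,3) D C] ba h(4) det[OF h(1)] det[OF h(2)] nz by auto
    have "((A, B), (C, D)) = act g1 g2 h1 h2 v0"
      unfolding act[OF g1(1) g2(1) h(1,2)] using g1(2,3) g2(2,3) by simp
    then show ?thesis unfolding \<Omega>_def using g1(1) g2(1) h(1,2) by blast
  qed
  have "reduced_irreducible_closed_subvariety W (fiber_ideal W \<psi> Sv (zariski Sv closure_of orb z0)) \<and>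
    zero_locus W (fiber_ideal W \<psi> Sv (zariski Sv closure_of orb z0)) = zariski W closure_of \<Omega> v0"
  proof (rule fm.fiber_irreducible)
    show "\<Omega> v0 \<subseteq> points W"
    proof
      fix y assume "y \<in> \<Omega> v0"
      then obtain g1 g2 h1 h2 where *: "g1 \<in> carrier (GL p)" "g2 \<in> carrier (GL q)" "h1 \<in> carrier (GL m)"
        "h2 \<in> carrier (GL n)" "y = act g1 g2 h1 h2 v0" by (auto simp: \<Omega>_def)
      show "y \<in> points W"
        unfolding *(5) act[OF *(1-4)] using carr[OF *(3,4)] GL_carrier_mat[OF *(1)] GL_carrier_mat[OF *(2)]
          gl_inv(1)[OF *(1)] gl_inv(1)[OF *(2)] by (auto simp: W_def intro!: mult_carrier_mat)
    qed
    show "\<Omega> v0 \<noteq> {}" unfolding \<Omega>_def using one_GL by blast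
    show "\<psi> ` \<Omega> v0 \<subseteq> orb z0"
    proof
      fix y assume "y \<in> \<psi> ` \<Omega> v0"
      then obtain g1 g2 h1 h2 where *: "g1 \<in> carrier (GL p)" "g2 \<in> carrier (GL q)" "h1 \<in> carrier (GL m)"
        "h2 \<in> carrier (GL n)" "y = \<psi> (act g1 g2 h1 h2 v0)" by (auto simp: \<Omega>_def)
      note ca = carr[OF *(3,4)]
      have "y = (h1 * X * gl_inv h2, h2 * Y * gl_inv h1)"
        unfolding *(5) act[OF *(1-4)] \<psi>_def prod.case contra(1)[OF *(1) ca(1,2)] contra(1)[OF *(2) ca(4,3)]
          base[OF *(3,4)] ..
      then show "y \<in> orb z0" using *(3,4) by (auto simp: orb_def z0_eq)
    qed
    show "orb z0 \<subseteq> points Sv"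
    proof
      fix y assume "y \<in> orb z0"
      then obtain h1 h2 where h: "h1 \<in> carrier (GL m)" "h2 \<in> carrier (GL n)"
        "y = (h1 * X * gl_inv h2, h2 * Y * gl_inv h1)" by (auto simp: orb_def z0_eq)
      show "y \<in> points Sv"
        using X Y GL_carrier_mat[OF h(1)] GL_carrier_mat[OF h(2)] gl_inv(1)[OF h(1)] gl_inv(1)[OF h(2)]
        by (auto simp: h(3) Sv_def intro!: mult_carrier_mat)
    qed
    fix h A assume h: "h \<in> polynomial_funs (coords W)"
      and van: "\<And>x. x \<in> \<Omega> v0 \<Longrightarrow> h x = 0" and A: "A \<in> points W" "\<psi> A \<in> orb z0" "\<Delta> A \<noteq> 0"
    obtain M B C D where AM: "A = ((M, B), (C, D))" by (metis surj_pair)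
    have c: "M \<in> carrier_mat p m" "B \<in> carrier_mat p n" "C \<in> carrier_mat q m" "D \<in> carrier_mat q n"
      using A(1) by (auto simp: AM W_def)
    have nz: "det (e1\<^sup>T * M) \<noteq> 0" "det (e2\<^sup>T * D) \<noteq> 0" using A(3) by (auto simp: \<Delta>_def AM)
    obtain B' where B': "B' \<in> carrier_mat p n" "f1\<^sup>T * B' = 1\<^sub>m n" "M\<^sup>T * B' = M\<^sup>T * B"
      using F1.deformation[OF c(1,2) nz(1)] by blast
    obtain C' where C': "C' \<in> carrier_mat q m" "f2\<^sup>T * C' = 1\<^sub>m m" "D\<^sup>T * C' = D\<^sup>T * C"
      using F2.deformation[OF c(4,3) nz(2)] by blast
    \<comment> \<open>The segments stay in the fiber, because their ends have the same product with
      \<open>M\<^sup>T\<close> and \<open>D\<^sup>T\<close>, respectively.\<close>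
    define Bt where "Bt = gl_path B B'"
    define Ct where "Ct = gl_path C C'"
    have ct: "Bt t \<in> carrier_mat p n" "Ct t \<in> carrier_mat q m" for t
      using c B'(1) C'(1) by (auto simp: Bt_def Ct_def gl_path_def)
    have Bt01: "Bt 0 = B" "Bt 1 = B'" "Ct 0 = C" "Ct 1 = C'"
      using c B'(1) C'(1) by (auto simp: Bt_def Ct_def gl_path_def intro!: eq_matI)
    have eq: "M\<^sup>T * Bt t = M\<^sup>T * B" "D\<^sup>T * Ct t = D\<^sup>T * C" for t
    proof -
      note d = carrier_matD[OF c(1)] carrier_matD[OF c(2)] carrier_matD[OF c(3)] carrier_matD[OF c(4)]
        carrier_matD[OF B'(1)] carrier_matD[OF C'(1)]
      show "M\<^sup>T * Bt t = M\<^sup>T * B" unfolding Bt_def gl_path_def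
        by (simp add: mat_mult_add mat_mult_smult d B'(3)) (intro eq_matI; simp add: d algebra_simps del: index_mult_mat(1))
      show "D\<^sup>T * Ct t = D\<^sup>T * C" unfolding Ct_def gl_path_def
        by (simp add: mat_mult_add mat_mult_smult d C'(3)) (intro eq_matI; simp add: d algebra_simps del: index_mult_mat(1))
    qed
    interpret R: function_algebra UNIV "rational_funs {0, 1}" by (rule function_algebra_rational_funs)
    have Bt: "Bt \<in> R.mat_funs p n" and Ct: "Ct \<in> R.mat_funs q m"
      unfolding Bt_def Ct_def gl_path_def [abs_def]
      by (intro R.mat_funs_add R.mat_funs_smult R.mat_funs_const R.diff R.const rational_funs_ident c B'(1) C'(1))+
    \<comment> \<open>Where \<open>E\<close> is nonzero the deformed point lies in
      \<open>\<Omega>\<close> and \<open>h\<close> vanishes. Since \<open>E 1\<close> is nonzero,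
      \<open>h\<close> also vanishes at the starting point \<open>t = 0\<close>.\<close>
    define E where "E t = det (f1\<^sup>T * Bt t) * det (f2\<^sup>T * Ct t)" for t
    have fc: "f1\<^sup>T \<in> carrier_mat n p" "f2\<^sup>T \<in> carrier_mat m q" using frame_carriers by auto
    have E: "E \<in> rational_funs {0, 1}"
      unfolding E_def [abs_def]
      by (rule R.mult[OF R.det_mat_funs[OF R.mat_funs_mult[OF R.mat_funs_const[OF fc(1)] Bt]]
            R.det_mat_funs[OF R.mat_funs_mult[OF R.mat_funs_const[OF fc(2)] Ct]]])
    have "(\<lambda>t. h ((M, Bt t), (Ct t, D))) \<in> rational_funs {0, 1}"
      by (rule R.comp_polynomial_funs[OF h])
        (auto simp: W_def coords_prod_variety mat_coords_def intro: R.const R.mat_funs_entry[OF Bt] R.mat_funs_entry[OF Ct])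
    from rational_funs_mult_eq_0[OF this E R.const[of 1], of 0 1]
    have "h ((M, Bt 0), (Ct 0, D)) = 0 \<or> E 1 = 0"
    proof
      fix t
      show "h ((M, Bt t), (Ct t, D)) * E t = 0"
      proof (cases "E t = 0")
        case False
        have "((M, Bt t), (Ct t, D)) \<in> \<Omega> v0"
          using chart[OF c(1) ct(1) ct(2) c(4)] False nz A(2) by (auto simp: eq E_def AM \<psi>_def)
        then show ?thesis using van by simp
      qed simp
    qed auto
    then show "h A = 0" by (simp add: Bt01 E_def B'(2) C'(2) AM)
  next
    fix z z' assume "z \<in> orb z0" "z' \<in> orb z0"
    then obtain g1 g2 h1 h2 where g: "g1 \<in> carrier (GL m)" "g2 \<in> carrier (GL n)"
        "z = (g1 * X * gl_inv g2, g2 * Y * gl_inv g1)"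
      and h: "h1 \<in> carrier (GL m)" "h2 \<in> carrier (GL n)" "z' = (h1 * X * gl_inv h2, h2 * Y * gl_inv h1)"
      by (auto simp: orb_def z0_eq)
    define P1 where "P1 = gl_path g1 h1"
    define P2 where "P2 = gl_path g2 h2"
    note p1 = gl_path[OF g(1) h(1), folded P1_def] and p2 = gl_path[OF g(2) h(2), folded P2_def]
    interpret R: function_algebra UNIV "rational_funs {0, 1}" by (rule function_algebra_rational_funs)
    define \<zeta> where "\<zeta> t = (P1 t * X * gl_inv (P2 t), P2 t * Y * gl_inv (P1 t))" for t
    have inv: "gl_inv (P1 t) = adj_inv (P1 t)" "P1 t \<in> carrier (GL m)" if "det (P1 t) \<noteq> 0" for t
      using gl_inv_adj[OF p1(3) that] by (simp_all add: adj_inv_def)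
    have inv': "gl_inv (P2 t) = adj_inv (P2 t)" "P2 t \<in> carrier (GL n)" if "det (P2 t) \<noteq> 0" for t
      using gl_inv_adj[OF p2(3) that] by (simp_all add: adj_inv_def)
    have rat: "(\<lambda>t. \<chi> r (\<zeta> t)) \<in> rational_funs {0, 1}" if "r \<in> eqs" for r
    proof -
      obtain s i j where r: "r = (s, i, j)" by (cases r)
      show ?thesis
      proof (cases s)
        case True
        then have ij: "i < m" "j < n" using that by (auto simp: eqs_def r)
        have "(\<lambda>t. (P1 t * X * adj_inv (P2 t)) $$ (i, j)) \<in> rational_funs {0, 1}"
          by (rule R.mat_funs_entry[OF R.mat_funs_mult[OF R.mat_funs_mult[OF p1(4) R.mat_funs_const[OF X]] p2(6)] ij])
        then show ?thesis
          by (rule rational_adj_inv_cong[OF g(2) h(2)]) (use True inv' in \<open>simp add: r \<chi>_def \<zeta>_def P2_def\<close>)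
      next
        case False
        then have ij: "i < n" "j < m" using that by (auto simp: eqs_def r)
        have "(\<lambda>t. (P2 t * Y * adj_inv (P1 t)) $$ (i, j)) \<in> rational_funs {0, 1}"
          by (rule R.mat_funs_entry[OF R.mat_funs_mult[OF R.mat_funs_mult[OF p2(4) R.mat_funs_const[OF Y]] p1(6)] ij])
        then show ?thesis
          by (rule rational_adj_inv_cong[OF g(1) h(1)]) (use False inv in \<open>simp add: r \<chi>_def \<zeta>_def P1_def\<close>)
      qed
    qed
    have "\<zeta> t \<in> orb z0" if "det (P1 t) * det (P2 t) \<noteq> 0" for t
      using inv(2)[of t] inv'(2)[of t] that by (auto simp: \<zeta>_def orb_def z0_eq)
    then show "\<exists>\<zeta> E. (\<forall>p\<in>eqs. (\<lambda>t. \<chi> p (\<zeta> t)) \<in> rational_funs {0, 1}) \<and> \<zeta> 0 = z \<and> \<zeta> 1 = z' \<and>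
        E \<in> rational_funs {0, 1} \<and> E 0 \<noteq> 0 \<and> E 1 \<noteq> 0 \<and> (\<forall>t. E t \<noteq> 0 \<longrightarrow> \<zeta> t \<in> orb z0)"
      using rat p1(1,2) p2(1,2) R.mult[OF p1(5) p2(5)]
        GL_det[OF g(1)] GL_det[OF h(1)] GL_det[OF g(2)] GL_det[OF h(2)] g(3) h(3)
      by (intro exI[of _ \<zeta>] exI[of _ "\<lambda>t. det (P1 t) * det (P2 t)"]) (auto simp: \<zeta>_def)
  qed
  moreover have "v0 \<in> points W" using frame_carriers B0(1) C0(1) by (simp add: W_def v0_def)
  ultimately show ?thesis by blast
qed

end

section \<open>The three dual pairs\<close>

lemma sum_lessThan_add: "(\<Sum>r<a + b. g r) = (\<Sum>r<a. g r) + (\<Sum>r<b. g (a + r))" for g :: "nat \<Rightarrow> 'a :: comm_monoid_add"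
  by (induction b) (auto simp: add.assoc)

lemma sum_split_blocks:
  fixes g :: "nat \<Rightarrow> complex"
  assumes "2 * n \<le> N"
  shows "(\<Sum>r<N. g r) = (\<Sum>k<n. g k + g (n + k)) + (\<Sum>l<N - 2 * n. g (2 * n + l))"
proof -
  have "N = n + (n + (N - 2 * n))" using assms by simp
  then have "(\<Sum>r<N. g r) = (\<Sum>r<n + (n + (N - 2 * n)). g r)" by (rule arg_cong)
  also have "\<dots> = (\<Sum>k<n. g k + g (n + k)) + (\<Sum>l<N - 2 * n. g (2 * n + l))"
    unfolding sum_lessThan_add by (simp add: sum.distrib add.assoc mult_2)
  finally show ?thesis .
qed

subsection \<open>Orthogonal groups\<close>

lemma orthogonal_form:
  fixes A B :: "complex mat"
  assumes "2 * n \<le> N" "A \<in> carrier_mat N a" "B \<in> carrier_mat N b" "i < a" "j < b"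
  shows "(A\<^sup>T * 1\<^sub>m N * B) $$ (i, j) = (\<Sum>k<n. A $$ (k, i) * B $$ (k, j) + A $$ (n + k, i) * B $$ (n + k, j)) +
    (\<Sum>l<N - 2 * n. A $$ (2 * n + l, i) * B $$ (2 * n + l, j))"
proof -
  have "A\<^sup>T * 1\<^sub>m N * B = A\<^sup>T * B" using assms by (simp add: mat_one_right)
  then have "(A\<^sup>T * 1\<^sub>m N * B) $$ (i, j) = (\<Sum>r<N. A $$ (r, i) * B $$ (r, j))"
    using assms by (simp add: scalar_prod_def atLeast0LessThan)
  then show ?thesis unfolding sum_split_blocks[OF assms(1)] .
qed

text \<open>Its columns are isotropic for the standard form if \<open>c^2 + d^2 = 0\<close>. The
  frames used are \<open>(1, \<i>)\<close> and \<open>(1/2, -\<i>/2)\<close>, whose scalar product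
  is 1.\<close>

definition iso_frame :: "complex \<Rightarrow> complex \<Rightarrow> nat \<Rightarrow> nat \<Rightarrow> complex mat" where
  "iso_frame c d N n = mat N n (\<lambda>(r, k). if r = k then c else if r = n + k then d else 0)"

lemma iso_frame_carrier: "iso_frame c d N n \<in> carrier_mat N n"
  by (simp add: iso_frame_def)

lemma iso_frame_mult:
  assumes "2 * n \<le> N" "B \<in> carrier_mat N b"
  shows "(iso_frame c d N n)\<^sup>T * 1\<^sub>m N * B = mat n b (\<lambda>(i, j). c * B $$ (i, j) + d * B $$ (n + i, j))"
proof (rule eq_matI)
  fix i j assume "i < dim_row (mat n b (\<lambda>(i, j). c * B $$ (i, j) + d * B $$ (n + i, j)))"
    "j < dim_col (mat n b (\<lambda>(i, j). c * B $$ (i, j) + d * B $$ (n + i, j)))"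
  then have ij: "i < n" "j < b" by auto
  have f: "iso_frame c d N n $$ (k, i) = (if k = i then c else 0)"
    "iso_frame c d N n $$ (n + k, i) = (if k = i then d else 0)" if "k < n" for k
    using that assms(1) ij by (auto simp: iso_frame_def)
  have f': "iso_frame c d N n $$ (2 * n + l, i) = 0" if "l < N - 2 * n" for l
    using that ij by (auto simp: iso_frame_def)
  have "((iso_frame c d N n)\<^sup>T * 1\<^sub>m N * B) $$ (i, j) =
      (\<Sum>k<n. (if k = i then c else 0) * B $$ (k, j) + (if k = i then d else 0) * B $$ (n + k, j)) + 0"
    unfolding orthogonal_form[OF assms(1) iso_frame_carrier assms(2) ij]
    by (intro arg_cong2[of _ _ _ _ "(+)"] sum.cong sum.neutral) (auto simp: f f')
  also have "\<dots> = c * B $$ (i, j) + d * B $$ (n + i, j)"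
    using ij by (simp add: sum.distrib if_distrib[of "\<lambda>x. x * _"] cong: if_cong)
  finally show "((iso_frame c d N n)\<^sup>T * 1\<^sub>m N * B) $$ (i, j) =
      mat n b (\<lambda>(i, j). c * B $$ (i, j) + d * B $$ (n + i, j)) $$ (i, j)" using ij by simp
qed (use assms in \<open>simp_all add: iso_frame_def\<close>)

text \<open>Rows \<open>k\<close> and \<open>n + k\<close> hold the coordinates of \<open>v\<close>
  times the frame \<open>(1, \<i>)\<close> plus \<open>u\<close> times the frame
  \<open>(1/2, -\<i>/2)\<close>, where \<open>u\<close> is block 0 and \<open>v\<close> is block 1;
  \<open>ortho_cd\<close> solves for \<open>u\<close> and \<open>v\<close>.\<close>

definition ortho_cmp :: "nat \<Rightarrow> nat \<Rightarrow> (nat \<times> nat \<times> nat \<Rightarrow> complex) \<Rightarrow> complex mat" where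
  "ortho_cmp n N b = mat N n (\<lambda>(r, i). if r < n then b (0, r, i) / 2 + b (1, r, i)
    else if r < 2 * n then \<i> * (b (1, r - n, i) - b (0, r - n, i) / 2) else b (2, r - 2 * n, i))"

definition ortho_cd :: "nat \<Rightarrow> nat \<Rightarrow> complex mat \<Rightarrow> nat \<times> nat \<times> nat \<Rightarrow> complex" where
  "ortho_cd n N A = (\<lambda>(c, k, i).
    if c = 0 then entry0 N n A k i + \<i> * entry0 N n A (n + k) i
    else if c = 1 then (entry0 N n A k i - \<i> * entry0 N n A (n + k) i) / 2
    else entry0 N n A (2 * n + k) i)"

text \<open>The strict inequalities leave at least one row beyond the two isotropic blocks. It
  supplies the variables \<open>r(0, i)\<close> whose squares lead the diagonal equations.\<close>

lemma orthogonal_model: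
  assumes n: "0 < n" and le: "2 * n < p" "2 * n < q"
  defines "N \<equiv> case_bool p q"
  shows "form_model n (\<lambda>_. n) (\<lambda>s. N s - 2 * n) 1 N (\<lambda>s. 1\<^sub>m (N s)) (\<lambda>s. 1\<^sub>m (N s))
    (\<lambda>s. iso_frame 1 \<i> (N s) n) (\<lambda>s. iso_frame (1 / 2) (- \<i> / 2) (N s) n)
    (\<lambda>s. ortho_cmp n (N s)) (\<lambda>s. ortho_cd n (N s)) (sym_space n \<times>\<^sub>V sym_space n) (psi (pair_O_Sp p q n))"
proof -
  have N: "2 * n < N s" for s using le by (cases s) (simp_all add: N_def)
  then have N': "2 * n \<le> N s" for s by (simp add: less_imp_le)
  interpret form_family n "\<lambda>_. n" "\<lambda>s. N s - 2 * n" 1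
    by standard (use n N in auto)
  show ?thesis
  proof
    show "1\<^sub>m (N s) * 1\<^sub>m (N s) = (1\<^sub>m (N s) :: complex mat)" for s
      by (rule left_mult_one_mat[OF one_carrier_mat])
    show "(1\<^sub>m (N s))\<^sup>T = 1 \<cdot>\<^sub>m (1\<^sub>m (N s) :: complex mat)" for s
      by (rule eq_matI) auto
    show "(iso_frame 1 \<i> (N s) n)\<^sup>T * 1\<^sub>m (N s) * iso_frame 1 \<i> (N s) n = 0\<^sub>m n n" for s
      unfolding iso_frame_mult[OF N' iso_frame_carrier]
      using N'[of s] by (intro eq_matI) (auto simp: iso_frame_def)
    show "(iso_frame (1 / 2) (- \<i> / 2) (N s) n)\<^sup>T * 1\<^sub>m (N s) * iso_frame (1 / 2) (- \<i> / 2) (N s) n = 0\<^sub>m n n" for s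
      unfolding iso_frame_mult[OF N' iso_frame_carrier]
      using N'[of s] by (intro eq_matI) (auto simp: iso_frame_def)
    show "(iso_frame 1 \<i> (N s) n)\<^sup>T * 1\<^sub>m (N s) * iso_frame (1 / 2) (- \<i> / 2) (N s) n = 1\<^sub>m n" for s
      unfolding iso_frame_mult[OF N' iso_frame_carrier]
      using N'[of s] by (intro eq_matI) (auto simp: iso_frame_def)
    show "(\<lambda>a. ortho_cmp n (N s) (\<lambda>x. a (s, x)) $$ (r, i)) \<in> assignment_polys" if "r < N s" "i < n" for s r i
    proof -
      interpret A: function_algebra UNIV "assignment_polys :: ((var \<Rightarrow> complex) \<Rightarrow> complex) set"
        by (rule function_algebra_polynomial_funs)
      have v: "(\<lambda>a :: var \<Rightarrow> complex. a x) \<in> assignment_polys" for x by (rule polynomial_funs.coord) simp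
      have "(\<lambda>a :: var \<Rightarrow> complex. (1 / 2) * a (s, 0, r, i) + a (s, 1, r, i)) \<in> assignment_polys"
        "(\<lambda>a :: var \<Rightarrow> complex. \<i> * (a (s, 1, r - n, i) - (1 / 2) * a (s, 0, r - n, i))) \<in> assignment_polys"
        by (intro A.add A.mult A.diff A.const v)+
      then show ?thesis using that v[of "(s, 2, r - 2 * n, i)"]
        by (cases "r < n"; cases "r < 2 * n") (simp_all add: ortho_cmp_def)
    qed
    show "ortho_cmp n (N s) (ortho_cd n (N s) A) = A" if A: "A \<in> carrier_mat (N s) n" for s A
    proof (rule eq_matI)
      fix r i assume "r < dim_row A" "i < dim_col A"
      then have ri: "r < N s" "i < n" using A by auto
      then show "ortho_cmp n (N s) (ortho_cd n (N s) A) $$ (r, i) = A $$ (r, i)"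
        using N'[of s] by (auto simp: ortho_cmp_def ortho_cd_def entry0_def field_simps)
    qed (use A in \<open>auto simp: ortho_cmp_def\<close>)
    show "(\<lambda>A. ortho_cd n (N s) A x) \<in> polynomial_funs (mat_coords (N s) n)" for s x
    proof -
      interpret A: function_algebra UNIV "polynomial_funs (mat_coords (N s) n)"
        by (rule function_algebra_polynomial_funs)
      obtain c k i where x: "x = (c, k, i)" by (metis surj_pair)
      have "(\<lambda>A. entry0 (N s) n A k i + \<i> * entry0 (N s) n A (n + k) i) \<in> polynomial_funs (mat_coords (N s) n)"
        "(\<lambda>A. (entry0 (N s) n A k i - \<i> * entry0 (N s) n A (n + k) i) * (1 / 2)) \<in> polynomial_funs (mat_coords (N s) n)"
        by (intro A.add A.mult A.diff A.const entry0_polynomial)+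
      then show ?thesis using entry0_polynomial[of "N s" n "2 * n + k" i]
        by (cases "c = 0"; cases "c = 1") (simp_all add: x ortho_cd_def)
    qed
    show "((ortho_cmp n (N s) (\<lambda>x. a (s, x)))\<^sup>T * 1\<^sub>m (N s) * ortho_cmp n (N s) (\<lambda>x. a (s, x))) $$ (i, j) = form (s, i, j) a"
      if "i < n" "j < n" for s a i j
    proof -
      have c: "ortho_cmp n (N s) (\<lambda>x. a (s, x)) \<in> carrier_mat (N s) n" by (simp add: ortho_cmp_def)
      have ii: "\<i> * x * (\<i> * y) = - (x * y)" for x y by (simp add: algebra_simps)
      have e1: "ortho_cmp n (N s) (\<lambda>x. a (s, x)) $$ (k, i) * ortho_cmp n (N s) (\<lambda>x. a (s, x)) $$ (k, j) +
          ortho_cmp n (N s) (\<lambda>x. a (s, x)) $$ (n + k, i) * ortho_cmp n (N s) (\<lambda>x. a (s, x)) $$ (n + k, j) =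
          a (s, 0, k, i) * a (s, 1, k, j) + 1 * (a (s, 1, k, i) * a (s, 0, k, j))" if "k < n" for k
        using that \<open>i < n\<close> \<open>j < n\<close> N'[of s] by (simp add: ortho_cmp_def ii) (simp add: field_simps)
      have e2: "ortho_cmp n (N s) (\<lambda>x. a (s, x)) $$ (2 * n + l, i) * ortho_cmp n (N s) (\<lambda>x. a (s, x)) $$ (2 * n + l, j) =
          a (s, 2, l, i) * a (s, 2, l, j)" if "l < N s - 2 * n" for l
        using that \<open>i < n\<close> \<open>j < n\<close> by (simp add: ortho_cmp_def)
      show ?thesis
        unfolding orthogonal_form[OF N' c c that] form_def prod.case
        by (rule arg_cong2[of _ _ _ _ "(+)", OF sum.cong sum.cong]) (use e1 e2 in auto)
    qed
    show "(iso_frame 1 \<i> (N s) n)\<^sup>T * 1\<^sub>m (N s) * ortho_cmp n (N s) b = mat n n (\<lambda>(k, i). b (0, k, i))" for s b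
    proof -
      have c: "ortho_cmp n (N s) b \<in> carrier_mat (N s) n" by (simp add: ortho_cmp_def)
      show ?thesis
        unfolding iso_frame_mult[OF N' c] using N'[of s]
        by (intro eq_matI) (auto simp: ortho_cmp_def algebra_simps)
    qed
    show "points (sym_space n \<times>\<^sub>V sym_space n) =
        {X \<in> carrier_mat n n. X\<^sup>T = 1 \<cdot>\<^sub>m X} \<times> {X \<in> carrier_mat n n. X\<^sup>T = 1 \<cdot>\<^sub>m X}"
      by (simp add: sym_space_def mat_smult_one)
    show "coords (sym_space n \<times>\<^sub>V sym_space n) = coords (mat_space n n \<times>\<^sub>V mat_space n n)"
      by (simp add: prod_variety_def sym_space_def mat_space_def)
    show "psi (pair_O_Sp p q n) (A, B) = (A\<^sup>T * 1\<^sub>m (N True) * A, B\<^sup>T * 1\<^sub>m (N False) * B)"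
      if "A \<in> carrier_mat (N True) n" "B \<in> carrier_mat (N False) n" for A B
      using that by (simp add: pair_O_Sp_def mat_one_right)
  qed (simp_all add: iso_frame_carrier ortho_cmp_def)
qed

lemma carrier_O_group: "carrier (O_group p) = isometries p (1\<^sub>m p)"
proof -
  have "k \<in> carrier (GL p)" if "k \<in> carrier_mat p p" "k\<^sup>T * k = 1\<^sub>m p" for k
    by (rule gl_inv_eq(1)[of _ _ "k\<^sup>T"]) (use that in auto)
  then show ?thesis by (auto simp: O_group_def isometries_def mat_one_right dest: GL_carrier_mat)
qed

lemma O_Sp_fiber:
  assumes n: "0 < n" "2 * n < min p q" and Orb: "Orb \<in> nilpotent_orbits (pair_O_Sp p q n)"
  defines "D \<equiv> pair_O_Sp p q n"
  shows "reduced_irreducible_closed_subvariety (space_W D) (closure_fiber_ideal D Orb) \<and>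
    (\<exists>w\<in>points (space_W D). zero_locus (space_W D) (closure_fiber_ideal D Orb) =
      zariski (space_W D) closure_of orbit (grp_K D \<times>\<times> grp_K' D) (act_W D) w)"
proof -
  interpret m: form_model n "\<lambda>_. n" "\<lambda>s. case_bool p q s - 2 * n" 1 "case_bool p q"
    "\<lambda>s. 1\<^sub>m (case_bool p q s)" "\<lambda>s. 1\<^sub>m (case_bool p q s)"
    "\<lambda>s. iso_frame 1 \<i> (case_bool p q s) n" "\<lambda>s. iso_frame (1 / 2) (- \<i> / 2) (case_bool p q s) n"
    "\<lambda>s. ortho_cmp n (case_bool p q s)" "\<lambda>s. ortho_cd n (case_bool p q s)" "sym_space n \<times>\<^sub>V sym_space n" "psi D"
    unfolding D_def by (rule orthogonal_model) (use n in auto)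
  have W: "m.W = space_W D" by (simp add: m.W_def D_def pair_O_Sp_def)
  obtain z0 where z0: "z0 \<in> points (sym_space n \<times>\<^sub>V sym_space n)" "Orb = orbit (GL n) (act_s' D) z0"
    using Orb by (auto simp: nilpotent_orbits_def orbits_def D_def pair_O_Sp_def)
  have "Orb = m.orb z0"
    unfolding z0(2) by (cases z0) (auto simp: orbit_def m.orb_def D_def pair_O_Sp_def)
  then have I: "fiber_ideal m.W (psi D) (sym_space n \<times>\<^sub>V sym_space n) (zariski (sym_space n \<times>\<^sub>V sym_space n) closure_of m.orb z0) =
      closure_fiber_ideal D Orb"
    unfolding W by (simp add: closure_fiber_ideal_def D_def pair_O_Sp_def)
  have "m.\<Omega> v = orbit (grp_K D \<times>\<times> grp_K' D) (act_W D) v" for v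
    by (cases v) (force simp: m.\<Omega>_def orbit_def D_def pair_O_Sp_def carrier_O_group DirProd_def)
  with m.form_fiber[OF z0(1)] show ?thesis unfolding I unfolding W by auto
qed

subsection \<open>Symplectic groups\<close>

lemma J_carrier: "J_mat P \<in> carrier_mat (2 * P) (2 * P)"
  by (simp add: J_mat_def mult_2)

lemma J_mult:
  assumes B: "B \<in> carrier_mat (2 * P) b" and j: "j < b" and k: "k < P"
  shows "(J_mat P * B) $$ (k, j) = B $$ (P + k, j)" "(J_mat P * B) $$ (P + k, j) = - B $$ (k, j)"
proof -
  have s: "(\<Sum>r<2 * P. g r) = (\<Sum>r<P. g r + g (P + r))" for g :: "nat \<Rightarrow> complex"
    using sum_split_blocks[of P "2 * P" g] by simp
  have "(J_mat P * B) $$ (r, j) = (\<Sum>c<2 * P. J_mat P $$ (r, c) * B $$ (c, j))" if "r < 2 * P" for r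
    using that B j J_carrier[of P] by (simp add: scalar_prod_def atLeast0LessThan)
  then have "(J_mat P * B) $$ (k, j) = (\<Sum>c<P. J_mat P $$ (k, c) * B $$ (c, j) + J_mat P $$ (k, P + c) * B $$ (P + c, j))"
    "(J_mat P * B) $$ (P + k, j) = (\<Sum>c<P. J_mat P $$ (P + k, c) * B $$ (c, j) + J_mat P $$ (P + k, P + c) * B $$ (P + c, j))"
    using k by (simp_all add: s)
  moreover have "J_mat P $$ (k, c) = 0" "J_mat P $$ (k, P + c) = (if c = k then 1 else 0)"
    "J_mat P $$ (P + k, c) = (if c = k then -1 else 0)" "J_mat P $$ (P + k, P + c) = 0" if "c < P" for c
    using k that by (auto simp: J_mat_def)
  ultimately show "(J_mat P * B) $$ (k, j) = B $$ (P + k, j)" "(J_mat P * B) $$ (P + k, j) = - B $$ (k, j)"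
    using k by (simp_all add: if_distrib[of "\<lambda>x. x * _"] cong: if_cong)
qed

lemma symplectic_form:
  assumes "A \<in> carrier_mat (2 * P) a" "B \<in> carrier_mat (2 * P) b" "i < a" "j < b"
  shows "(A\<^sup>T * J_mat P * B) $$ (i, j) = (\<Sum>k<P. A $$ (k, i) * B $$ (P + k, j) - A $$ (P + k, i) * B $$ (k, j))"
proof -
  have "A\<^sup>T * J_mat P * B = A\<^sup>T * (J_mat P * B)"
    using assms J_carrier[of P] by (simp add: mat_assoc)
  then have "(A\<^sup>T * J_mat P * B) $$ (i, j) = (\<Sum>r<2 * P. A $$ (r, i) * (J_mat P * B) $$ (r, j))"
    using assms carrier_matD[OF J_carrier[of P]] by (simp add: scalar_prod_def atLeast0LessThan del: index_mult_mat(1))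
      (simp add: scalar_prod_def atLeast0LessThan)
  also have "\<dots> = (\<Sum>k<P. A $$ (k, i) * B $$ (P + k, j) - A $$ (P + k, i) * B $$ (k, j))"
    using sum_split_blocks[of P "2 * P" "\<lambda>r. A $$ (r, i) * (J_mat P * B) $$ (r, j)"]
    by (simp add: J_mult[OF assms(2,4)] del: index_mult_mat(1))
  finally show ?thesis .
qed

lemma J_square: "J_mat P * J_mat P = (- 1) \<cdot>\<^sub>m 1\<^sub>m (2 * P)"
proof (rule eq_matI)
  fix r c assume "r < dim_row ((- 1) \<cdot>\<^sub>m 1\<^sub>m (2 * P) :: complex mat)" "c < dim_col ((- 1) \<cdot>\<^sub>m 1\<^sub>m (2 * P) :: complex mat)"
  then have rc: "r < 2 * P" "c < 2 * P" by auto
  show "(J_mat P * J_mat P) $$ (r, c) = ((- 1) \<cdot>\<^sub>m 1\<^sub>m (2 * P)) $$ (r, c)"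
  proof (cases "r < P")
    case True
    then show ?thesis using rc by (simp only: J_mult(1)[OF J_carrier rc(2) True]) (auto simp: J_mat_def)
  next
    case False
    define k where "k = r - P"
    have k: "k < P" "r = P + k" using False rc by (auto simp: k_def)
    show ?thesis using rc unfolding k(2) J_mult(2)[OF J_carrier rc(2) k(1)] by (auto simp: J_mat_def)
  qed
qed (use J_carrier[of P] in auto)

lemma J_transpose: "(J_mat P)\<^sup>T = (- 1) \<cdot>\<^sub>m J_mat P"
  by (rule eq_matI) (auto simp: J_mat_def)

definition symp_frame :: "complex \<Rightarrow> complex \<Rightarrow> nat \<Rightarrow> nat \<Rightarrow> complex mat" where
  "symp_frame c d P n = mat (2 * P) n (\<lambda>(r, k). if r = k then c else if r = P + k then d else 0)"

lemma symp_frame_carrier: "symp_frame c d P n \<in> carrier_mat (2 * P) n"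
  by (simp add: symp_frame_def)

lemma symp_frame_mult:
  assumes "n \<le> P" "B \<in> carrier_mat (2 * P) b"
  shows "(symp_frame c d P n)\<^sup>T * J_mat P * B = mat n b (\<lambda>(i, j). c * B $$ (P + i, j) - d * B $$ (i, j))"
proof (rule eq_matI)
  fix i j assume "i < dim_row (mat n b (\<lambda>(i, j). c * B $$ (P + i, j) - d * B $$ (i, j)))"
    "j < dim_col (mat n b (\<lambda>(i, j). c * B $$ (P + i, j) - d * B $$ (i, j)))"
  then have ij: "i < n" "j < b" by auto
  have f: "symp_frame c d P n $$ (k, i) = (if k = i then c else 0)"
    "symp_frame c d P n $$ (P + k, i) = (if k = i then d else 0)" if "k < P" for k
    using that assms(1) ij by (auto simp: symp_frame_def)
  have "((symp_frame c d P n)\<^sup>T * J_mat P * B) $$ (i, j) =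
      (\<Sum>k<P. (if k = i then c else 0) * B $$ (P + k, j) - (if k = i then d else 0) * B $$ (k, j))"
    unfolding symplectic_form[OF symp_frame_carrier assms(2) ij] by (intro sum.cong) (auto simp: f)
  also have "\<dots> = c * B $$ (P + i, j) - d * B $$ (i, j)"
    using ij assms(1) by (simp add: sum_subtractf if_distrib[of "\<lambda>x. x * _"] cong: if_cong)
  finally show "((symp_frame c d P n)\<^sup>T * J_mat P * B) $$ (i, j) =
      mat n b (\<lambda>(i, j). c * B $$ (P + i, j) - d * B $$ (i, j)) $$ (i, j)" using ij by simp
qed (use assms J_carrier[of P] in \<open>simp_all add: symp_frame_def\<close>)

definition symp_cmp :: "nat \<Rightarrow> nat \<Rightarrow> (nat \<times> nat \<times> nat \<Rightarrow> complex) \<Rightarrow> complex mat" where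
  "symp_cmp n P b = mat (2 * P) n (\<lambda>(r, i). if r < P then b (0, r, i) else b (1, r - P, i))"

definition symp_cd :: "nat \<Rightarrow> nat \<Rightarrow> complex mat \<Rightarrow> nat \<times> nat \<times> nat \<Rightarrow> complex" where
  "symp_cd n P A = (\<lambda>(c, k, i). if c = 0 then entry0 (2 * P) n A k i else entry0 (2 * P) n A (P + k) i)"

text \<open>The two isotropic blocks already fill the space, and an alternating form has no diagonal
  equations, so \<open>n \<le> N s\<close> suffices. The entry -1 of the frame \<open>e\<close>
  makes \<open>e\<^sup>T J A\<close> the first \<open>n\<close> rows of \<open>A\<close>.\<close>

lemma symplectic_model:
  assumes n: "0 < n" and le: "n \<le> p" "n \<le> q"
  defines "N \<equiv> case_bool p q"
  shows "form_model n N (\<lambda>s. 0) (- 1) (\<lambda>s. 2 * N s) (\<lambda>s. J_mat (N s)) (\<lambda>s. (- 1) \<cdot>\<^sub>m J_mat (N s))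
    (\<lambda>s. symp_frame 0 (- 1) (N s) n) (\<lambda>s. symp_frame 1 0 (N s) n)
    (\<lambda>s. symp_cmp n (N s)) (\<lambda>s. symp_cd n (N s)) (alt_space n \<times>\<^sub>V alt_space n) (psi (pair_Sp_O p q n))"
proof -
  have N: "n \<le> N s" for s using le by (cases s) (simp_all add: N_def)
  interpret form_family n N "\<lambda>_. 0" "- 1"
    by standard (use n N in auto)
  show ?thesis
  proof
    show "J_mat (N s) \<in> carrier_mat (2 * N s) (2 * N s)" "(- 1) \<cdot>\<^sub>m J_mat (N s) \<in> carrier_mat (2 * N s) (2 * N s)"
      "(J_mat (N s))\<^sup>T = (- 1) \<cdot>\<^sub>m J_mat (N s)" for s
      using J_carrier[of "N s"] J_transpose by auto
    show "(- 1) \<cdot>\<^sub>m J_mat (N s) * J_mat (N s) = 1\<^sub>m (2 * N s)" for s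
      using J_carrier[of "N s"] J_square[of "N s"] by (simp add: mat_smult_mult mat_smult_smult mat_smult_one)
    show "(symp_frame 0 (- 1) (N s) n)\<^sup>T * J_mat (N s) * symp_frame 0 (- 1) (N s) n = 0\<^sub>m n n"
      "(symp_frame 1 0 (N s) n)\<^sup>T * J_mat (N s) * symp_frame 1 0 (N s) n = 0\<^sub>m n n"
      "(symp_frame 0 (- 1) (N s) n)\<^sup>T * J_mat (N s) * symp_frame 1 0 (N s) n = 1\<^sub>m n" for s
      unfolding symp_frame_mult[OF N symp_frame_carrier]
      using N[of s] by (auto simp: symp_frame_def intro!: eq_matI)
    show "(\<lambda>a. symp_cmp n (N s) (\<lambda>x. a (s, x)) $$ (r, i)) \<in> assignment_polys" if "r < 2 * N s" "i < n" for s r i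
      using that by (cases "r < N s") (auto simp: symp_cmp_def intro: polynomial_funs.coord)
    show "symp_cmp n (N s) (symp_cd n (N s) A) = A" if A: "A \<in> carrier_mat (2 * N s) n" for s A
      using A by (intro eq_matI) (auto simp: symp_cmp_def symp_cd_def entry0_def)
    show "(\<lambda>A. symp_cd n (N s) A x) \<in> polynomial_funs (mat_coords (2 * N s) n)" for s x
    proof -
      obtain c k i where x: "x = (c, k, i)" by (metis surj_pair)
      show ?thesis using entry0_polynomial by (cases "c = 0") (simp_all add: x symp_cd_def)
    qed
    show "((symp_cmp n (N s) (\<lambda>x. a (s, x)))\<^sup>T * J_mat (N s) * symp_cmp n (N s) (\<lambda>x. a (s, x))) $$ (i, j) = form (s, i, j) a"
      if "i < n" "j < n" for s a i j
    proof -
      have c: "symp_cmp n (N s) (\<lambda>x. a (s, x)) \<in> carrier_mat (2 * N s) n" by (simp add: symp_cmp_def)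
      show ?thesis
        unfolding symplectic_form[OF c c that] form_def
        using that by (auto simp: symp_cmp_def intro!: sum.cong)
    qed
    show "(symp_frame 0 (- 1) (N s) n)\<^sup>T * J_mat (N s) * symp_cmp n (N s) b = mat n n (\<lambda>(k, i). b (0, k, i))" for s b
    proof -
      have c: "symp_cmp n (N s) b \<in> carrier_mat (2 * N s) n" by (simp add: symp_cmp_def)
      show ?thesis
        unfolding symp_frame_mult[OF N c] using N[of s] by (auto simp: symp_cmp_def intro!: eq_matI)
    qed
    have "- A = (- 1) \<cdot>\<^sub>m A" for A :: "complex mat" by (rule eq_matI) auto
    then show "points (alt_space n \<times>\<^sub>V alt_space n) =
        {X \<in> carrier_mat n n. X\<^sup>T = (- 1) \<cdot>\<^sub>m X} \<times> {X \<in> carrier_mat n n. X\<^sup>T = (- 1) \<cdot>\<^sub>m X}"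
      by (simp add: alt_space_def)
    show "coords (alt_space n \<times>\<^sub>V alt_space n) = coords (mat_space n n \<times>\<^sub>V mat_space n n)"
      by (simp add: prod_variety_def alt_space_def mat_space_def)
    show "psi (pair_Sp_O p q n) (A, B) = (A\<^sup>T * J_mat (N True) * A, B\<^sup>T * J_mat (N False) * B)" for A B
      by (simp add: pair_Sp_O_def N_def)
  qed (simp_all add: symp_frame_carrier symp_cmp_def)
qed

lemma J_inverse: "((- 1) \<cdot>\<^sub>m J_mat P) * J_mat P = 1\<^sub>m (2 * P)"
  using J_carrier[of P] J_square[of P] by (simp add: mat_smult_mult mat_smult_smult mat_smult_one)

lemma isometries_J_GL: "k \<in> isometries (2 * P) (J_mat P) \<Longrightarrow> k \<in> carrier (GL (2 * P))"
  by (rule isometries_GL[OF _ J_carrier _ J_inverse]) (use J_carrier[of P] in auto)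

lemma carrier_Sp_group: "carrier (Sp_group P) = isometries (2 * P) (J_mat P)"
  using isometries_J_GL GL_carrier_mat by (auto simp: Sp_group_def isometries_def)

lemma gl_inv_transpose:
  assumes "k \<in> carrier (GL N)"
  shows "(gl_inv k)\<^sup>T \<in> carrier (GL N)" "gl_inv ((gl_inv k)\<^sup>T) = k\<^sup>T"
proof -
  note c = GL_carrier_mat[OF assms] gl_inv[OF assms]
  have "k\<^sup>T * (gl_inv k)\<^sup>T = (gl_inv k * k)\<^sup>T" using c(1,2) by (simp add: mat_transpose_mult)
  then have "k\<^sup>T * (gl_inv k)\<^sup>T = 1\<^sub>m N" by (simp add: c(3))
  then show "(gl_inv k)\<^sup>T \<in> carrier (GL N)" "gl_inv ((gl_inv k)\<^sup>T) = k\<^sup>T"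
    using gl_inv_eq[of "(gl_inv k)\<^sup>T" N "k\<^sup>T"] c(1,2) by auto
qed

text \<open>The relation \<open>k\<^sup>T J k = J\<close> gives \<open>J h = k\<^sup>T J\<close> for
  the inverse \<open>h\<close> of \<open>k\<close>; using \<open>J J = -1\<close> twice moves this
  to \<open>h J h\<^sup>T = J\<close>.\<close>

lemma symplectic_contragredient:
  assumes k: "k \<in> isometries (2 * P) (J_mat P)"
  shows "(gl_inv k)\<^sup>T \<in> isometries (2 * P) (J_mat P)"
proof -
  let ?J = "J_mat P" and ?N = "2 * P"
  note g = isometries_J_GL[OF k]
  define h where "h = gl_inv k"
  have c: "k \<in> carrier_mat ?N ?N" "h \<in> carrier_mat ?N ?N" "h * k = 1\<^sub>m ?N" "k * h = 1\<^sub>m ?N"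
    using GL_carrier_mat[OF g] gl_inv[OF g] by (simp_all add: h_def)
  note d = carrier_matD[OF c(1)] carrier_matD[OF c(2)] carrier_matD[OF J_carrier[of P]]
  have e: "k\<^sup>T * ?J * k = ?J" using k by (simp add: isometries_def)
  have JJ: "?J * (?J * A) = (- 1) \<cdot>\<^sub>m A" if "A \<in> carrier_mat ?N ?N" for A
  proof -
    have "?J * (?J * A) = (?J * ?J) * A" using that by (simp add: mat_assoc d)
    then show ?thesis unfolding J_square using that by (simp add: mat_ring)
  qed
  have "?J * h = k\<^sup>T * (?J * (k * h))" using arg_cong[OF e, of "\<lambda>A. A * h"] by (simp add: mat_assoc d)
  then have Jh: "?J * h = k\<^sup>T * ?J" by (simp add: c(4) mat_one_right d)
  have kh: "h\<^sup>T * k\<^sup>T = 1\<^sub>m ?N"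
  proof -
    have "h\<^sup>T * k\<^sup>T = (k * h)\<^sup>T" by (simp add: mat_transpose_mult d)
    then show ?thesis by (simp add: c(4))
  qed
  have "h * (?J * h\<^sup>T) = ((- 1) \<cdot>\<^sub>m (?J * (?J * h))) * (?J * h\<^sup>T)"
    using c(2) by (simp add: JJ mat_smult_smult mat_smult_one)
  also have "\<dots> = (- 1) \<cdot>\<^sub>m (?J * (k\<^sup>T * (?J * (?J * h\<^sup>T))))"
    unfolding Jh by (simp add: mat_assoc mat_smult_mult d)
  also have "\<dots> = ?J * (k\<^sup>T * h\<^sup>T)"
    using c by (simp add: JJ mat_mult_smult mat_smult_smult mat_smult_one d)
  also have "k\<^sup>T * h\<^sup>T = (h * k)\<^sup>T" by (simp add: mat_transpose_mult d)
  also have "?J * (h * k)\<^sup>T = ?J" by (simp add: c(3) mat_one_right d)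
  finally have "h * (?J * h\<^sup>T) = ?J" .
  then show ?thesis using c(2) by (simp add: isometries_def h_def [symmetric] mat_assoc d)
qed

lemma Sp_O_fiber:
  assumes n: "0 < n" "n \<le> min p q" and Orb: "Orb \<in> nilpotent_orbits (pair_Sp_O p q n)"
  defines "D \<equiv> pair_Sp_O p q n"
  shows "reduced_irreducible_closed_subvariety (space_W D) (closure_fiber_ideal D Orb) \<and>
    (\<exists>w\<in>points (space_W D). zero_locus (space_W D) (closure_fiber_ideal D Orb) =
      zariski (space_W D) closure_of orbit (grp_K D \<times>\<times> grp_K' D) (act_W D) w)"
proof -
  interpret m: form_model n "case_bool p q" "\<lambda>s. 0" "- 1" "\<lambda>s. 2 * case_bool p q s"
    "\<lambda>s. J_mat (case_bool p q s)" "\<lambda>s. (- 1) \<cdot>\<^sub>m J_mat (case_bool p q s)"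
    "\<lambda>s. symp_frame 0 (- 1) (case_bool p q s) n" "\<lambda>s. symp_frame 1 0 (case_bool p q s) n"
    "\<lambda>s. symp_cmp n (case_bool p q s)" "\<lambda>s. symp_cd n (case_bool p q s)" "alt_space n \<times>\<^sub>V alt_space n" "psi D"
    unfolding D_def by (rule symplectic_model) (use n in auto)
  have W: "m.W = space_W D" by (simp add: m.W_def D_def pair_Sp_O_def)
  obtain z0 where z0: "z0 \<in> points (alt_space n \<times>\<^sub>V alt_space n)" "Orb = orbit (GL n) (act_s' D) z0"
    using Orb by (auto simp: nilpotent_orbits_def orbits_def D_def pair_Sp_O_def)
  have "Orb = m.orb z0"
    unfolding z0(2) by (cases z0) (auto simp: orbit_def m.orb_def D_def pair_Sp_O_def)
  then have I: "fiber_ideal m.W (psi D) (alt_space n \<times>\<^sub>V alt_space n) (zariski (alt_space n \<times>\<^sub>V alt_space n) closure_of m.orb z0) =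
      closure_fiber_ideal D Orb"
    unfolding W by (simp add: closure_fiber_ideal_def D_def pair_Sp_O_def)
  have "m.\<Omega> v = orbit (grp_K D \<times>\<times> grp_K' D) (act_W D) v" for v
  proof (intro equalityI subsetI)
    obtain A B where v: "v = (A, B)" by (cases v)
    fix x
    assume "x \<in> m.\<Omega> v"
    then obtain k l g where *: "k \<in> isometries (2 * p) (J_mat p)" "l \<in> isometries (2 * q) (J_mat q)"
      "g \<in> carrier (GL n)" "x = (k * A * g\<^sup>T, l * B * gl_inv g)" by (auto simp: m.\<Omega>_def v)
    \<comment> \<open>Taking inverse transposes is an involution, so \<open>l'\<close> is the group
      element that acts on the second factor as \<open>l\<close>.\<close>
    define l' where "l' = (gl_inv l)\<^sup>T"
    have "l' \<in> isometries (2 * q) (J_mat q)" "(gl_inv l')\<^sup>T = l"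
      using symplectic_contragredient[OF *(2)] gl_inv_transpose(2)[OF isometries_J_GL[OF *(2)]] by (simp_all add: l'_def)
    then have "x = act_W D ((k, l'), g) v" "((k, l'), g) \<in> carrier (grp_K D \<times>\<times> grp_K' D)"
      using * by (simp_all add: v D_def pair_Sp_O_def DirProd_def carrier_Sp_group)
    then show "x \<in> orbit (grp_K D \<times>\<times> grp_K' D) (act_W D) v" by (auto simp: orbit_def)
  next
    obtain A B where v: "v = (A, B)" by (cases v)
    fix x
    assume "x \<in> orbit (grp_K D \<times>\<times> grp_K' D) (act_W D) v"
    then obtain k l g where *: "k \<in> isometries (2 * p) (J_mat p)" "l \<in> isometries (2 * q) (J_mat q)"
      "g \<in> carrier (GL n)" "x = (k * A * g\<^sup>T, (gl_inv l)\<^sup>T * B * gl_inv g)"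
      by (auto simp: orbit_def v D_def pair_Sp_O_def DirProd_def carrier_Sp_group)
    then show "x \<in> m.\<Omega> v" using symplectic_contragredient[OF *(2)] by (auto simp: m.\<Omega>_def v)
  qed
  with m.form_fiber[OF z0(1)] show ?thesis unfolding I unfolding W by auto
qed

subsection \<open>General linear groups\<close>

lemma U_U_fiber:
  assumes n: "0 < m" "0 < n" "m + n \<le> min p q" and Orb: "Orb \<in> nilpotent_orbits (pair_U_U p q m n)"
  defines "D \<equiv> pair_U_U p q m n"
  shows "reduced_irreducible_closed_subvariety (space_W D) (closure_fiber_ideal D Orb) \<and>
    (\<exists>w\<in>points (space_W D). zero_locus (space_W D) (closure_fiber_ideal D Orb) =
      zariski (space_W D) closure_of orbit (grp_K D \<times>\<times> grp_K' D) (act_W D) w)"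
proof -
  interpret m: pairing_model p q m n by standard (use n in auto)
  have eqs: "m.W = space_W D" "m.Sv = space_s' D" "m.\<psi> = psi D"
    by (simp_all add: m.W_def m.Sv_def m.\<psi>_def D_def pair_U_U_def)
  obtain z0 where z0: "z0 \<in> points m.Sv" "Orb = orbit (GL m \<times>\<times> GL n) (act_s' D) z0"
    using Orb by (auto simp: nilpotent_orbits_def orbits_def D_def pair_U_U_def m.Sv_def)
  have "Orb = m.orb z0"
    unfolding z0(2) by (cases z0) (force simp: orbit_def m.orb_def D_def pair_U_U_def DirProd_def)
  then have I: "fiber_ideal m.W m.\<psi> m.Sv (zariski m.Sv closure_of m.orb z0) = closure_fiber_ideal D Orb"
    unfolding eqs by (simp add: closure_fiber_ideal_def)
  have act: "act_W D ((g1, g2), (h1, h2)) v = m.act g1 g2 h1 h2 v" for g1 g2 h1 h2 v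
    by (cases v) (simp add: m.act_def D_def pair_U_U_def split: prod.split)
  have grps: "carrier (grp_K D \<times>\<times> grp_K' D) =
      (carrier (GL p) \<times> carrier (GL q)) \<times> (carrier (GL m) \<times> carrier (GL n))"
    by (simp add: DirProd_def D_def pair_U_U_def)
  have orbit: "m.\<Omega> v = orbit (grp_K D \<times>\<times> grp_K' D) (act_W D) v" for v
  proof (intro equalityI subsetI)
    fix x assume "x \<in> m.\<Omega> v"
    then obtain g1 g2 h1 h2 where "g1 \<in> carrier (GL p)" "g2 \<in> carrier (GL q)" "h1 \<in> carrier (GL m)"
      "h2 \<in> carrier (GL n)" "x = m.act g1 g2 h1 h2 v" unfolding m.\<Omega>_def by blast
    then show "x \<in> orbit (grp_K D \<times>\<times> grp_K' D) (act_W D) v"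
      unfolding orbit_def grps act[symmetric] by (intro CollectI exI[where x = "((g1, g2), (h1, h2))"]) simp
  next
    fix x assume "x \<in> orbit (grp_K D \<times>\<times> grp_K' D) (act_W D) v"
    then obtain g1 g2 h1 h2 where "g1 \<in> carrier (GL p)" "g2 \<in> carrier (GL q)" "h1 \<in> carrier (GL m)"
      "h2 \<in> carrier (GL n)" "x = act_W D ((g1, g2), (h1, h2)) v" unfolding orbit_def grps by blast
    then show "x \<in> m.\<Omega> v" unfolding m.\<Omega>_def act by blast
  qed
  obtain v where v: "v \<in> points m.W"
    "reduced_irreducible_closed_subvariety m.W (closure_fiber_ideal D Orb)"
    "zero_locus m.W (closure_fiber_ideal D Orb) = zariski m.W closure_of m.\<Omega> v"
    using m.pairing_fiber[OF z0(1), unfolded I] by (elim bexE conjE)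
  note w = v[unfolded eqs(1) orbit]
  show ?thesis by (intro conjI bexI[where x = v] w)
qed

theorem theorem1:
  fixes p q m n :: nat
  assumes "p > 0" and "q > 0" and "m > 0" and "n > 0"
  shows
    "(2 * n < min p q \<longrightarrow>
       (let D = pair_O_Sp p q n in
         \<forall>Orb \<in> nilpotent_orbits D.
           reduced_irreducible_closed_subvariety (space_W D) (closure_fiber_ideal D Orb) \<and>
           (\<exists>w \<in> points (space_W D).
              zero_locus (space_W D) (closure_fiber_ideal D Orb) =
              zariski (space_W D) closure_of orbit (grp_K D \<times>\<times> grp_K' D) (act_W D) w)))
     \<and>
     (m + n \<le> min p q \<longrightarrow>
       (let D = pair_U_U p q m n in
         \<forall>Orb \<in> nilpotent_orbits D.
           reduced_irreducible_closed_subvariety (space_W D) (closure_fiber_ideal D Orb) \<and>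
           (\<exists>w \<in> points (space_W D).
              zero_locus (space_W D) (closure_fiber_ideal D Orb) =
              zariski (space_W D) closure_of orbit (grp_K D \<times>\<times> grp_K' D) (act_W D) w)))
     \<and>
     (n \<le> min p q \<longrightarrow>
       (let D = pair_Sp_O p q n in
         \<forall>Orb \<in> nilpotent_orbits D.
           reduced_irreducible_closed_subvariety (space_W D) (closure_fiber_ideal D Orb) \<and>
           (\<exists>w \<in> points (space_W D).
              zero_locus (space_W D) (closure_fiber_ideal D Orb) =
              zariski (space_W D) closure_of orbit (grp_K D \<times>\<times> grp_K' D) (act_W D) w)))"
  unfolding Let_def using O_Sp_fiber[OF assms(4)] U_U_fiber[OF assms(3,4)] Sp_O_fiber[OF assms(4)]
  by (intro conjI impI ballI) simp_all

end
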